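(* Let $G$ be a group, $P$ a finite $p$-subgroup of $G$, and let $A$ and $A'$ be two $G$-interior $\mathcal{O}$-algebras such that $A'$ has a $P\times P$-invariant $\mathcal{O}$-basis. Let $K$ be a subgroup of $\operatorname{Aut}(P)$. 1) There is an isomorphism $$\bar N^K_{A\otimes_{\mathcal{O}}A'}(P)\simeq\Delta\big(\bar N_A^K(P)\otimes_k\bar N_{A'}^K(P)\big)$$ of $K$-graded $N_G^K(P)$-interior algebras. 2) Assume in addition that, as $K$-graded $N_G^K(P)$-interior algebras, $\bar N_A^K(P)\simeq A(P)\otimes_k kK$. Then $$\bar N^K_{A\otimes_{\mathcal{O}}A'}(P)\simeq A(P)\otimes_k\bar N_{A'}^K(P)$$ as $K$-graded $N_G^K(P)$-interior algebras.
   Context: $\mathcal{O}$ is a complete discrete valuation ring with maximal ideal $J(\mathcal{O})$ and residue field $k$ of characteristic $p>0$. A $G$-interior algebra is an $\mathcal{O}$-algebra $A$ with a unital algebra homomorphism $\mathcal{O}G\to A$; it is an $\mathcal{O}(P\times P)$-module by left and right multiplication, and a $P\times P$-invariant basis is an $\mathcal{O}$-basis permuted by left and right multiplication by elements of $P$. $A\otimes_{\mathcal{O}}A'$ is $G$-interior via $g\mapsto g\otimes g$. Convention: the product in $\operatorname{Aut}(P)$ is $\varphi\psi:=\psi\circ\varphi$ (first apply $\varphi$). For $x\in N_G(P)$ let $\varphi_x(u)=x^{-1}ux$; $N_G^K(P)=\{x\in N_G(P)\mid\varphi_x\in K\}$. For $\varphi\in\operatorname{Aut}(P)$ and $Q\le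 P$ put $A^{\Delta_\varphi(Q)}=\{a\in A\mid ua=a\varphi(u)\ \forall u\in Q\}$; for $Q<P$ let $A_{\Delta_\varphi(Q)}^{\Delta_\varphi(P)}$ be the set of elements $\sum_{u\in[Q\backslash P]}u^{-1}c\varphi(u)$ with $c\in A^{\Delta_\varphi(Q)}$ (sum over representatives of the cosets $Qu$). Put $A(\Delta_\varphi(P))=A^{\Delta_\varphi(P)}/(\sum_{Q<P}A^{\Delta_\varphi(P)}_{\Delta_\varphi(Q)}+J(\mathcal{O})A^{\Delta_\varphi(P)})$, $A(P)=A(\Delta_{\mathrm{id}}(P))$, and $\bar N_A^K(P)=\bigoplus_{\varphi\in K}A(\Delta_\varphi(P))$. It is a $K$-graded $k$-algebra with multiplication induced by that of $A$ (if $a\in A^{\Delta_\varphi(P)}$, $b\in A^{\Delta_\psi(P)}$ then $ab\in A^{\Delta_{\varphi\psi}(P)}$), and it is $N_G^K(P)$-interior by sending $x$ to the class of the image of $x$ in the $\varphi_x$-component. For two $K$-graded algebras $C=\bigoplus_{\varphi\in K} C_\varphi$, $C'=\bigoplus_{\varphi\in K} C'_\varphi$, the diagonal subalgebra of the $K\times K$-graded algebra $C\otimes_kC'$ is the $K$-graded algebra $\Delta(C\otimes_k C')=\bigoplus_{\varphi\in K}C_\varphi\otimes_k C'_\varphi$; when $C,C'$ are $N_G^K(P)$-interior with $x$ mapped into degree $\varphi_x$, it is $N_G^K(P)$-interior via $x\mapsto x\otimes x$. In 2), $A(P)\otimes_kkK$ is the tensor product algebra graded by $\varphi\mapsto A(P)\otimes\varphi$;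 the hypothesis means that there is a group homomorphism $\sigma:N_G^K(P)\to A(P)^\times$ (making $A(P)$ an $N_G^K(P)$-interior algebra) such that $\bar N_A^K(P)\simeq A(P)\otimes_kkK$ as $K$-graded algebras with the image of $x$ corresponding to $\sigma(x)\otimes\varphi_x$. In the conclusion, $A(P)\otimes_k\bar N_{A'}^K(P)$ is the tensor product algebra with $K$-grading coming from the second factor and interior structure $x\mapsto\sigma(x)\otimes x$. *)

theory Defs
  imports "HOL-Algebra.Algebra"
begin

section \<open>Complete discrete valuation rings\<close>

text \<open>\<^const>\<open>ideals_set\<close> is the monoid of ideals under the ideal product, so a power of \<open>J\<close> in it
  is the usual power of the ideal \<open>J\<close>. The last two assumptions say that the canonical map from
  \<open>R\<close> to the inverse limit of the rings \<open>R / J^n\<close> is bijective.\<close>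

locale complete_dvr = principal_domain R + maximalideal J R for R (structure) and J +
  assumes unique_maximalideal: "maximalideal M R \<Longrightarrow> M = J"
    and maximalideal_nonzero: "J \<noteq> {\<zero>}"
    and separated: "(\<Inter>n::nat. J [^]\<^bsub>ideals_set R\<^esub> n) = {\<zero>}"
    and complete: "s \<in> (UNIV :: nat set) \<rightarrow> carrier R \<Longrightarrow>
      (\<And>n::nat. \<exists>N. \<forall>i\<ge>N. \<forall>j\<ge>N. s i \<ominus> s j \<in> J [^]\<^bsub>ideals_set R\<^esub> n) \<Longrightarrow>
      \<exists>l\<in>carrier R. \<forall>n::nat. \<exists>N. \<forall>i\<ge>N. s i \<ominus> l \<in> J [^]\<^bsub>ideals_set R\<^esub> n"

definition ring_characteristic :: "('a, 'm) ring_scheme \<Rightarrow> nat" where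
  "ring_characteristic R =
     (if \<exists>n::nat. n > 0 \<and> add_pow R n \<one>\<^bsub>R\<^esub> = \<zero>\<^bsub>R\<^esub>
      then LEAST n::nat. n > 0 \<and> add_pow R n \<one>\<^bsub>R\<^esub> = \<zero>\<^bsub>R\<^esub> else 0)"


section \<open>Associative algebras, bases, monoid algebras\<close>

text \<open>The library locale \<^locale>\<open>algebra\<close> requires commutative multiplication.\<close>

locale assoc_algebra = module R A + ring A for R and A (structure) +
  assumes smult_mult_left: "r \<in> carrier R \<Longrightarrow> x \<in> carrier A \<Longrightarrow> y \<in> carrier A \<Longrightarrow>
      (r \<odot> x) \<otimes> y = r \<odot> (x \<otimes> y)"
    and smult_mult_right: "r \<in> carrier R \<Longrightarrow> x \<in> carrier A \<Longrightarrow> y \<in> carrier A \<Longrightarrow>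
      x \<otimes> (r \<odot> y) = r \<odot> (x \<otimes> y)"

definition alg_hom ::
  "('r, 'm) ring_scheme \<Rightarrow> ('r, 'a, 'c) module_scheme \<Rightarrow> ('r, 'b, 'd) module_scheme \<Rightarrow> ('a \<Rightarrow> 'b) set"
  where "alg_hom R A B =
    {h \<in> ring_hom A B. \<forall>r\<in>carrier R. \<forall>a\<in>carrier A. h (r \<odot>\<^bsub>A\<^esub> a) = r \<odot>\<^bsub>B\<^esub> h a}"

definition submodule_span ::
  "('r, 'm) ring_scheme \<Rightarrow> ('r, 'a, 'c) module_scheme \<Rightarrow> 'a set \<Rightarrow> 'a set"
  where "submodule_span R M S = \<Inter>{H. submodule H R M \<and> S \<subseteq> H}"

definition finsupp :: "('r, 'm) ring_scheme \<Rightarrow> 'x set \<Rightarrow> ('x \<Rightarrow> 'r) set" where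
  "finsupp R S = {f. (\<forall>x. f x \<in> carrier R) \<and> {x. f x \<noteq> \<zero>\<^bsub>R\<^esub>} \<subseteq> S \<and> finite {x. f x \<noteq> \<zero>\<^bsub>R\<^esub>}}"

definition single :: "('r, 'm) ring_scheme \<Rightarrow> 'x \<Rightarrow> 'x \<Rightarrow> 'r" where
  "single R x = (\<lambda>y. if y = x then \<one>\<^bsub>R\<^esub> else \<zero>\<^bsub>R\<^esub>)"

text \<open>The linear extension of a map \<open>s\<close> to finitely supported coefficient functions.\<close>

definition lin_ext ::
  "('r, 'm) ring_scheme \<Rightarrow> ('r, 'a, 'c) module_scheme \<Rightarrow> ('x \<Rightarrow> 'a) \<Rightarrow> ('x \<Rightarrow> 'r) \<Rightarrow> 'a"
  where "lin_ext R M s f = (\<Oplus>\<^bsub>M\<^esub>x\<in>{x. f x \<noteq> \<zero>\<^bsub>R\<^esub>}. f x \<odot>\<^bsub>M\<^esub> s x)"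

definition module_basis ::
  "('r, 'm) ring_scheme \<Rightarrow> ('r, 'a, 'c) module_scheme \<Rightarrow> 'a set \<Rightarrow> bool"
  where "module_basis R M B \<longleftrightarrow>
    B \<subseteq> carrier M \<and> bij_betw (lin_ext R M (\<lambda>b. b)) (finsupp R B) (carrier M)"

definition monoid_algebra ::
  "('r, 'm) ring_scheme \<Rightarrow> ('x, 'n) monoid_scheme \<Rightarrow> ('r, 'x \<Rightarrow> 'r) module"
  where "monoid_algebra R M =
    \<lparr>carrier = finsupp R (carrier M),
     monoid.mult = (\<lambda>f g z. \<Oplus>\<^bsub>R\<^esub>w\<in>{(x, y). f x \<noteq> \<zero>\<^bsub>R\<^esub> \<and> g y \<noteq> \<zero>\<^bsub>R\<^esub> \<and> x \<otimes>\<^bsub>M\<^esub> y = z}.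
        f (fst w) \<otimes>\<^bsub>R\<^esub> g (snd w)),
     one = single R \<one>\<^bsub>M\<^esub>,
     ring.zero = (\<lambda>_. \<zero>\<^bsub>R\<^esub>),
     ring.add = (\<lambda>f g z. f z \<oplus>\<^bsub>R\<^esub> g z),
     module.smult = (\<lambda>r f z. r \<otimes>\<^bsub>R\<^esub> f z)\<rparr>"


section \<open>Tensor products of algebras\<close>

text \<open>\<open>A \<otimes> B\<close> is the free module on \<open>A \<times> B\<close> modulo the bilinearity relations. The product
  \<open>(a \<otimes> b)(a' \<otimes> b') = aa' \<otimes> bb'\<close> is the one induced by the convolution product of the monoid
  algebra of the multiplicative monoid \<open>A \<times> B\<close>.\<close>

definition tensor_relators ::
  "('r, 'm) ring_scheme \<Rightarrow> ('r, 'a, 'c) module_scheme \<Rightarrow> ('r, 'b, 'd) module_scheme \<Rightarrow>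
   ('a \<times> 'b \<Rightarrow> 'r) set"
  where "tensor_relators R A B = (let U = monoid_algebra R (A \<times>\<times> B); e = single R in
      {e (a \<oplus>\<^bsub>A\<^esub> a', b) \<ominus>\<^bsub>U\<^esub> (e (a, b) \<oplus>\<^bsub>U\<^esub> e (a', b)) | a a' b.
         a \<in> carrier A \<and> a' \<in> carrier A \<and> b \<in> carrier B}
    \<union> {e (a, b \<oplus>\<^bsub>B\<^esub> b') \<ominus>\<^bsub>U\<^esub> (e (a, b) \<oplus>\<^bsub>U\<^esub> e (a, b')) | a b b'.
         a \<in> carrier A \<and> b \<in> carrier B \<and> b' \<in> carrier B}
    \<union> {e (r \<odot>\<^bsub>A\<^esub> a, b) \<ominus>\<^bsub>U\<^esub> (r \<odot>\<^bsub>U\<^esub> e (a, b)) | r a b.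
         r \<in> carrier R \<and> a \<in> carrier A \<and> b \<in> carrier B}
    \<union> {e (a, r \<odot>\<^bsub>B\<^esub> b) \<ominus>\<^bsub>U\<^esub> (r \<odot>\<^bsub>U\<^esub> e (a, b)) | r a b.
         r \<in> carrier R \<and> a \<in> carrier A \<and> b \<in> carrier B})"

definition tensor_kernel ::
  "('r, 'm) ring_scheme \<Rightarrow> ('r, 'a, 'c) module_scheme \<Rightarrow> ('r, 'b, 'd) module_scheme \<Rightarrow>
   ('a \<times> 'b \<Rightarrow> 'r) set"
  where "tensor_kernel R A B =
    submodule_span R (monoid_algebra R (A \<times>\<times> B)) (tensor_relators R A B)"

definition tensor ::
  "('r, 'm) ring_scheme \<Rightarrow> ('r, 'a, 'c) module_scheme \<Rightarrow> ('r, 'b, 'd) module_scheme \<Rightarrow>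
   ('r, ('a \<times> 'b \<Rightarrow> 'r) set) module"
  where "tensor R A B = (let U = monoid_algebra R (A \<times>\<times> B); I = tensor_kernel R A B in
    ring.extend (U Quot I) (module.fields (\<lambda>r C. \<Union>x\<in>C. I +>\<^bsub>U\<^esub> (r \<odot>\<^bsub>U\<^esub> x))))"

definition pure_tensor ::
  "('r, 'm) ring_scheme \<Rightarrow> ('r, 'a, 'c) module_scheme \<Rightarrow> ('r, 'b, 'd) module_scheme \<Rightarrow>
   'a \<Rightarrow> 'b \<Rightarrow> ('a \<times> 'b \<Rightarrow> 'r) set"
  where "pure_tensor R A B a b =
    tensor_kernel R A B +>\<^bsub>monoid_algebra R (A \<times>\<times> B)\<^esub> single R (a, b)"


section \<open>Interior algebras and graded interior algebras\<close>

text \<open>\<open>structural\<close> is the structural homomorphism from the group algebra; a group element \<open>g\<close> is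
  embedded there as \<open>single R g\<close>, and \<open>gimage\<close> is its image. \<open>homcomp\<close> is the family of homogeneous
  components.\<close>

record ('r, 'a, 'g) interior = "('r, 'a) module" +
  structural :: "('g \<Rightarrow> 'r) \<Rightarrow> 'a"

record ('r, 'a, 'g, 'd) graded_interior = "('r, 'a, 'g) interior" +
  homcomp :: "'d \<Rightarrow> 'a set"

locale interior_algebra = assoc_algebra R A + G?: group G
  for R :: "('r, 'm) ring_scheme" and G :: "('g, 'n) monoid_scheme"
    and A :: "('r, 'a, 'g, 'c) interior_scheme" (structure) +
  assumes structural_hom: "structural A \<in> alg_hom R (monoid_algebra R G) A"

definition gimage ::
  "('r, 'm) ring_scheme \<Rightarrow> ('r, 'a, 'g, 'c) interior_scheme \<Rightarrow> 'g \<Rightarrow> 'a"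
  where "gimage R A g = structural A (single R g)"

text \<open>The interior structure determined by its values \<open>s g\<close> on group elements.\<close>

definition make_interior ::
  "('r, 'm) ring_scheme \<Rightarrow> ('r, 'a) module \<Rightarrow> ('g \<Rightarrow> 'a) \<Rightarrow> ('r, 'a, 'g) interior"
  where "make_interior R M s = module.extend M (interior.fields (lin_ext R M s))"

definition make_graded_interior ::
  "('r, 'm) ring_scheme \<Rightarrow> ('r, 'a) module \<Rightarrow> ('g \<Rightarrow> 'a) \<Rightarrow> ('d \<Rightarrow> 'a set) \<Rightarrow>
   ('r, 'a, 'g, 'd) graded_interior"
  where "make_graded_interior R M s D =
    interior.extend (make_interior R M s) (graded_interior.fields D)"

definition tensor_interior ::
  "('r, 'm) ring_scheme \<Rightarrow> ('r, 'a, 'g, 'c) interior_scheme \<Rightarrow> ('r, 'b, 'g, 'd) interior_scheme \<Rightarrow>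
   ('r, ('a \<times> 'b \<Rightarrow> 'r) set, 'g) interior"
  where "tensor_interior R A B =
    make_interior R (tensor R A B) (\<lambda>g. pure_tensor R A B (gimage R A g) (gimage R B g))"

definition graded_interior_iso ::
  "('r, 'm) ring_scheme \<Rightarrow> ('g, 'n) monoid_scheme \<Rightarrow> 'd set \<Rightarrow>
   ('r, 'a, 'g, 'd, 'c) graded_interior_scheme \<Rightarrow> ('r, 'b, 'g, 'd, 'e) graded_interior_scheme \<Rightarrow>
   ('a \<Rightarrow> 'b) set"
  where "graded_interior_iso R N K C D =
    {F \<in> alg_hom R C D. bij_betw F (carrier C) (carrier D) \<and>
       (\<forall>\<phi>\<in>K. F ` homcomp C \<phi> = homcomp D \<phi>) \<and>
       (\<forall>f\<in>carrier (monoid_algebra R N). F (structural C f) = structural D f)}"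

definition diagonal_subalgebra ::
  "('r, 'm) ring_scheme \<Rightarrow> 'd set \<Rightarrow>
   ('r, 'a, 'g, 'd, 'c) graded_interior_scheme \<Rightarrow> ('r, 'b, 'g, 'd, 'e) graded_interior_scheme \<Rightarrow>
   ('r, ('a \<times> 'b \<Rightarrow> 'r) set, 'g, 'd) graded_interior"
  where "diagonal_subalgebra R K C D =
    (let T = tensor R C D;
         E = (\<lambda>\<phi>. submodule_span R T {pure_tensor R C D c d | c d. c \<in> homcomp C \<phi> \<and> d \<in> homcomp D \<phi>})
     in make_graded_interior R (T\<lparr>carrier := submodule_span R T (\<Union>\<phi>\<in>K. E \<phi>)\<rparr>)
          (\<lambda>x. pure_tensor R C D (gimage R C x) (gimage R D x)) E)"

text \<open>\<open>B \<otimes> D\<close> for a graded interior algebra \<open>D\<close> and an algebra \<open>B\<close> that is interior via \<open>\<sigma>\<close>: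
  the grading comes from \<open>D\<close>, the interior structure is \<open>x \<mapsto> \<sigma> x \<otimes> x\<close>.\<close>

definition tensor_graded_interior ::
  "('r, 'm) ring_scheme \<Rightarrow> ('r, 'a, 'c) module_scheme \<Rightarrow> ('g \<Rightarrow> 'a) \<Rightarrow>
   ('r, 'b, 'g, 'd, 'e) graded_interior_scheme \<Rightarrow>
   ('r, ('a \<times> 'b \<Rightarrow> 'r) set, 'g, 'd) graded_interior"
  where "tensor_graded_interior R B \<sigma> D =
    make_graded_interior R (tensor R B D)
      (\<lambda>x. pure_tensor R B D (\<sigma> x) (gimage R D x))
      (\<lambda>\<phi>. submodule_span R (tensor R B D)
              {pure_tensor R B D b d | b d. b \<in> carrier B \<and> d \<in> homcomp D \<phi>})"


section \<open>Brauer quotients\<close>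

text \<open>\<open>Aut(P)\<close> with the product \<open>\<phi>\<psi> = \<psi> \<circ> \<phi>\<close>, opposite to that of \<^const>\<open>AutoGroup\<close>.\<close>

definition aut_group :: "('g, 'n) monoid_scheme \<Rightarrow> 'g set \<Rightarrow> ('g \<Rightarrow> 'g) monoid" where
  "aut_group G P = (let H = AutoGroup (G\<lparr>carrier := P\<rparr>) in H\<lparr>monoid.mult := \<lambda>\<phi> \<psi>. \<psi> \<otimes>\<^bsub>H\<^esub> \<phi>\<rparr>)"

definition conj_aut :: "('g, 'n) monoid_scheme \<Rightarrow> 'g set \<Rightarrow> 'g \<Rightarrow> 'g \<Rightarrow> 'g" where
  "conj_aut G P x = (\<lambda>u\<in>P. inv\<^bsub>G\<^esub> x \<otimes>\<^bsub>G\<^esub> u \<otimes>\<^bsub>G\<^esub> x)"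

definition normalizer_in :: "('g, 'n) monoid_scheme \<Rightarrow> 'g set \<Rightarrow> ('g \<Rightarrow> 'g) set \<Rightarrow> ('g, 'n) monoid_scheme"
  where "normalizer_in G P K = G\<lparr>carrier := {x \<in> normalizer G P. conj_aut G P x \<in> K}\<rparr>"

definition twisted_fixed ::
  "('r, 'm) ring_scheme \<Rightarrow> ('r, 'a, 'g, 'c) interior_scheme \<Rightarrow> ('g \<Rightarrow> 'g) \<Rightarrow> 'g set \<Rightarrow> 'a set"
  where "twisted_fixed R A \<phi> Q =
    {a \<in> carrier A. \<forall>u\<in>Q. gimage R A u \<otimes>\<^bsub>A\<^esub> a = a \<otimes>\<^bsub>A\<^esub> gimage R A (\<phi> u)}"

text \<open>For \<open>c\<close> in \<open>twisted_fixed R A \<phi> Q\<close> the summand does not depend on the chosen representative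
  of the right coset \<open>Qu\<close>.\<close>

definition twisted_trace ::
  "('r, 'm) ring_scheme \<Rightarrow> ('g, 'n) monoid_scheme \<Rightarrow> ('r, 'a, 'g, 'c) interior_scheme \<Rightarrow>
   'g set \<Rightarrow> ('g \<Rightarrow> 'g) \<Rightarrow> 'g set \<Rightarrow> 'a \<Rightarrow> 'a"
  where "twisted_trace R G A P \<phi> Q c =
    (\<Oplus>\<^bsub>A\<^esub>C\<in>rcosets\<^bsub>G\<lparr>carrier := P\<rparr>\<^esub> Q.
       let u = (SOME u. u \<in> C) in gimage R A (inv\<^bsub>G\<^esub> u) \<otimes>\<^bsub>A\<^esub> c \<otimes>\<^bsub>A\<^esub> gimage R A (\<phi> u))"

definition brauer_kernel ::
  "('r, 'm) ring_scheme \<Rightarrow> 'r set \<Rightarrow> ('g, 'n) monoid_scheme \<Rightarrow> 'g set \<Rightarrow>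
   ('r, 'a, 'g, 'c) interior_scheme \<Rightarrow> ('g \<Rightarrow> 'g) \<Rightarrow> 'a set"
  where "brauer_kernel R J G P A \<phi> =
    submodule_span R (A\<lparr>carrier := twisted_fixed R A \<phi> P\<rparr>)
      ((\<Union>Q\<in>{Q. subgroup Q (G\<lparr>carrier := P\<rparr>) \<and> Q \<noteq> P}.
          twisted_trace R G A P \<phi> Q ` twisted_fixed R A \<phi> Q)
       \<union> {r \<odot>\<^bsub>A\<^esub> a | r a. r \<in> J \<and> a \<in> twisted_fixed R A \<phi> P})"

text \<open>\<open>A(\<Delta>\<^sub>\<phi>(P))\<close> as a module over \<open>R / J\<close>. Its fields \<open>mult\<close> and \<open>one\<close> are meaningful only when
  \<open>\<phi>\<close> is the identity, where they give the algebra structure of \<open>A(P)\<close>.\<close>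

definition brauer_quotient ::
  "('r, 'm) ring_scheme \<Rightarrow> 'r set \<Rightarrow> ('g, 'n) monoid_scheme \<Rightarrow> 'g set \<Rightarrow>
   ('r, 'a, 'g, 'c) interior_scheme \<Rightarrow> ('g \<Rightarrow> 'g) \<Rightarrow> ('r set, 'a set) module"
  where "brauer_quotient R J G P A \<phi> = (let I = brauer_kernel R J G P A \<phi> in
    ring.extend (A\<lparr>carrier := twisted_fixed R A \<phi> P\<rparr> Quot I)
      (module.fields (\<lambda>c C. \<Union>r\<in>c. \<Union>a\<in>C. I +>\<^bsub>A\<^esub> (r \<odot>\<^bsub>A\<^esub> a))))"

text \<open>The algebra \<open>\<Oplus>\<^sub>\<phi>\<^sub>\<in>\<^sub>K A(\<Delta>\<^sub>\<phi>(P))\<close>. The product of the classes of \<open>a\<close> in degree \<open>\<phi>\<close> and \<open>b\<close> in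
  degree \<open>\<psi>\<close> is the class of \<open>ab\<close> in degree \<open>\<phi>\<psi>\<close>, which is what \<^const>\<open>rcoset_mult\<close> computes.\<close>

definition brauer_algebra ::
  "('r, 'm) ring_scheme \<Rightarrow> 'r set \<Rightarrow> ('g, 'n) monoid_scheme \<Rightarrow> 'g set \<Rightarrow> ('g \<Rightarrow> 'g) set \<Rightarrow>
   ('r, 'a, 'g, 'c) interior_scheme \<Rightarrow> ('r set, ('g \<Rightarrow> 'g) \<Rightarrow> 'a set) module"
  where "brauer_algebra R J G P K A =
    (let B = brauer_quotient R J G P A; I = brauer_kernel R J G P A;
         S = sum_group K (\<lambda>\<phi>. add_monoid (B \<phi>)); H = aut_group G P in
     \<lparr>carrier = carrier S,
      monoid.mult = (\<lambda>f g. \<lambda>\<chi>\<in>K. \<Oplus>\<^bsub>B \<chi>\<^esub>w\<in>{(\<phi>, \<psi>). \<phi> \<in> K \<and> \<psi> \<in> K \<and> \<phi> \<otimes>\<^bsub>H\<^esub> \<psi> = \<chi>}.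
        rcoset_mult A (I \<chi>) (f (fst w)) (g (snd w))),
      one = (\<lambda>\<phi>\<in>K. if \<phi> = \<one>\<^bsub>H\<^esub> then I \<phi> +>\<^bsub>A\<^esub> \<one>\<^bsub>A\<^esub> else \<zero>\<^bsub>B \<phi>\<^esub>),
      ring.zero = \<one>\<^bsub>S\<^esub>,
      ring.add = monoid.mult S,
      module.smult = (\<lambda>c f. \<lambda>\<phi>\<in>K. c \<odot>\<^bsub>B \<phi>\<^esub> f \<phi>)\<rparr>)"

definition N_bar ::
  "('r, 'm) ring_scheme \<Rightarrow> 'r set \<Rightarrow> ('g, 'n) monoid_scheme \<Rightarrow> 'g set \<Rightarrow> ('g \<Rightarrow> 'g) set \<Rightarrow>
   ('r, 'a, 'g, 'c) interior_scheme \<Rightarrow> ('r set, ('g \<Rightarrow> 'g) \<Rightarrow> 'a set, 'g, 'g \<Rightarrow> 'g) graded_interior"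
  where "N_bar R J G P K A =
    (let B = brauer_quotient R J G P A; I = brauer_kernel R J G P A; M = brauer_algebra R J G P K A in
     make_graded_interior (R Quot J) M
       (\<lambda>x. \<lambda>\<phi>\<in>K. if \<phi> = conj_aut G P x then I \<phi> +>\<^bsub>A\<^esub> gimage R A x else \<zero>\<^bsub>B \<phi>\<^esub>)
       (\<lambda>\<phi>. {f \<in> carrier M. \<forall>\<psi>\<in>K. \<psi> \<noteq> \<phi> \<longrightarrow> f \<psi> = \<zero>\<^bsub>B \<psi>\<^esub>}))"

text \<open>The group algebra of \<open>K\<close> with its natural \<open>K\<close>-grading, interior via \<open>x \<mapsto> \<phi>\<^sub>x\<close>.\<close>

definition K_algebra ::
  "('k, 'm) ring_scheme \<Rightarrow> ('g, 'n) monoid_scheme \<Rightarrow> 'g set \<Rightarrow> ('g \<Rightarrow> 'g) set \<Rightarrow>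
   ('k, ('g \<Rightarrow> 'g) \<Rightarrow> 'k, 'g, 'g \<Rightarrow> 'g) graded_interior"
  where "K_algebra k G P K =
    (let M = monoid_algebra k (aut_group G P\<lparr>carrier := K\<rparr>) in
     make_graded_interior k M (\<lambda>x. single k (conj_aut G P x))
       (\<lambda>\<phi>. {c \<odot>\<^bsub>M\<^esub> single k \<phi> | c. c \<in> carrier k}))"

end

theory Submission
  imports Defs
begin

text \<open>For \<open>\<phi> \<in> K\<close> let \<open>u \<in> P\<close> act on \<open>A\<close> on the right by \<open>a \<mapsto> u\<inverse> a \<phi>(u)\<close>; the sets
  \<open>A\<^sup>\<Delta>\<close> are the fixed points and the Brauer kernel is spanned by traces from proper subgroups and \<open>J\<close>.
  The map \<open>[a] \<otimes> [b] \<mapsto> [a \<otimes> b]\<close> is well defined for all \<open>A\<close> and \<open>A'\<close>. The action permutes the given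
  basis \<open>Y\<close> of \<open>A'\<close>, and \<open>A \<otimes> A'\<close> is the direct sum of the \<open>A \<otimes> y\<close>. In a fixed element the
  non-trivial \<open>P\<close>-orbits on \<open>Y\<close> contribute traces from proper subgroups, so modulo the Brauer kernel
  only the \<open>P\<close>-fixed \<open>y\<close> matter; the coordinates at these \<open>y\<close> commute with traces, hence
  \<open>x \<mapsto> \<Sum>\<^sub>y [x\<^sub>y] \<otimes> [y]\<close> is an inverse. For the second part, an isomorphism \<open>F\<close> with \<open>A(P) \<otimes> kK\<close>
  writes each element of degree \<open>\<phi>\<close> as \<open>F\<inverse> (a \<otimes> \<phi>)\<close>, and \<open>F\<inverse> (a \<otimes> \<phi>) \<otimes> d \<mapsto> a \<otimes> d\<close> is the required
  isomorphism on the diagonal subalgebra.\<close>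

section \<open>Linear maps, spans and quotients\<close>

text \<open>The orbit step rests on stabilisers. In a fixed element the coordinates along the orbit
  of y are translates of a single coordinate fixed by the stabiliser Q of y, so they sum to its
  trace from Q; the orbit is non-trivial exactly when Q is proper, and then this trace lies in the
  Brauer kernel. Which y are fixed depends on \<phi>, so the inverse is built degree by degree and
  assembled over the finite group K.

  Both maps out of the diagonal subalgebra are first defined on the full tensor product of the
  graded algebras, by pairing components of equal degree. There they need not be multiplicative.
  Products, the grading and the inverse are compared only on pure tensors of elements of equal
  degree, which span the diagonal subalgebra, and linearity does the rest. In this way the ordinary
  universal property of the tensor product suffices. The first of the two isomorphisms is inverted
  at the end and composed with the second.\<close>

definition lin_hom ::
  "('r, 'm) ring_scheme \<Rightarrow> ('r, 'a, 'c) module_scheme \<Rightarrow> ('r, 'b, 'd) module_scheme \<Rightarrow> ('a \<Rightarrow> 'b) set"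
  where "lin_hom R M N = {h \<in> carrier M \<rightarrow> carrier N.
    (\<forall>x\<in>carrier M. \<forall>y\<in>carrier M. h (x \<oplus>\<^bsub>M\<^esub> y) = h x \<oplus>\<^bsub>N\<^esub> h y) \<and>
    (\<forall>r\<in>carrier R. \<forall>x\<in>carrier M. h (r \<odot>\<^bsub>M\<^esub> x) = r \<odot>\<^bsub>N\<^esub> h x)}"

definition bilin ::
  "('r, 'm) ring_scheme \<Rightarrow> ('r, 'a, 'c) module_scheme \<Rightarrow> ('r, 'b, 'd) module_scheme \<Rightarrow>
   ('r, 'e, 'f) module_scheme \<Rightarrow> ('a \<Rightarrow> 'b \<Rightarrow> 'e) set"
  where "bilin R A B M = {\<beta>. (\<forall>a\<in>carrier A. \<beta> a \<in> lin_hom R B M) \<and>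
    (\<forall>b\<in>carrier B. (\<lambda>a. \<beta> a b) \<in> lin_hom R A M)}"

lemma lin_homI:
  assumes "\<And>x. x \<in> carrier M \<Longrightarrow> h x \<in> carrier N"
    and "\<And>x y. x \<in> carrier M \<Longrightarrow> y \<in> carrier M \<Longrightarrow> h (x \<oplus>\<^bsub>M\<^esub> y) = h x \<oplus>\<^bsub>N\<^esub> h y"
    and "\<And>r x. r \<in> carrier R \<Longrightarrow> x \<in> carrier M \<Longrightarrow> h (r \<odot>\<^bsub>M\<^esub> x) = r \<odot>\<^bsub>N\<^esub> h x"
  shows "h \<in> lin_hom R M N"
  using assms by (simp add: lin_hom_def)

lemma lin_hom_closed: "h \<in> lin_hom R M N \<Longrightarrow> x \<in> carrier M \<Longrightarrow> h x \<in> carrier N"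
  and lin_hom_add: "h \<in> lin_hom R M N \<Longrightarrow> x \<in> carrier M \<Longrightarrow> y \<in> carrier M \<Longrightarrow>
    h (x \<oplus>\<^bsub>M\<^esub> y) = h x \<oplus>\<^bsub>N\<^esub> h y"
  and lin_hom_smult: "h \<in> lin_hom R M N \<Longrightarrow> r \<in> carrier R \<Longrightarrow> x \<in> carrier M \<Longrightarrow>
    h (r \<odot>\<^bsub>M\<^esub> x) = r \<odot>\<^bsub>N\<^esub> h x"
  by (auto simp: lin_hom_def)

lemma lin_hom_comp: "h \<in> lin_hom R M N \<Longrightarrow> g \<in> lin_hom R N L \<Longrightarrow> (\<lambda>x. g (h x)) \<in> lin_hom R M L"
  by (auto simp: lin_hom_def Pi_iff)

lemma lin_hom_zero:
  assumes "module R M" "module R N" "h \<in> lin_hom R M N"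
  shows "h \<zero>\<^bsub>M\<^esub> = \<zero>\<^bsub>N\<^esub>"
proof -
  interpret M: module R M by fact
  interpret N: module R N by fact
  have "h (\<zero>\<^bsub>R\<^esub> \<odot>\<^bsub>M\<^esub> \<zero>\<^bsub>M\<^esub>) = \<zero>\<^bsub>R\<^esub> \<odot>\<^bsub>N\<^esub> h \<zero>\<^bsub>M\<^esub>"
    using assms(3) by (intro lin_hom_smult) auto
  then show ?thesis
    using lin_hom_closed[OF assms(3), of "\<zero>\<^bsub>M\<^esub>"] by simp
qed

lemma lin_hom_neg:
  assumes "module R M" "module R N" "h \<in> lin_hom R M N" "x \<in> carrier M"
  shows "h (\<ominus>\<^bsub>M\<^esub> x) = \<ominus>\<^bsub>N\<^esub> h x"
proof -
  interpret M: module R M by fact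
  interpret N: module R N by fact
  have "h (\<ominus>\<^bsub>M\<^esub> x) \<oplus>\<^bsub>N\<^esub> h x = \<zero>\<^bsub>N\<^esub>"
    using assms by (simp flip: lin_hom_add[OF assms(3)] add: M.l_neg lin_hom_zero)
  then show ?thesis
    using N.minus_equality[of "h (\<ominus>\<^bsub>M\<^esub> x)" "h x"] lin_hom_closed[OF assms(3)] assms(4) by auto
qed

lemma lin_hom_minus:
  assumes "module R M" "module R N" "h \<in> lin_hom R M N" "x \<in> carrier M" "y \<in> carrier M"
  shows "h (x \<ominus>\<^bsub>M\<^esub> y) = h x \<ominus>\<^bsub>N\<^esub> h y"
proof -
  interpret M: module R M by fact
  show ?thesis
    unfolding a_minus_def using assms by (simp add: lin_hom_add[OF assms(3)] lin_hom_neg)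
qed

text \<open>Formulated for additive maps because the class map goes from a module over
  \<open>R\<close> to a module over \<open>R Quot J\<close>, and coordinates go from a module to the
  ring \<open>R\<close>.\<close>

lemma additive_finsum:
  assumes "abelian_group M" "abelian_group N"
    and "\<And>x. x \<in> carrier M \<Longrightarrow> h x \<in> carrier N"
    and "\<And>x y. x \<in> carrier M \<Longrightarrow> y \<in> carrier M \<Longrightarrow> h (x \<oplus>\<^bsub>M\<^esub> y) = h x \<oplus>\<^bsub>N\<^esub> h y"
    and "f \<in> S \<rightarrow> carrier M"
  shows "h (finsum M f S) = finsum N (\<lambda>i. h (f i)) S"
proof -
  interpret M: abelian_group M by fact
  interpret N: abelian_group N by fact
  have "h \<zero>\<^bsub>M\<^esub> \<oplus>\<^bsub>N\<^esub> h \<zero>\<^bsub>M\<^esub> = h \<zero>\<^bsub>M\<^esub>"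
    using assms(4)[of "\<zero>\<^bsub>M\<^esub>" "\<zero>\<^bsub>M\<^esub>"] by simp
  then have zero: "h \<zero>\<^bsub>M\<^esub> = \<zero>\<^bsub>N\<^esub>"
    using assms(3)[of "\<zero>\<^bsub>M\<^esub>"] by (metis M.zero_closed N.add.r_cancel_one')
  show ?thesis
    using assms(5)
  proof (induction S rule: infinite_finite_induct)
    case (insert i S)
    then show ?case
      using assms(3,4) by (simp add: Pi_iff)
  qed (use zero in auto)
qed

lemma lin_hom_finsum:
  assumes "module R M" "module R N" "h \<in> lin_hom R M N" "f \<in> S \<rightarrow> carrier M"
  shows "h (finsum M f S) = finsum N (\<lambda>i. h (f i)) S"
  using assms lin_hom_closed[OF assms(3)] lin_hom_add[OF assms(3)]
  by (intro additive_finsum) (auto simp: module_def)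

lemma (in abelian_monoid) finsum_superset:
  assumes "finite S" "T \<subseteq> S" "\<And>i. i \<in> S - T \<Longrightarrow> f i = \<zero>" "f \<in> S \<rightarrow> carrier G"
  shows "finsum G f T = finsum G f S"
  using add.finprod_mono_neutral_cong_left[OF assms(1-3) refl assms(4)]
  by (simp add: finsum_def)

lemma (in abelian_monoid) finsum_single:
  assumes "finite S" "i \<in> S" "f i \<in> carrier G" "\<And>j. j \<in> S \<Longrightarrow> j \<noteq> i \<Longrightarrow> f j = \<zero>"
  shows "finsum G f S = f i"
proof -
  have "f \<in> S \<rightarrow> carrier G"
    using assms(3,4) by (metis Pi_I zero_closed)
  with finsum_superset[of S "{i}" f] assms show ?thesis
    by simp
qed

section \<open>Submodules, spans and linear maps between them\<close>

lemma submodule_span_submodule: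
  assumes "module R M" "S \<subseteq> carrier M"
  shows "submodule (submodule_span R M S) R M"
proof -
  interpret module R M by fact
  have top: "carrier M \<in> {H. submodule H R M \<and> S \<subseteq> H}"
    using carrier_is_submodule assms(2) by simp
  note E = submoduleE
  have zero: "\<zero>\<^bsub>M\<^esub> \<in> H" if "submodule H R M" for H
    using subgroup.one_closed[OF submodule.axioms(1)[OF that]] by simp
  show ?thesis
    unfolding submodule_span_def
    by (rule submoduleI) (use top zero E in \<open>auto 0 4\<close>)
qed

lemma submodule_span_superset: "S \<subseteq> submodule_span R M S"
  by (auto simp: submodule_span_def)

lemma submodule_span_minimal: "submodule H R M \<Longrightarrow> S \<subseteq> H \<Longrightarrow> submodule_span R M S \<subseteq> H"
  by (auto simp: submodule_span_def)

lemma submodule_zero: "submodule H R M \<Longrightarrow> \<zero>\<^bsub>M\<^esub> \<in> H"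
  using subgroup.one_closed[OF submodule.axioms(1)] by force

lemma submodule_subset: "submodule H R M \<Longrightarrow> H \<subseteq> carrier M"
  using subgroup.subset[OF submodule.axioms(1)] by force

lemma submodule_add: "submodule H R M \<Longrightarrow> x \<in> H \<Longrightarrow> y \<in> H \<Longrightarrow> x \<oplus>\<^bsub>M\<^esub> y \<in> H"
  using subgroup.m_closed[OF submodule.axioms(1)] by force

lemma submodule_finsum:
  assumes "module R M" "submodule H R M" "f \<in> S \<rightarrow> H"
  shows "finsum M f S \<in> H"
proof -
  interpret module R M by fact
  note H = submodule_zero[OF assms(2)] submodule_subset[OF assms(2)] submodule_add[OF assms(2)]
  show ?thesis
    using assms(3)
  proof (induction S rule: infinite_finite_induct)
    case (insert x F)
    then have "finsum M f (insert x F) = f x \<oplus>\<^bsub>M\<^esub> finsum M f F"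
      using H(2) by (intro finsum_insert) (auto simp: Pi_iff)
    then show ?case
      using insert H(3) by (auto simp: Pi_iff)
  qed (use H in auto)
qed

lemma submodule_vimage:
  assumes "module R M" "module R N" "h \<in> lin_hom R M N" "submodule H R N"
  shows "submodule {x \<in> carrier M. h x \<in> H} R M"
proof -
  interpret M: module R M by fact
  interpret N: module R N by fact
  show ?thesis
    using submodule_zero[OF assms(4)] N.submoduleE[OF assms(4)] assms(1-3)
    by (intro M.submoduleI)
      (auto simp: lin_hom_zero lin_hom_neg lin_hom_add[OF assms(3)] lin_hom_smult[OF assms(3)])
qed

lemma submodule_image:
  assumes "module R M" "module R N" "h \<in> lin_hom R M N" "submodule H R M"
  shows "submodule (h ` H) R N"
proof -
  interpret M: module R M by fact
  interpret N: module R N by fact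
  note H = submodule_subset[OF assms(4)] M.submoduleE[OF assms(4)]
  show ?thesis
  proof (rule N.submoduleI)
    show "h ` H \<subseteq> carrier N"
      using H(1) lin_hom_closed[OF assms(3)] by auto
    show "\<zero>\<^bsub>N\<^esub> \<in> h ` H"
      using submodule_zero[OF assms(4)] lin_hom_zero[OF assms(1-3)] by (metis imageI)
    show "\<ominus>\<^bsub>N\<^esub> a \<in> h ` H" if "a \<in> h ` H" for a
      using that H lin_hom_neg[OF assms(1-3)] by (smt (verit) image_iff subsetD)
    show "a \<oplus>\<^bsub>N\<^esub> b \<in> h ` H" if "a \<in> h ` H" "b \<in> h ` H" for a b
      using that H lin_hom_add[OF assms(3)] by (smt (verit) image_iff subsetD)
    show "r \<odot>\<^bsub>N\<^esub> b \<in> h ` H" if "r \<in> carrier R" "b \<in> h ` H" for r b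
      using that H lin_hom_smult[OF assms(3)] by (smt (verit) image_iff subsetD)
  qed
qed

lemma lin_hom_submodule_source:
  "submodule H R M \<Longrightarrow> h \<in> lin_hom R M N \<Longrightarrow> h \<in> lin_hom R (M\<lparr>carrier := H\<rparr>) N"
  using submodule_subset[of H R M] by (simp add: lin_hom_def Pi_iff subset_iff)

text \<open>The equaliser of two linear maps is a submodule, so it contains the span once it
  contains the generators.\<close>

lemma lin_hom_eq_on_span:
  assumes "module R M" "module R N" "f \<in> lin_hom R M N" "g \<in> lin_hom R M N"
    and "S \<subseteq> carrier M" "\<And>x. x \<in> S \<Longrightarrow> f x = g x" "x \<in> submodule_span R M S"
  shows "f x = g x"
proof -
  interpret M: module R M by fact
  interpret N: module R N by fact
  note rules = lin_hom_zero[OF assms(1,2)] lin_hom_neg[OF assms(1,2)] lin_hom_add lin_hom_smult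
  have "submodule {x \<in> carrier M. f x = g x} R M"
    by (rule M.submoduleI)
      (simp_all add: rules[OF assms(3)] rules[OF assms(4)] subset_iff)
  from submodule_span_minimal[OF this, of S] assms show ?thesis
    by auto
qed

lemma lin_hom_span_image:
  assumes "module R M" "module R N" "h \<in> lin_hom R M N" "S \<subseteq> carrier M"
    and "submodule H R N" "\<And>x. x \<in> S \<Longrightarrow> h x \<in> H" "x \<in> submodule_span R M S"
  shows "h x \<in> H"
  using submodule_span_minimal[OF submodule_vimage[OF assms(1,2,3,5)], of S] assms by auto

section \<open>Bilinear maps and sums of families of linear maps\<close>

lemma bilinD:
  "\<beta> \<in> bilin R A B M \<Longrightarrow> a \<in> carrier A \<Longrightarrow> \<beta> a \<in> lin_hom R B M"
  "\<beta> \<in> bilin R A B M \<Longrightarrow> b \<in> carrier B \<Longrightarrow> (\<lambda>a. \<beta> a b) \<in> lin_hom R A M"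
  "\<beta> \<in> bilin R A B M \<Longrightarrow> a \<in> carrier A \<Longrightarrow> b \<in> carrier B \<Longrightarrow> \<beta> a b \<in> carrier M"
  by (auto simp: bilin_def dest: lin_hom_closed)

lemma bilinI:
  assumes "\<And>a b. a \<in> carrier A \<Longrightarrow> b \<in> carrier B \<Longrightarrow> \<beta> a b \<in> carrier M"
    and "\<And>a a' b. a \<in> carrier A \<Longrightarrow> a' \<in> carrier A \<Longrightarrow> b \<in> carrier B \<Longrightarrow>
      \<beta> (a \<oplus>\<^bsub>A\<^esub> a') b = \<beta> a b \<oplus>\<^bsub>M\<^esub> \<beta> a' b"
    and "\<And>a b b'. a \<in> carrier A \<Longrightarrow> b \<in> carrier B \<Longrightarrow> b' \<in> carrier B \<Longrightarrow>
      \<beta> a (b \<oplus>\<^bsub>B\<^esub> b') = \<beta> a b \<oplus>\<^bsub>M\<^esub> \<beta> a b'"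
    and "\<And>r a b. r \<in> carrier R \<Longrightarrow> a \<in> carrier A \<Longrightarrow> b \<in> carrier B \<Longrightarrow>
      \<beta> (r \<odot>\<^bsub>A\<^esub> a) b = r \<odot>\<^bsub>M\<^esub> \<beta> a b"
    and "\<And>r a b. r \<in> carrier R \<Longrightarrow> a \<in> carrier A \<Longrightarrow> b \<in> carrier B \<Longrightarrow>
      \<beta> a (r \<odot>\<^bsub>B\<^esub> b) = r \<odot>\<^bsub>M\<^esub> \<beta> a b"
  shows "\<beta> \<in> bilin R A B M"
  using assms by (auto simp: bilin_def intro!: lin_homI)

text \<open>The family may be infinite, but each argument meets only finitely many nonzero terms.
  Since the set of these terms varies with the argument, both sides of each law are compared over
  one finite index set containing all supports involved; the surplus terms are zero.\<close>

lemma lin_hom_finsum_family: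
  assumes "module R M" "module R N" "\<And>i. i \<in> I \<Longrightarrow> h i \<in> lin_hom R M N"
    and fin: "\<And>x. x \<in> carrier M \<Longrightarrow> finite {i \<in> I. h i x \<noteq> \<zero>\<^bsub>N\<^esub>}"
  shows "(\<lambda>x. \<Oplus>\<^bsub>N\<^esub>i\<in>{i \<in> I. h i x \<noteq> \<zero>\<^bsub>N\<^esub>}. h i x) \<in> lin_hom R M N"
proof -
  interpret M: module R M by fact
  interpret N: module R N by fact
  have hc: "h i x \<in> carrier N" if "i \<in> I" "x \<in> carrier M" for i x
    using lin_hom_closed[OF assms(3)] that by blast
  define supp where "supp x = {i \<in> I. h i x \<noteq> \<zero>\<^bsub>N\<^esub>}" for x
  have sum: "(\<Oplus>\<^bsub>N\<^esub>i\<in>supp x. h i x) = (\<Oplus>\<^bsub>N\<^esub>i\<in>S. h i x)"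
    if "finite S" "supp x \<subseteq> S" "S \<subseteq> I" "x \<in> carrier M" for x S
    using that assms(3) by (intro N.finsum_superset) (auto simp: supp_def hc subset_iff)
  have fin': "finite (supp x)" "supp x \<subseteq> I" if "x \<in> carrier M" for x
    using fin[OF that] by (auto simp: supp_def)
  show ?thesis
    unfolding supp_def[symmetric]
  proof (rule lin_homI)
    show "(\<Oplus>\<^bsub>N\<^esub>i\<in>supp x. h i x) \<in> carrier N" if "x \<in> carrier M" for x
      using that assms(3) by (intro N.finsum_closed) (auto simp: supp_def hc)
  next
    fix x y assume xy: "x \<in> carrier M" "y \<in> carrier M"
    define S where "S = supp x \<union> supp y \<union> supp (x \<oplus>\<^bsub>M\<^esub> y)"
    have S: "finite S" "S \<subseteq> I" "supp x \<subseteq> S" "supp y \<subseteq> S" "supp (x \<oplus>\<^bsub>M\<^esub> y) \<subseteq> S"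
      using fin' xy by (auto simp: S_def)
    have "(\<Oplus>\<^bsub>N\<^esub>i\<in>S. h i (x \<oplus>\<^bsub>M\<^esub> y)) = (\<Oplus>\<^bsub>N\<^esub>i\<in>S. h i x \<oplus>\<^bsub>N\<^esub> h i y)"
      using S(2) xy assms(3) by (intro N.finsum_cong') (auto simp: lin_hom_add[OF assms(3)] hc subset_iff)
    also have "\<dots> = (\<Oplus>\<^bsub>N\<^esub>i\<in>S. h i x) \<oplus>\<^bsub>N\<^esub> (\<Oplus>\<^bsub>N\<^esub>i\<in>S. h i y)"
      using S(2) xy assms(3) by (intro N.finsum_addf) (auto simp: hc subset_iff)
    finally show "(\<Oplus>\<^bsub>N\<^esub>i\<in>supp (x \<oplus>\<^bsub>M\<^esub> y). h i (x \<oplus>\<^bsub>M\<^esub> y)) =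
        (\<Oplus>\<^bsub>N\<^esub>i\<in>supp x. h i x) \<oplus>\<^bsub>N\<^esub> (\<Oplus>\<^bsub>N\<^esub>i\<in>supp y. h i y)"
      using sum[OF S(1) _ S(2)] S xy by simp
  next
    fix r x assume rx: "r \<in> carrier R" "x \<in> carrier M"
    define S where "S = supp x \<union> supp (r \<odot>\<^bsub>M\<^esub> x)"
    have S: "finite S" "S \<subseteq> I" "supp x \<subseteq> S" "supp (r \<odot>\<^bsub>M\<^esub> x) \<subseteq> S"
      using fin' rx by (auto simp: S_def)
    have "(\<Oplus>\<^bsub>N\<^esub>i\<in>S. h i (r \<odot>\<^bsub>M\<^esub> x)) = (\<Oplus>\<^bsub>N\<^esub>i\<in>S. r \<odot>\<^bsub>N\<^esub> h i x)"
      using S(2) rx assms(3) by (intro N.finsum_cong') (auto simp: lin_hom_smult[OF assms(3)] hc subset_iff)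
    also have "\<dots> = r \<odot>\<^bsub>N\<^esub> (\<Oplus>\<^bsub>N\<^esub>i\<in>S. h i x)"
      using S rx assms(3) by (intro N.finsum_smult_ldistr[symmetric]) (auto simp: hc subset_iff)
    finally show "(\<Oplus>\<^bsub>N\<^esub>i\<in>supp (r \<odot>\<^bsub>M\<^esub> x). h i (r \<odot>\<^bsub>M\<^esub> x)) = r \<odot>\<^bsub>N\<^esub> (\<Oplus>\<^bsub>N\<^esub>i\<in>supp x. h i x)"
      using sum[OF S(1) _ S(2)] S rx by simp
  qed
qed

lemma bilin_finsum:
  assumes "module k M" "finite S" "\<And>i. i \<in> S \<Longrightarrow> \<beta> i \<in> bilin k A B M"
  shows "(\<lambda>a b. \<Oplus>\<^bsub>M\<^esub>i\<in>S. \<beta> i a b) \<in> bilin k A B M"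
proof -
  interpret M: module k M by fact
  note \<beta> = bilinD[OF assms(3)]
  note \<beta>r = lin_hom_add[OF \<beta>(1)] lin_hom_add[OF \<beta>(2)] lin_hom_smult[OF \<beta>(1)] lin_hom_smult[OF \<beta>(2)]
  show ?thesis
  proof (rule bilinI)
    show "(\<Oplus>\<^bsub>M\<^esub>i\<in>S. \<beta> i a b) \<in> carrier M" if "a \<in> carrier A" "b \<in> carrier B" for a b
      using that \<beta>(3) by (intro M.finsum_closed) auto
    show "(\<Oplus>\<^bsub>M\<^esub>i\<in>S. \<beta> i (a \<oplus>\<^bsub>A\<^esub> a') b) = (\<Oplus>\<^bsub>M\<^esub>i\<in>S. \<beta> i a b) \<oplus>\<^bsub>M\<^esub> (\<Oplus>\<^bsub>M\<^esub>i\<in>S. \<beta> i a' b)"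
      if "a \<in> carrier A" "a' \<in> carrier A" "b \<in> carrier B" for a a' b
      using that by (subst M.finsum_addf[symmetric]) (auto simp: \<beta>(3) \<beta>r simp del: M.finsum_addf intro!: M.finsum_cong')
    show "(\<Oplus>\<^bsub>M\<^esub>i\<in>S. \<beta> i a (b \<oplus>\<^bsub>B\<^esub> b')) = (\<Oplus>\<^bsub>M\<^esub>i\<in>S. \<beta> i a b) \<oplus>\<^bsub>M\<^esub> (\<Oplus>\<^bsub>M\<^esub>i\<in>S. \<beta> i a b')"
      if "a \<in> carrier A" "b \<in> carrier B" "b' \<in> carrier B" for a b b'
      using that by (subst M.finsum_addf[symmetric]) (auto simp: \<beta>(3) \<beta>r simp del: M.finsum_addf intro!: M.finsum_cong')
    show "(\<Oplus>\<^bsub>M\<^esub>i\<in>S. \<beta> i (r \<odot>\<^bsub>A\<^esub> a) b) = r \<odot>\<^bsub>M\<^esub> (\<Oplus>\<^bsub>M\<^esub>i\<in>S. \<beta> i a b)"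
      if "r \<in> carrier k" "a \<in> carrier A" "b \<in> carrier B" for r a b
      using that assms(2) by (subst M.finsum_smult_ldistr) (auto simp: \<beta>(3) \<beta>r intro!: M.finsum_cong')
    show "(\<Oplus>\<^bsub>M\<^esub>i\<in>S. \<beta> i a (r \<odot>\<^bsub>B\<^esub> b)) = r \<odot>\<^bsub>M\<^esub> (\<Oplus>\<^bsub>M\<^esub>i\<in>S. \<beta> i a b)"
      if "r \<in> carrier k" "a \<in> carrier A" "b \<in> carrier B" for r a b
      using that assms(2) by (subst M.finsum_smult_ldistr) (auto simp: \<beta>(3) \<beta>r intro!: M.finsum_cong')
  qed
qed

lemma (in abelian_group) minus_zero_iff:
  assumes "x \<in> carrier G" "y \<in> carrier G"
  shows "x \<ominus> y = \<zero> \<longleftrightarrow> x = y"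
  using assms minus_equality[of x "\<ominus> y"] by (auto simp: a_minus_def r_neg)

lemma finsum_submodule:
  assumes "module R M" "submodule N R M" "f \<in> S \<rightarrow> N"
  shows "finsum (M\<lparr>carrier := N\<rparr>) f S = finsum M f S"
proof -
  have N: "module R (M\<lparr>carrier := N\<rparr>)"
    by (rule submodule.submodule_is_module[OF assms(2,1)])
  show ?thesis
    using additive_finsum[of "M\<lparr>carrier := N\<rparr>" M "\<lambda>x. x" f S] assms(3) submodule_subset[OF assms(2)]
      module.axioms(2)[OF N] module.axioms(2)[OF assms(1)] by auto
qed

text \<open>By distributivity both sides of associativity are additive in each of the three
  arguments, so additive generators suffice. The hypothesis \<open>gen\<close> asks that
  \<open>S\<close> generate the carrier as an additive monoid; both uses take an \<open>S\<close>
  stable under scalars, which supplies the negatives.\<close>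

lemma ringI_generators:
  fixes M (structure)
  assumes "abelian_group M"
    and m_closed: "\<And>x y. x \<in> carrier M \<Longrightarrow> y \<in> carrier M \<Longrightarrow> x \<otimes> y \<in> carrier M"
    and one: "\<one> \<in> carrier M"
    and ld: "\<And>x y z. x \<in> carrier M \<Longrightarrow> y \<in> carrier M \<Longrightarrow> z \<in> carrier M \<Longrightarrow>
      (x \<oplus> y) \<otimes> z = x \<otimes> z \<oplus> y \<otimes> z"
    and rd: "\<And>x y z. x \<in> carrier M \<Longrightarrow> y \<in> carrier M \<Longrightarrow> z \<in> carrier M \<Longrightarrow>
      z \<otimes> (x \<oplus> y) = z \<otimes> x \<oplus> z \<otimes> y"
    and S: "S \<subseteq> carrier M"
    and gen: "\<And>H. H \<subseteq> carrier M \<Longrightarrow> S \<subseteq> H \<Longrightarrow> \<zero> \<in> H \<Longrightarrow>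
      (\<And>x y. x \<in> H \<Longrightarrow> y \<in> H \<Longrightarrow> x \<oplus> y \<in> H) \<Longrightarrow> carrier M \<subseteq> H"
    and assoc: "\<And>x y z. x \<in> S \<Longrightarrow> y \<in> S \<Longrightarrow> z \<in> S \<Longrightarrow> x \<otimes> y \<otimes> z = x \<otimes> (y \<otimes> z)"
    and unit: "\<And>x. x \<in> S \<Longrightarrow> \<one> \<otimes> x = x" "\<And>x. x \<in> S \<Longrightarrow> x \<otimes> \<one> = x"
  shows "ring M"
proof -
  interpret M: abelian_group M by fact
  have null: "\<zero> \<otimes> x = \<zero>" "x \<otimes> \<zero> = \<zero>" if "x \<in> carrier M" for x
    using ld[of \<zero> \<zero> x] rd[of \<zero> \<zero> x] m_closed[of \<zero> x] m_closed[of x \<zero>] that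
    by (metis M.l_zero M.zero_closed M.add.r_cancel_one')+
  note rules = ld rd null m_closed one
  \<comment> \<open>The arguments leave \<open>S\<close> one at a time: the set handed to
    \<open>gen\<close> consists of the values of one argument for which the identity holds while the
    later arguments still range over \<open>S\<close>.\<close>
  have 1: "x \<otimes> y \<otimes> z = x \<otimes> (y \<otimes> z)" if "x \<in> carrier M" "y \<in> S" "z \<in> S" for x y z
    using that S gen[of "{x \<in> carrier M. \<forall>y\<in>S. \<forall>z\<in>S. x \<otimes> y \<otimes> z = x \<otimes> (y \<otimes> z)}"] assoc
    by (auto simp: rules subset_iff)
  have 2: "x \<otimes> y \<otimes> z = x \<otimes> (y \<otimes> z)" if "x \<in> carrier M" "y \<in> carrier M" "z \<in> S" for x y z
    using that S gen[of "{y \<in> carrier M. \<forall>x\<in>carrier M. \<forall>z\<in>S. x \<otimes> y \<otimes> z = x \<otimes> (y \<otimes> z)}"] 1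
    by (auto simp: rules subset_iff)
  have 3: "x \<otimes> y \<otimes> z = x \<otimes> (y \<otimes> z)" if "x \<in> carrier M" "y \<in> carrier M" "z \<in> carrier M" for x y z
    using that S gen[of "{z \<in> carrier M. \<forall>x\<in>carrier M. \<forall>y\<in>carrier M. x \<otimes> y \<otimes> z = x \<otimes> (y \<otimes> z)}"] 2
    by (auto simp: rules subset_iff)
  have 4: "\<one> \<otimes> x = x" "x \<otimes> \<one> = x" if "x \<in> carrier M" for x
    using that S gen[of "{x \<in> carrier M. \<one> \<otimes> x = x \<and> x \<otimes> \<one> = x}"] unit
    by (auto simp: rules subset_iff)
  have "monoid M"
    using 3 4 by unfold_locales (auto simp: rules)
  then show ?thesis
    using rules by (intro ringI) (auto intro: M.abelian_group_axioms)
qed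

text \<open>Every axiom is an identity between images of elements of \<open>M\<close>, so it
  descends along a surjection that respects the operations. With \<open>\<rho>\<close> the
  projection onto \<open>R Quot J\<close> this covers A(P), with \<open>\<rho>\<close> the identity
  the tensor product, and with \<open>q\<close> the identity as well the extended records.\<close>

lemma assoc_algebra_surj_image:
  assumes "assoc_algebra R M" "cring k" "carrier k = \<rho> ` carrier R"
    and \<rho>: "\<rho> \<in> ring_hom R k"
    and surj: "carrier N = q ` carrier M"
    and add: "\<And>x y. x \<in> carrier M \<Longrightarrow> y \<in> carrier M \<Longrightarrow> q x \<oplus>\<^bsub>N\<^esub> q y = q (x \<oplus>\<^bsub>M\<^esub> y)"
    and zero: "\<zero>\<^bsub>N\<^esub> = q \<zero>\<^bsub>M\<^esub>"
    and smult: "\<And>r x. r \<in> carrier R \<Longrightarrow> x \<in> carrier M \<Longrightarrow> \<rho> r \<odot>\<^bsub>N\<^esub> q x = q (r \<odot>\<^bsub>M\<^esub> x)"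
    and mult: "\<And>x y. x \<in> carrier M \<Longrightarrow> y \<in> carrier M \<Longrightarrow> q x \<otimes>\<^bsub>N\<^esub> q y = q (x \<otimes>\<^bsub>M\<^esub> y)"
    and one: "\<one>\<^bsub>N\<^esub> = q \<one>\<^bsub>M\<^esub>"
  shows "assoc_algebra k N"
proof -
  interpret M: assoc_algebra R M by fact
  note \<rho>' = ring_hom_add[OF \<rho>, symmetric] ring_hom_mult[OF \<rho>, symmetric] ring_hom_one[OF \<rho>, symmetric]
  have ab: "abelian_group N"
    by (rule abelian_groupI)
      (auto simp: surj add zero M.a_ac M.r_neg intro!: bexI[of _ "\<ominus>\<^bsub>M\<^esub> _"] imageI)
  have "ring N"
    by (rule ringI[OF ab])
      (auto intro!: monoidI simp: surj add mult one M.m_assoc M.l_distr M.r_distr)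
  moreover have "module k N"
    by (rule moduleI[OF assms(2) ab])
      (auto simp: surj assms(3) add smult \<rho>' M.smult_l_distr M.smult_r_distr M.smult_assoc1)
  ultimately show ?thesis
    unfolding assoc_algebra_def assoc_algebra_axioms_def
    by (auto simp: surj assms(3) mult smult M.smult_mult_left M.smult_mult_right)
qed

text \<open>The version without multiplication serves the components of a general degree, which
  carry no product of their own.\<close>

lemma module_surj_image:
  assumes "module R M" "cring k" "carrier k = \<rho> ` carrier R"
    and \<rho>: "\<rho> \<in> ring_hom R k"
    and surj: "carrier N = q ` carrier M"
    and add: "\<And>x y. x \<in> carrier M \<Longrightarrow> y \<in> carrier M \<Longrightarrow> q x \<oplus>\<^bsub>N\<^esub> q y = q (x \<oplus>\<^bsub>M\<^esub> y)"
    and zero: "\<zero>\<^bsub>N\<^esub> = q \<zero>\<^bsub>M\<^esub>"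
    and smult: "\<And>r x. r \<in> carrier R \<Longrightarrow> x \<in> carrier M \<Longrightarrow> \<rho> r \<odot>\<^bsub>N\<^esub> q x = q (r \<odot>\<^bsub>M\<^esub> x)"
  shows "module k N"
proof -
  interpret M: module R M by fact
  note \<rho>' = ring_hom_add[OF \<rho>, symmetric] ring_hom_mult[OF \<rho>, symmetric] ring_hom_one[OF \<rho>, symmetric]
  have ab: "abelian_group N"
    by (rule abelian_groupI)
      (auto simp: surj add zero M.a_ac M.r_neg intro!: bexI[of _ "\<ominus>\<^bsub>M\<^esub> _"] imageI)
  show ?thesis
    by (rule moduleI[OF assms(2) ab])
      (auto simp: surj assms(3) add smult \<rho>' M.smult_l_distr M.smult_r_distr M.smult_assoc1)
qed

section \<open>Cosets of submodules\<close>

lemma (in module) submodule_abelian_subgroup: "submodule I R M \<Longrightarrow> abelian_subgroup I M"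
  by (intro abelian_subgroupI3 additive_subgroup.intro submodule.axioms(1) M.abelian_group_axioms)

lemma (in module) coset_eq_iff:
  assumes "submodule I R M" "x \<in> carrier M" "y \<in> carrier M"
  shows "I +>\<^bsub>M\<^esub> x = I +>\<^bsub>M\<^esub> y \<longleftrightarrow> x \<ominus>\<^bsub>M\<^esub> y \<in> I"
proof -
  interpret I: abelian_subgroup I M
    using assms(1) by (rule submodule_abelian_subgroup)
  show ?thesis
    using assms(2,3) by (metis I.a_rcos_module a_minus_def I.a_repr_independence' I.a_rcos_self)
qed

lemma (in module) coset_mem_iff:
  assumes "submodule I R M" "x \<in> carrier M"
  shows "y \<in> I +>\<^bsub>M\<^esub> x \<longleftrightarrow> y \<in> carrier M \<and> I +>\<^bsub>M\<^esub> y = I +>\<^bsub>M\<^esub> x"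
proof -
  interpret I: abelian_subgroup I M
    using assms(1) by (rule submodule_abelian_subgroup)
  show ?thesis
    using assms(2) I.a_elemrcos_carrier I.a_repr_independence' I.a_rcos_self by blast
qed

lemma (in module) coset_zero:
  assumes "submodule I R M" "x \<in> carrier M"
  shows "I +>\<^bsub>M\<^esub> x = I \<longleftrightarrow> x \<in> I"
proof -
  interpret I: abelian_subgroup I M
    using assms(1) by (rule submodule_abelian_subgroup)
  show ?thesis
    using assms(2) I.a_rcos_const I.a_rcos_self by blast
qed

text \<open>The operations on quotients are unions over representatives. Independence of the
  representative is exactly the second premise, and one representative \<open>x\<close> gives the
  value.\<close>

lemma UN_const: "x \<in> S \<Longrightarrow> (\<And>y. y \<in> S \<Longrightarrow> f y = C) \<Longrightarrow> (\<Union>y\<in>S. f y) = C"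
  by auto

section \<open>Monoid algebras\<close>

lemma monoid_algebra_simps [simp]:
  "carrier (monoid_algebra R M) = finsupp R (carrier M)"
  "\<one>\<^bsub>monoid_algebra R M\<^esub> = single R \<one>\<^bsub>M\<^esub>"
  "\<zero>\<^bsub>monoid_algebra R M\<^esub> = (\<lambda>_. \<zero>\<^bsub>R\<^esub>)"
  "f \<oplus>\<^bsub>monoid_algebra R M\<^esub> g = (\<lambda>z. f z \<oplus>\<^bsub>R\<^esub> g z)"
  "r \<odot>\<^bsub>monoid_algebra R M\<^esub> f = (\<lambda>z. r \<otimes>\<^bsub>R\<^esub> f z)"
  by (simp_all add: monoid_algebra_def)

lemma finsuppD:
  assumes "f \<in> finsupp R Z"
  shows "f x \<in> carrier R" "finite {x. f x \<noteq> \<zero>\<^bsub>R\<^esub>}" "{x. f x \<noteq> \<zero>\<^bsub>R\<^esub>} \<subseteq> Z"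
  using assms by (auto simp: finsupp_def)

lemma finsuppI:
  assumes "\<And>x. f x \<in> carrier R" "finite S" "S \<subseteq> Z" "\<And>x. x \<notin> S \<Longrightarrow> f x = \<zero>\<^bsub>R\<^esub>"
  shows "f \<in> finsupp R Z"
proof -
  have "{x. f x \<noteq> \<zero>\<^bsub>R\<^esub>} \<subseteq> S"
    using assms(4) by auto
  then show ?thesis
    using assms(1-3) by (auto simp: finsupp_def dest: finite_subset)
qed

lemma (in cring) single_finsupp: "x \<in> Z \<Longrightarrow> single R x \<in> finsupp R Z"
  by (rule finsuppI[of _ _ "{x}"]) (auto simp: single_def)

lemma (in cring) module_monoid_algebra: "module R (monoid_algebra R M)"
proof (rule moduleI)
  show "abelian_group (monoid_algebra R M)"
  proof (rule abelian_groupI)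
    fix f g assume "f \<in> carrier (monoid_algebra R M)" "g \<in> carrier (monoid_algebra R M)"
    then show "f \<oplus>\<^bsub>monoid_algebra R M\<^esub> g \<in> carrier (monoid_algebra R M)"
      by (intro finsuppI[of _ _ "{x. f x \<noteq> \<zero>} \<union> {x. g x \<noteq> \<zero>}", THEN monoid_algebra_simps(1)[THEN equalityD2, THEN subsetD]])
        (auto dest: finsuppD)
  next
    fix f assume f: "f \<in> carrier (monoid_algebra R M)"
    then have "(\<lambda>x. \<ominus> f x) \<in> carrier (monoid_algebra R M)"
      by (intro finsuppI[of _ _ "{x. f x \<noteq> \<zero>}", THEN monoid_algebra_simps(1)[THEN equalityD2, THEN subsetD]])
        (auto dest: finsuppD)
    moreover have "(\<lambda>x. \<ominus> f x) \<oplus>\<^bsub>monoid_algebra R M\<^esub> f = \<zero>\<^bsub>monoid_algebra R M\<^esub>"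
      using f by (simp add: fun_eq_iff l_neg finsuppD(1))
    ultimately show "\<exists>g\<in>carrier (monoid_algebra R M). g \<oplus>\<^bsub>monoid_algebra R M\<^esub> f = \<zero>\<^bsub>monoid_algebra R M\<^esub>"
      by blast
  qed (auto simp: fun_eq_iff a_ac finsuppD(1) intro!: finsuppI[of _ _ "{}"])
next
  fix r f assume "r \<in> carrier R" "f \<in> carrier (monoid_algebra R M)"
  then show "r \<odot>\<^bsub>monoid_algebra R M\<^esub> f \<in> carrier (monoid_algebra R M)"
    by (intro finsuppI[of _ _ "{x. f x \<noteq> \<zero>}", THEN monoid_algebra_simps(1)[THEN equalityD2, THEN subsetD]])
      (auto dest: finsuppD)
qed (auto simp: fun_eq_iff finsuppD(1) l_distr r_distr m_assoc is_cring)

text \<open>A finitely supported function is a finite sum of multiples of delta functions. The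
  closure conditions on \<open>H\<close> match those offered by \<open>ringI_generators\<close>, so
  the lemma serves both the span and the ring laws.\<close>

lemma (in cring) monoid_algebra_generators:
  assumes "(\<lambda>_. \<zero>) \<in> H" "\<And>f g. f \<in> H \<Longrightarrow> g \<in> H \<Longrightarrow> (\<lambda>z. f z \<oplus> g z) \<in> H"
    and "\<And>r x. r \<in> carrier R \<Longrightarrow> x \<in> Z \<Longrightarrow> (\<lambda>z. r \<otimes> single R x z) \<in> H"
    and "f \<in> finsupp R Z"
  shows "f \<in> H"
proof -
  \<comment> \<open>The finite set \<open>S\<close> only bounds the support, so the induction can
    drop \<open>x\<close> even when \<open>f x\<close> vanishes.\<close>
  have "finite S \<Longrightarrow> f \<in> finsupp R Z \<Longrightarrow> {x. f x \<noteq> \<zero>} \<subseteq> S \<Longrightarrow> f \<in> H" for S f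
  proof (induction S arbitrary: f rule: finite_induct)
    case empty
    then have "f = (\<lambda>_. \<zero>)" by auto
    then show ?case using assms(1) by simp
  next
    case (insert x S)
    note fD = finsuppD[OF insert.prems(1)]
    show ?case
    proof (cases "f x = \<zero>")
      case True
      then show ?thesis using insert by auto
    next
      case False
      then have x: "x \<in> Z" using fD(3) by auto
      have 1: "(\<lambda>z. f x \<otimes> single R x z) \<in> H"
        using fD x assms(3) by simp
      have 2: "f(x := \<zero>) \<in> H"
        using insert.prems(2) fD by (intro insert.IH finsuppI[of _ _ "{x. f x \<noteq> \<zero>}"]) auto
      have "f = (\<lambda>z. f x \<otimes> single R x z \<oplus> (f(x := \<zero>)) z)"
        using fD(1) by (auto simp: fun_eq_iff single_def)
      then show ?thesis
        using assms(2)[OF 1 2] by simp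
    qed
  qed
  then show ?thesis
    using assms(4) finsuppD(2)[OF assms(4)] by blast
qed

lemma (in cring) monoid_algebra_span:
  "submodule_span R (monoid_algebra R M) (single R ` carrier M) = finsupp R (carrier M)"
proof -
  let ?U = "monoid_algebra R M"
  interpret U: module R ?U
    by (rule module_monoid_algebra)
  have sub: "submodule (submodule_span R ?U (single R ` carrier M)) R ?U"
    by (rule submodule_span_submodule[OF U.module_axioms]) (auto intro: single_finsupp)
  note S = submodule_zero[OF sub] submodule_add[OF sub] submodule.smult_closed[OF sub]
  have "f \<in> submodule_span R ?U (single R ` carrier M)" if "f \<in> finsupp R (carrier M)" for f
    by (rule monoid_algebra_generators[OF _ _ _ that])
      (use S submodule_span_superset[of "single R ` carrier M" R ?U] in auto)
  then show ?thesis
    using submodule_subset[OF sub] by auto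
qed

lemma lin_ext_eq:
  assumes "module R V" "f \<in> finsupp R Z" "s \<in> Z \<rightarrow> carrier V"
    and "finite S" "{x. f x \<noteq> \<zero>\<^bsub>R\<^esub>} \<subseteq> S" "S \<subseteq> Z"
  shows "lin_ext R V s f = (\<Oplus>\<^bsub>V\<^esub>x\<in>S. f x \<odot>\<^bsub>V\<^esub> s x)"
proof -
  interpret module R V by fact
  show ?thesis
    unfolding lin_ext_def using assms(3-) finsuppD(1)[OF assms(2)]
    by (intro finsum_superset) (auto simp: Pi_iff subset_iff)
qed

lemma lin_ext_single:
  assumes "module R V" "s x \<in> carrier V"
  shows "lin_ext R V s (single R x) = s x"
proof -
  interpret module R V by fact
  have "lin_ext R V s (single R x) = (\<Oplus>\<^bsub>V\<^esub>y\<in>{x}. single R x y \<odot>\<^bsub>V\<^esub> s y)"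
    using assms by (intro lin_ext_eq[of _ _ _ "{x}"] single_finsupp) (auto simp: single_def)
  then show ?thesis
    using assms(2) by (simp add: single_def)
qed

lemma lin_ext_lin_hom:
  assumes "module R V" "s \<in> carrier M \<rightarrow> carrier V"
  shows "lin_ext R V s \<in> lin_hom R (monoid_algebra R M) V"
proof -
  interpret V: module R V by fact
  interpret U: module R "monoid_algebra R M" by (rule V.module_monoid_algebra)
  \<comment> \<open>The support of \<open>f\<close> is replaced by the set of nonzero terms, the
    index set that \<open>lin_hom_finsum_family\<close> sums over.\<close>
  have eq: "lin_ext R V s f = (\<Oplus>\<^bsub>V\<^esub>x\<in>{x \<in> carrier M. f x \<odot>\<^bsub>V\<^esub> s x \<noteq> \<zero>\<^bsub>V\<^esub>}. f x \<odot>\<^bsub>V\<^esub> s x)"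
    if f: "f \<in> finsupp R (carrier M)" for f
    unfolding lin_ext_def using finsuppD[OF f] assms(2)
    by (intro V.finsum_superset[symmetric]) (auto simp: Pi_iff subset_iff)
  have "(\<lambda>f. \<Oplus>\<^bsub>V\<^esub>x\<in>{x \<in> carrier M. f x \<odot>\<^bsub>V\<^esub> s x \<noteq> \<zero>\<^bsub>V\<^esub>}. f x \<odot>\<^bsub>V\<^esub> s x) \<in> lin_hom R (monoid_algebra R M) V"
  proof (rule lin_hom_finsum_family[OF U.module_axioms V.module_axioms])
    show "(\<lambda>f. f x \<odot>\<^bsub>V\<^esub> s x) \<in> lin_hom R (monoid_algebra R M) V" if "x \<in> carrier M" for x
      using that assms(2)
      by (intro lin_homI) (auto simp: Pi_iff finsuppD(1) V.smult_l_distr V.smult_assoc1)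
    show "finite {x \<in> carrier M. f x \<odot>\<^bsub>V\<^esub> s x \<noteq> \<zero>\<^bsub>V\<^esub>}" if "f \<in> carrier (monoid_algebra R M)" for f
      using that assms(2) by (intro finite_subset[OF _ finsuppD(2)[of f R]]) (auto simp: Pi_iff)
  qed
  then show ?thesis
    using eq U.a_closed U.smult_closed by (simp add: lin_hom_def Pi_iff)
qed

text \<open>Summing over a rectangle with an indicator, in place of the fibre over \<open>z\<close>,
  lets products with different supports be written over one common index set. Distributivity then
  becomes a termwise identity.\<close>

lemma (in cring) monoid_algebra_mult_eq:
  assumes "f \<in> finsupp R Z" "g \<in> finsupp R Y"
    and "finite S" "{x. f x \<noteq> \<zero>} \<subseteq> S" "finite T" "{x. g x \<noteq> \<zero>} \<subseteq> T"
  shows "(f \<otimes>\<^bsub>monoid_algebra R M\<^esub> g) z =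
    (\<Oplus>w\<in>S \<times> T. if fst w \<otimes>\<^bsub>M\<^esub> snd w = z then f (fst w) \<otimes> g (snd w) else \<zero>)"
proof -
  note f = finsuppD[OF assms(1)] and g = finsuppD[OF assms(2)]
  have "(\<Oplus>w\<in>{(x, y). f x \<noteq> \<zero> \<and> g y \<noteq> \<zero> \<and> x \<otimes>\<^bsub>M\<^esub> y = z}. f (fst w) \<otimes> g (snd w)) =
    (\<Oplus>w\<in>{(x, y). f x \<noteq> \<zero> \<and> g y \<noteq> \<zero> \<and> x \<otimes>\<^bsub>M\<^esub> y = z}. if fst w \<otimes>\<^bsub>M\<^esub> snd w = z then f (fst w) \<otimes> g (snd w) else \<zero>)"
    using f(1) g(1) by (intro finsum_cong') auto
  also have "\<dots> = (\<Oplus>w\<in>S \<times> T. if fst w \<otimes>\<^bsub>M\<^esub> snd w = z then f (fst w) \<otimes> g (snd w) else \<zero>)"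
    using assms(3-) f(1) g(1) by (intro finsum_superset) auto
  finally show ?thesis
    by (simp add: monoid_algebra_def)
qed

text \<open>Distributivity and compatibility with scalars come from the rectangle form of the
  product. Associativity and the unit laws then reduce to multiples of delta functions, where they
  are the laws of \<open>M\<close>.\<close>

lemma assoc_algebra_monoid_algebra:
  fixes R :: "('r, 'm) ring_scheme" and M :: "('x, 'n) monoid_scheme"
  assumes "cring R" "monoid M"
  shows "assoc_algebra R (monoid_algebra R M)"
    and "\<And>x y. x \<in> carrier M \<Longrightarrow> y \<in> carrier M \<Longrightarrow>
      single R x \<otimes>\<^bsub>monoid_algebra R M\<^esub> single R y = single R (x \<otimes>\<^bsub>M\<^esub> y)"
proof -
  interpret R: cring R by fact
  interpret M: monoid M by fact
  let ?U = "monoid_algebra R M"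
  interpret U: module R ?U by (rule R.module_monoid_algebra)
  define supp where "supp f = {x. f x \<noteq> \<zero>\<^bsub>R\<^esub>}" for f :: "'x \<Rightarrow> 'r"
  note C = U.a_closed[simplified] U.smult_closed[simplified]
  have C': "r \<odot>\<^bsub>?U\<^esub> f \<in> finsupp R (carrier M)" if "r \<in> carrier R" "f \<in> finsupp R (carrier M)" for r f
    using U.smult_closed that by simp
  have supp: "f x \<in> carrier R" "finite (supp f)" "supp f \<subseteq> carrier M"
    if "f \<in> finsupp R (carrier M)" for f x
    using finsuppD[OF that] by (auto simp: supp_def)
  have eq: "(f \<otimes>\<^bsub>?U\<^esub> g) z =
      (\<Oplus>\<^bsub>R\<^esub>w\<in>S \<times> T. if fst w \<otimes>\<^bsub>M\<^esub> snd w = z then f (fst w) \<otimes>\<^bsub>R\<^esub> g (snd w) else \<zero>\<^bsub>R\<^esub>)"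
    if "f \<in> finsupp R (carrier M)" "g \<in> finsupp R (carrier M)"
      "finite S" "supp f \<subseteq> S" "finite T" "supp g \<subseteq> T" for f g S T z
    using that unfolding supp_def by (rule R.monoid_algebra_mult_eq)
  have closed: "f \<otimes>\<^bsub>?U\<^esub> g \<in> finsupp R (carrier M)"
    if f: "f \<in> finsupp R (carrier M)" and g: "g \<in> finsupp R (carrier M)" for f g
  proof (rule finsuppI[of _ _ "(\<lambda>w. fst w \<otimes>\<^bsub>M\<^esub> snd w) ` (supp f \<times> supp g)"])
    note fg = eq[OF f g supp(2)[OF f] order_refl supp(2)[OF g] order_refl]
    show "(f \<otimes>\<^bsub>?U\<^esub> g) x \<in> carrier R" for x
      unfolding fg using supp(1)[OF f] supp(1)[OF g] by (intro R.finsum_closed) simp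
    show "(f \<otimes>\<^bsub>?U\<^esub> g) x = \<zero>\<^bsub>R\<^esub>" if "x \<notin> (\<lambda>w. fst w \<otimes>\<^bsub>M\<^esub> snd w) ` (supp f \<times> supp g)" for x
      unfolding fg using that by (intro R.add.finprod_one_eqI[folded finsum_def, simplified]) force
    show "finite ((\<lambda>w. fst w \<otimes>\<^bsub>M\<^esub> snd w) ` (supp f \<times> supp g))"
      using supp(2)[OF f] supp(2)[OF g] by blast
    show "(\<lambda>w. fst w \<otimes>\<^bsub>M\<^esub> snd w) ` (supp f \<times> supp g) \<subseteq> carrier M"
      using supp(3)[OF f] supp(3)[OF g] by (auto intro!: M.m_closed)
  qed
  have ld: "(f \<oplus>\<^bsub>?U\<^esub> g) \<otimes>\<^bsub>?U\<^esub> h = f \<otimes>\<^bsub>?U\<^esub> h \<oplus>\<^bsub>?U\<^esub> g \<otimes>\<^bsub>?U\<^esub> h"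
    if f: "f \<in> finsupp R (carrier M)" and g: "g \<in> finsupp R (carrier M)"
      and h: "h \<in> finsupp R (carrier M)" for f g h
  proof
    fix z
    define S where "S = supp f \<union> supp g \<union> supp (f \<oplus>\<^bsub>?U\<^esub> g)"
    have S: "finite S" "supp f \<subseteq> S" "supp g \<subseteq> S" "supp (f \<oplus>\<^bsub>?U\<^esub> g) \<subseteq> S"
      using supp(2) f g C by (auto simp: S_def)
    note rules = eq[OF _ h S(1) _ supp(2)[OF h] order_refl]
    have "(\<Oplus>\<^bsub>R\<^esub>w\<in>S \<times> supp h. if fst w \<otimes>\<^bsub>M\<^esub> snd w = z then (f (fst w) \<oplus>\<^bsub>R\<^esub> g (fst w)) \<otimes>\<^bsub>R\<^esub> h (snd w) else \<zero>\<^bsub>R\<^esub>) =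
      (\<Oplus>\<^bsub>R\<^esub>w\<in>S \<times> supp h. (if fst w \<otimes>\<^bsub>M\<^esub> snd w = z then f (fst w) \<otimes>\<^bsub>R\<^esub> h (snd w) else \<zero>\<^bsub>R\<^esub>) \<oplus>\<^bsub>R\<^esub>
         (if fst w \<otimes>\<^bsub>M\<^esub> snd w = z then g (fst w) \<otimes>\<^bsub>R\<^esub> h (snd w) else \<zero>\<^bsub>R\<^esub>))"
      using supp(1) f g h by (intro R.finsum_cong') (auto simp: R.l_distr)
    also have "\<dots> = (\<Oplus>\<^bsub>R\<^esub>w\<in>S \<times> supp h. if fst w \<otimes>\<^bsub>M\<^esub> snd w = z then f (fst w) \<otimes>\<^bsub>R\<^esub> h (snd w) else \<zero>\<^bsub>R\<^esub>) \<oplus>\<^bsub>R\<^esub>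
       (\<Oplus>\<^bsub>R\<^esub>w\<in>S \<times> supp h. if fst w \<otimes>\<^bsub>M\<^esub> snd w = z then g (fst w) \<otimes>\<^bsub>R\<^esub> h (snd w) else \<zero>\<^bsub>R\<^esub>)"
      using supp(1) f g h by (intro R.finsum_addf) auto
    finally show "((f \<oplus>\<^bsub>?U\<^esub> g) \<otimes>\<^bsub>?U\<^esub> h) z = (f \<otimes>\<^bsub>?U\<^esub> h \<oplus>\<^bsub>?U\<^esub> g \<otimes>\<^bsub>?U\<^esub> h) z"
      using rules[OF _ S(4)] rules[OF f S(2)] rules[OF g S(3)] C f g by (simp cong: if_cong)
  qed
  have rd: "h \<otimes>\<^bsub>?U\<^esub> (f \<oplus>\<^bsub>?U\<^esub> g) = h \<otimes>\<^bsub>?U\<^esub> f \<oplus>\<^bsub>?U\<^esub> h \<otimes>\<^bsub>?U\<^esub> g"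
    if f: "f \<in> finsupp R (carrier M)" and g: "g \<in> finsupp R (carrier M)"
      and h: "h \<in> finsupp R (carrier M)" for f g h
  proof
    fix z
    define S where "S = supp f \<union> supp g \<union> supp (f \<oplus>\<^bsub>?U\<^esub> g)"
    have S: "finite S" "supp f \<subseteq> S" "supp g \<subseteq> S" "supp (f \<oplus>\<^bsub>?U\<^esub> g) \<subseteq> S"
      using supp(2) f g C by (auto simp: S_def)
    note rules = eq[OF h _ supp(2)[OF h] order_refl S(1)]
    have "(\<Oplus>\<^bsub>R\<^esub>w\<in>supp h \<times> S. if fst w \<otimes>\<^bsub>M\<^esub> snd w = z then h (fst w) \<otimes>\<^bsub>R\<^esub> (f (snd w) \<oplus>\<^bsub>R\<^esub> g (snd w)) else \<zero>\<^bsub>R\<^esub>) =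
      (\<Oplus>\<^bsub>R\<^esub>w\<in>supp h \<times> S. (if fst w \<otimes>\<^bsub>M\<^esub> snd w = z then h (fst w) \<otimes>\<^bsub>R\<^esub> f (snd w) else \<zero>\<^bsub>R\<^esub>) \<oplus>\<^bsub>R\<^esub>
         (if fst w \<otimes>\<^bsub>M\<^esub> snd w = z then h (fst w) \<otimes>\<^bsub>R\<^esub> g (snd w) else \<zero>\<^bsub>R\<^esub>))"
      using supp(1) f g h by (intro R.finsum_cong') (auto simp: R.r_distr)
    also have "\<dots> = (\<Oplus>\<^bsub>R\<^esub>w\<in>supp h \<times> S. if fst w \<otimes>\<^bsub>M\<^esub> snd w = z then h (fst w) \<otimes>\<^bsub>R\<^esub> f (snd w) else \<zero>\<^bsub>R\<^esub>) \<oplus>\<^bsub>R\<^esub>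
       (\<Oplus>\<^bsub>R\<^esub>w\<in>supp h \<times> S. if fst w \<otimes>\<^bsub>M\<^esub> snd w = z then h (fst w) \<otimes>\<^bsub>R\<^esub> g (snd w) else \<zero>\<^bsub>R\<^esub>)"
      using supp(1) f g h by (intro R.finsum_addf) auto
    finally show "(h \<otimes>\<^bsub>?U\<^esub> (f \<oplus>\<^bsub>?U\<^esub> g)) z = (h \<otimes>\<^bsub>?U\<^esub> f \<oplus>\<^bsub>?U\<^esub> h \<otimes>\<^bsub>?U\<^esub> g) z"
      using rules[OF _ S(4)] rules[OF f S(2)] rules[OF g S(3)] C f g by (simp cong: if_cong)
  qed
  have smult_l: "(r \<odot>\<^bsub>?U\<^esub> f) \<otimes>\<^bsub>?U\<^esub> g = r \<odot>\<^bsub>?U\<^esub> (f \<otimes>\<^bsub>?U\<^esub> g)"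
    and smult_r: "f \<otimes>\<^bsub>?U\<^esub> (r \<odot>\<^bsub>?U\<^esub> g) = r \<odot>\<^bsub>?U\<^esub> (f \<otimes>\<^bsub>?U\<^esub> g)"
    if r: "r \<in> carrier R" and f: "f \<in> finsupp R (carrier M)" and g: "g \<in> finsupp R (carrier M)" for r f g
  proof -
    have S: "supp (r \<odot>\<^bsub>?U\<^esub> f) \<subseteq> supp f" "supp (r \<odot>\<^bsub>?U\<^esub> g) \<subseteq> supp g"
      using r by (auto simp: supp_def)
    have *: "r \<otimes>\<^bsub>R\<^esub> (f \<otimes>\<^bsub>?U\<^esub> g) z =
      (\<Oplus>\<^bsub>R\<^esub>w\<in>supp f \<times> supp g. if fst w \<otimes>\<^bsub>M\<^esub> snd w = z then r \<otimes>\<^bsub>R\<^esub> (f (fst w) \<otimes>\<^bsub>R\<^esub> g (snd w)) else \<zero>\<^bsub>R\<^esub>)" for z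
      using supp[OF f] supp[OF g] r
      by (subst eq[OF f g supp(2)[OF f] order_refl supp(2)[OF g] order_refl])
        (simp add: R.finsum_rdistr Pi_iff if_distrib[of "\<lambda>x. r \<otimes>\<^bsub>R\<^esub> x"] cong: if_cong)
    show "(r \<odot>\<^bsub>?U\<^esub> f) \<otimes>\<^bsub>?U\<^esub> g = r \<odot>\<^bsub>?U\<^esub> (f \<otimes>\<^bsub>?U\<^esub> g)"
    proof
      fix z
      show "((r \<odot>\<^bsub>?U\<^esub> f) \<otimes>\<^bsub>?U\<^esub> g) z = (r \<odot>\<^bsub>?U\<^esub> (f \<otimes>\<^bsub>?U\<^esub> g)) z"
        using eq[OF _ g supp(2)[OF f] S(1) supp(2)[OF g] order_refl] C(2)[OF r f] supp(1)[OF f] supp(1)[OF g] r *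
        by (simp add: R.m_assoc cong: if_cong)
    qed
    show "f \<otimes>\<^bsub>?U\<^esub> (r \<odot>\<^bsub>?U\<^esub> g) = r \<odot>\<^bsub>?U\<^esub> (f \<otimes>\<^bsub>?U\<^esub> g)"
    proof
      fix z
      show "(f \<otimes>\<^bsub>?U\<^esub> (r \<odot>\<^bsub>?U\<^esub> g)) z = (r \<odot>\<^bsub>?U\<^esub> (f \<otimes>\<^bsub>?U\<^esub> g)) z"
        using eq[OF f _ supp(2)[OF f] order_refl supp(2)[OF g] S(2)] C(2)[OF r g] supp(1)[OF f] supp(1)[OF g] r *
        by (simp add: R.m_lcomm cong: if_cong)
    qed
  qed
  show single: "single R x \<otimes>\<^bsub>?U\<^esub> single R y = single R (x \<otimes>\<^bsub>M\<^esub> y)"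
    if "x \<in> carrier M" "y \<in> carrier M" for x y
  proof
    fix z
    have "supp (single R x) \<subseteq> {x}" for x :: 'x
      by (auto simp: supp_def single_def)
    from eq[OF R.single_finsupp[OF that(1)] R.single_finsupp[OF that(2)] _ this _ this, of z]
    show "(single R x \<otimes>\<^bsub>?U\<^esub> single R y) z = single R (x \<otimes>\<^bsub>M\<^esub> y) z"
      by (auto simp: single_def)
  qed
  \<comment> \<open>Scalar multiples are included because the delta functions alone need not
    generate the algebra additively.\<close>
  let ?S = "(\<lambda>(r, x). r \<odot>\<^bsub>?U\<^esub> single R x) ` (carrier R \<times> carrier M)"
  have "ring ?U"
  proof (rule ringI_generators[of _ ?S])
    show "abelian_group ?U" by (rule U.abelian_group_axioms)
    show "\<one>\<^bsub>?U\<^esub> \<in> carrier ?U" by (simp add: R.single_finsupp)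
    show "?S \<subseteq> carrier ?U" using C(2) R.single_finsupp by fastforce
    show "carrier ?U \<subseteq> H" if "H \<subseteq> carrier ?U" "?S \<subseteq> H" "\<zero>\<^bsub>?U\<^esub> \<in> H"
      "\<And>x y. x \<in> H \<Longrightarrow> y \<in> H \<Longrightarrow> x \<oplus>\<^bsub>?U\<^esub> y \<in> H" for H
      using that R.monoid_algebra_generators[of H "carrier M"] by (force simp: image_subset_iff)
    show "x \<otimes>\<^bsub>?U\<^esub> y \<otimes>\<^bsub>?U\<^esub> z = x \<otimes>\<^bsub>?U\<^esub> (y \<otimes>\<^bsub>?U\<^esub> z)" if "x \<in> ?S" "y \<in> ?S" "z \<in> ?S" for x y z
      using that
      by (auto simp del: monoid_algebra_simps(5) simp: smult_l smult_r single closed C' R.single_finsupp M.m_assoc)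
    show "\<one>\<^bsub>?U\<^esub> \<otimes>\<^bsub>?U\<^esub> x = x" "x \<otimes>\<^bsub>?U\<^esub> \<one>\<^bsub>?U\<^esub> = x" if "x \<in> ?S" for x
      using that
      by (auto simp del: monoid_algebra_simps(5) simp: smult_l smult_r single closed C' R.single_finsupp)
  qed (use closed ld rd in auto)
  then show "assoc_algebra R ?U"
    using smult_l smult_r U.module_axioms
    by (simp add: assoc_algebra_def assoc_algebra_axioms_def del: monoid_algebra_simps(5))
qed

section \<open>Tensor products\<close>

lemma tensor_simps [simp]:
  "carrier (tensor R A B) = a_rcosets\<^bsub>monoid_algebra R (A \<times>\<times> B)\<^esub> (tensor_kernel R A B)"
  "x \<otimes>\<^bsub>tensor R A B\<^esub> y = rcoset_mult (monoid_algebra R (A \<times>\<times> B)) (tensor_kernel R A B) x y"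
  "\<one>\<^bsub>tensor R A B\<^esub> = tensor_kernel R A B +>\<^bsub>monoid_algebra R (A \<times>\<times> B)\<^esub> single R (\<one>\<^bsub>A\<^esub>, \<one>\<^bsub>B\<^esub>)"
  "\<zero>\<^bsub>tensor R A B\<^esub> = tensor_kernel R A B"
  "x \<oplus>\<^bsub>tensor R A B\<^esub> y = x <+>\<^bsub>monoid_algebra R (A \<times>\<times> B)\<^esub> y"
  "r \<odot>\<^bsub>tensor R A B\<^esub> x =
     (\<Union>z\<in>x. tensor_kernel R A B +>\<^bsub>monoid_algebra R (A \<times>\<times> B)\<^esub> (r \<odot>\<^bsub>monoid_algebra R (A \<times>\<times> B)\<^esub> z))"
  by (simp_all add: tensor_def Let_def ring.defs module.defs FactRing_def)

context
  fixes R :: "('r, 'm) ring_scheme" and A :: "('r, 'a, 'c) module_scheme"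
    and B :: "('r, 'b, 'd) module_scheme"
  assumes A: "assoc_algebra R A" and B: "assoc_algebra R B"
begin

interpretation A: assoc_algebra R A by (rule A)
interpretation B: assoc_algebra R B by (rule B)

private abbreviation (input) "U \<equiv> monoid_algebra R (A \<times>\<times> B)"
private abbreviation (input) "T \<equiv> tensor R A B"
private abbreviation (input) "I \<equiv> tensor_kernel R A B"
private abbreviation (input) "e \<equiv> single R"
private abbreviation (input) "q \<equiv> (\<lambda>x. I +>\<^bsub>U\<^esub> x)"

private lemma U: "assoc_algebra R U"
  by (intro assoc_algebra_monoid_algebra DirProd_monoid A.R.is_cring A.is_monoid B.is_monoid)

interpretation U: assoc_algebra R U by (rule U)

private lemma e_closed: "a \<in> carrier A \<Longrightarrow> b \<in> carrier B \<Longrightarrow> e (a, b) \<in> carrier U"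
  by (simp add: A.R.single_finsupp)

private lemma e_mult:
  assumes "a \<in> carrier A" "b \<in> carrier B" "c \<in> carrier A" "d \<in> carrier B"
  shows "e (a, b) \<otimes>\<^bsub>U\<^esub> e (c, d) = e (a \<otimes>\<^bsub>A\<^esub> c, b \<otimes>\<^bsub>B\<^esub> d)"
proof -
  have "Group.monoid (A \<times>\<times> B)"
    by (intro DirProd_monoid A.is_monoid B.is_monoid)
  from assoc_algebra_monoid_algebra(2)[OF A.R.is_cring this, of "(a, b)" "(c, d)"] assms
  show ?thesis by simp
qed

private lemma relators_subset: "tensor_relators R A B \<subseteq> carrier U"
  unfolding tensor_relators_def Let_def
  by (auto simp del: monoid_algebra_simps intro!: U.minus_closed U.a_closed U.smult_closed e_closed)

text \<open>Multiplication by \<open>single R (c, d)\<close> turns a relator into the relator of the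
  same kind whose entries are multiplied by \<open>c\<close> and \<open>d\<close>. This is the
  reason why the relations form an ideal.\<close>

private lemma relators_mult:
  assumes "x \<in> tensor_relators R A B" "c \<in> carrier A" "d \<in> carrier B"
  shows "x \<otimes>\<^bsub>U\<^esub> e (c, d) \<in> tensor_relators R A B" "e (c, d) \<otimes>\<^bsub>U\<^esub> x \<in> tensor_relators R A B"
proof -
  note simps = U.l_distr U.r_distr a_minus_def U.l_minus U.r_minus U.smult_mult_left U.smult_mult_right
    A.l_distr A.r_distr B.l_distr B.r_distr A.smult_mult_left A.smult_mult_right
    B.smult_mult_left B.smult_mult_right e_mult e_closed
  show "x \<otimes>\<^bsub>U\<^esub> e (c, d) \<in> tensor_relators R A B"
    using assms(1)
    unfolding tensor_relators_def Let_def
    apply (elim UnE CollectE exE conjE)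
    subgoal for a a' b
      \<comment> \<open>The witnesses are the old entries multiplied on the right. The four cases
        are the four families of relators in the order of their definition.\<close>
      by (intro UnI1 CollectI exI[of _ "a \<otimes>\<^bsub>A\<^esub> c"] exI[of _ "a' \<otimes>\<^bsub>A\<^esub> c"] exI[of _ "b \<otimes>\<^bsub>B\<^esub> d"])
        (use assms(2,3) in \<open>simp add: simps del: monoid_algebra_simps\<close>)
    subgoal for a b b'
      by (intro UnI1 UnI2 CollectI exI[of _ "a \<otimes>\<^bsub>A\<^esub> c"] exI[of _ "b \<otimes>\<^bsub>B\<^esub> d"] exI[of _ "b' \<otimes>\<^bsub>B\<^esub> d"])
        (use assms(2,3) in \<open>simp add: simps del: monoid_algebra_simps\<close>)
    subgoal for r a b
      by (rule UnI1, rule UnI2, intro CollectI exI[of _ "a \<otimes>\<^bsub>A\<^esub> c"] exI[of _ "b \<otimes>\<^bsub>B\<^esub> d"] exI[of _ r])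
        (use assms(2,3) in \<open>simp add: simps del: monoid_algebra_simps\<close>)
    subgoal for r a b
      by (rule UnI2, intro CollectI exI[of _ "a \<otimes>\<^bsub>A\<^esub> c"] exI[of _ "b \<otimes>\<^bsub>B\<^esub> d"] exI[of _ r])
        (use assms(2,3) in \<open>simp add: simps del: monoid_algebra_simps\<close>)
    done
  show "e (c, d) \<otimes>\<^bsub>U\<^esub> x \<in> tensor_relators R A B"
    using assms(1)
    unfolding tensor_relators_def Let_def
    apply (elim UnE CollectE exE conjE)
    subgoal for a a' b
      by (intro UnI1 CollectI exI[of _ "c \<otimes>\<^bsub>A\<^esub> a"] exI[of _ "c \<otimes>\<^bsub>A\<^esub> a'"] exI[of _ "d \<otimes>\<^bsub>B\<^esub> b"])
        (use assms(2,3) in \<open>simp add: simps del: monoid_algebra_simps\<close>)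
    subgoal for a b b'
      by (intro UnI1 UnI2 CollectI exI[of _ "c \<otimes>\<^bsub>A\<^esub> a"] exI[of _ "d \<otimes>\<^bsub>B\<^esub> b"] exI[of _ "d \<otimes>\<^bsub>B\<^esub> b'"])
        (use assms(2,3) in \<open>simp add: simps del: monoid_algebra_simps\<close>)
    subgoal for r a b
      by (rule UnI1, rule UnI2, intro CollectI exI[of _ "c \<otimes>\<^bsub>A\<^esub> a"] exI[of _ "d \<otimes>\<^bsub>B\<^esub> b"] exI[of _ r])
        (use assms(2,3) in \<open>simp add: simps del: monoid_algebra_simps\<close>)
    subgoal for r a b
      by (rule UnI2, intro CollectI exI[of _ "c \<otimes>\<^bsub>A\<^esub> a"] exI[of _ "d \<otimes>\<^bsub>B\<^esub> b"] exI[of _ r])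
        (use assms(2,3) in \<open>simp add: simps del: monoid_algebra_simps\<close>)
    done
qed

private lemma sub: "submodule I R U"
  unfolding tensor_kernel_def by (rule submodule_span_submodule[OF U.module_axioms relators_subset])

private lemma relators_kernel: "tensor_relators R A B \<subseteq> I"
  unfolding tensor_kernel_def by (rule submodule_span_superset)

text \<open>The product is linear in each argument. For a relator \<open>x\<close> it is enough to
  let \<open>y\<close> run over delta functions, which is \<open>relators_mult\<close>; with
  \<open>y\<close> fixed, the claim then passes from relators to their span.\<close>

private lemma kernel_mult:
  assumes "x \<in> I" "y \<in> carrier U"
  shows "x \<otimes>\<^bsub>U\<^esub> y \<in> I" "y \<otimes>\<^bsub>U\<^esub> x \<in> I"
proof -
  have lin_l: "(\<lambda>y. x \<otimes>\<^bsub>U\<^esub> y) \<in> lin_hom R U U" and lin_r: "(\<lambda>y. y \<otimes>\<^bsub>U\<^esub> x) \<in> lin_hom R U U"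
    if "x \<in> carrier U" for x
    using that by (auto intro!: lin_homI simp del: monoid_algebra_simps
      simp: U.l_distr U.r_distr U.smult_mult_left U.smult_mult_right)
  have span: "y \<in> submodule_span R U (e ` carrier (A \<times>\<times> B))"
    using assms(2) A.R.monoid_algebra_span[of "A \<times>\<times> B"] by simp
  have gen: "e ` carrier (A \<times>\<times> B) \<subseteq> carrier U"
    using e_closed by auto
  have rel: "x \<otimes>\<^bsub>U\<^esub> y \<in> I \<and> y \<otimes>\<^bsub>U\<^esub> x \<in> I" if x: "x \<in> tensor_relators R A B" for x
  proof -
    have "x \<in> carrier U" using x relators_subset by blast
    moreover have "x \<otimes>\<^bsub>U\<^esub> z \<in> I" "z \<otimes>\<^bsub>U\<^esub> x \<in> I" if "z \<in> e ` carrier (A \<times>\<times> B)" for z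
      using that x relators_mult relators_kernel by auto
    ultimately show ?thesis
      using lin_hom_span_image[OF U.module_axioms U.module_axioms lin_l gen sub _ span]
        lin_hom_span_image[OF U.module_axioms U.module_axioms lin_r gen sub _ span] by blast
  qed
  have "x \<in> submodule_span R U (tensor_relators R A B)"
    using assms(1) by (simp add: tensor_kernel_def)
  with rel show "x \<otimes>\<^bsub>U\<^esub> y \<in> I" "y \<otimes>\<^bsub>U\<^esub> x \<in> I"
    using lin_hom_span_image[OF U.module_axioms U.module_axioms lin_l[OF assms(2)] relators_subset sub]
      lin_hom_span_image[OF U.module_axioms U.module_axioms lin_r[OF assms(2)] relators_subset sub] by blast+
qed

private lemma ideal_kernel: "ideal I U"
  using submodule.axioms(1)[OF sub] kernel_mult by (intro idealI U.ring_axioms) auto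

interpretation I: ideal I U by (rule ideal_kernel)

private lemma q_surj: "carrier T = q ` carrier U"
  by (auto simp: A_RCOSETS_def' simp del: monoid_algebra_simps)

text \<open>Two representatives differ by an element of the kernel, which is stable under scalars,
  so the union in the definition has a single value.\<close>

private lemma q_smult: "r \<in> carrier R \<Longrightarrow> x \<in> carrier U \<Longrightarrow> r \<odot>\<^bsub>T\<^esub> q x = q (r \<odot>\<^bsub>U\<^esub> x)"
proof (subst tensor_simps, rule UN_const[where x = x])
  assume r: "r \<in> carrier R" and x: "x \<in> carrier U"
  then show "x \<in> q x" by (rule_tac I.a_rcos_self)
  fix y assume "y \<in> q x"
  then have y: "y \<in> carrier U" "y \<ominus>\<^bsub>U\<^esub> x \<in> I"
    using x U.coset_mem_iff[OF sub] U.coset_eq_iff[OF sub] by metis+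
  then have "r \<odot>\<^bsub>U\<^esub> (y \<ominus>\<^bsub>U\<^esub> x) \<in> I"
    using r submodule.smult_closed[OF sub] by blast
  also have "r \<odot>\<^bsub>U\<^esub> (y \<ominus>\<^bsub>U\<^esub> x) = r \<odot>\<^bsub>U\<^esub> y \<ominus>\<^bsub>U\<^esub> r \<odot>\<^bsub>U\<^esub> x"
    using r x y by (simp add: a_minus_def U.smult_r_distr U.smult_r_minus del: monoid_algebra_simps)
  finally show "q (r \<odot>\<^bsub>U\<^esub> y) = q (r \<odot>\<^bsub>U\<^esub> x)"
    using r x y U.coset_eq_iff[OF sub] U.smult_closed by presburger
qed

private lemma q_lin: "q \<in> lin_hom R U T"
  using q_surj q_smult I.a_rcos_sum by (auto intro!: lin_homI simp del: monoid_algebra_simps)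

lemma assoc_algebra_tensor: "assoc_algebra R T"
  by (rule assoc_algebra_surj_image[where \<rho> = "\<lambda>r. r" and q = q, OF U A.R.is_cring _ _ q_surj _ _ q_smult])
    (use I.a_rcos_sum I.rcoset_mult_add U.coset_zero[OF sub U.zero_closed] submodule_zero[OF sub]
      in \<open>auto simp: ring_hom_def simp del: monoid_algebra_simps(1,3-)\<close>)

interpretation T: assoc_algebra R T by (rule assoc_algebra_tensor)

lemma pure_tensor_span:
  "submodule_span R T {pure_tensor R A B a b | a b. a \<in> carrier A \<and> b \<in> carrier B} = carrier T"
  (is "submodule_span R T ?S = _")
proof
  have S: "?S \<subseteq> carrier T"
    using q_surj e_closed by (auto simp: pure_tensor_def)
  note sub' = submodule_span_submodule[OF T.module_axioms S]
  show "submodule_span R T ?S \<subseteq> carrier T"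
    by (rule submodule_subset[OF sub'])
  have "q x \<in> submodule_span R T ?S" if x: "x \<in> carrier U" for x
  proof (rule lin_hom_span_image[OF U.module_axioms T.module_axioms q_lin _ sub'])
    show "x \<in> submodule_span R U (e ` carrier (A \<times>\<times> B))"
      using x A.R.monoid_algebra_span[of "A \<times>\<times> B"] by simp
    show "q x \<in> submodule_span R T ?S" if "x \<in> e ` carrier (A \<times>\<times> B)" for x
      using that by (intro subsetD[OF submodule_span_superset]) (auto simp: pure_tensor_def)
  qed (use e_closed in auto)
  then show "carrier T \<subseteq> submodule_span R T ?S"
    unfolding q_surj by blast
qed

private lemma q_relator:
  assumes "x \<ominus>\<^bsub>U\<^esub> y \<in> tensor_relators R A B" "x \<in> carrier U" "y \<in> carrier U"
  shows "q x = q y"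
  using assms relators_kernel U.coset_eq_iff[OF sub] by blast

text \<open>Each of the four laws is the vanishing of one family of relators in the
  quotient.\<close>

lemma pure_tensor_bilin: "pure_tensor R A B \<in> bilin R A B T"
proof (rule bilinI)
  show "pure_tensor R A B a b \<in> carrier T" if "a \<in> carrier A" "b \<in> carrier B" for a b
    using that q_surj e_closed by (auto simp: pure_tensor_def)
  note q = lin_hom_add[OF q_lin] lin_hom_smult[OF q_lin]
  show "pure_tensor R A B (a \<oplus>\<^bsub>A\<^esub> a') b = pure_tensor R A B a b \<oplus>\<^bsub>T\<^esub> pure_tensor R A B a' b"
    if "a \<in> carrier A" "a' \<in> carrier A" "b \<in> carrier B" for a a' b
  proof -
    have "q (e (a \<oplus>\<^bsub>A\<^esub> a', b)) = q (e (a, b) \<oplus>\<^bsub>U\<^esub> e (a', b))"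
      using that by (intro q_relator U.a_closed e_closed) (auto simp: tensor_relators_def Let_def)
    then show ?thesis
      unfolding pure_tensor_def using that by (simp only: q e_closed)
  qed
  show "pure_tensor R A B a (b \<oplus>\<^bsub>B\<^esub> b') = pure_tensor R A B a b \<oplus>\<^bsub>T\<^esub> pure_tensor R A B a b'"
    if "a \<in> carrier A" "b \<in> carrier B" "b' \<in> carrier B" for a b b'
  proof -
    have "q (e (a, b \<oplus>\<^bsub>B\<^esub> b')) = q (e (a, b) \<oplus>\<^bsub>U\<^esub> e (a, b'))"
      using that by (intro q_relator U.a_closed e_closed) (auto simp: tensor_relators_def Let_def)
    then show ?thesis
      unfolding pure_tensor_def using that by (simp only: q e_closed)
  qed
  show "pure_tensor R A B (r \<odot>\<^bsub>A\<^esub> a) b = r \<odot>\<^bsub>T\<^esub> pure_tensor R A B a b"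
    if "r \<in> carrier R" "a \<in> carrier A" "b \<in> carrier B" for r a b
  proof -
    have "q (e (r \<odot>\<^bsub>A\<^esub> a, b)) = q (r \<odot>\<^bsub>U\<^esub> e (a, b))"
      using that by (intro q_relator U.smult_closed e_closed)
        (auto simp: tensor_relators_def Let_def simp del: monoid_algebra_simps)
    then show ?thesis
      unfolding pure_tensor_def using that by (simp only: q e_closed)
  qed
  show "pure_tensor R A B a (r \<odot>\<^bsub>B\<^esub> b) = r \<odot>\<^bsub>T\<^esub> pure_tensor R A B a b"
    if "r \<in> carrier R" "a \<in> carrier A" "b \<in> carrier B" for r a b
  proof -
    have "q (e (a, r \<odot>\<^bsub>B\<^esub> b)) = q (r \<odot>\<^bsub>U\<^esub> e (a, b))"
      using that by (intro q_relator U.smult_closed e_closed)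
        (auto simp: tensor_relators_def Let_def simp del: monoid_algebra_simps)
    then show ?thesis
      unfolding pure_tensor_def using that by (simp only: q e_closed)
  qed
qed

lemma pure_tensor_mult:
  assumes "a \<in> carrier A" "b \<in> carrier B" "c \<in> carrier A" "d \<in> carrier B"
  shows "pure_tensor R A B a b \<otimes>\<^bsub>T\<^esub> pure_tensor R A B c d = pure_tensor R A B (a \<otimes>\<^bsub>A\<^esub> c) (b \<otimes>\<^bsub>B\<^esub> d)"
  using assms I.rcoset_mult_add[OF e_closed e_closed] by (simp add: pure_tensor_def e_mult)

lemma pure_tensor_one: "pure_tensor R A B \<one>\<^bsub>A\<^esub> \<one>\<^bsub>B\<^esub> = \<one>\<^bsub>T\<^esub>"
  by (simp add: pure_tensor_def)

text \<open>The universal property. The linear extension of \<open>\<beta>\<close> sends every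
  relator to zero by bilinearity, hence kills the kernel and factors through the quotient. The maps
  out of tensor products constructed below all come from here.\<close>

lemma tensor_lift:
  assumes M: "module R M" and \<beta>: "\<beta> \<in> bilin R A B M"
  obtains h where "h \<in> lin_hom R T M"
    and "\<And>a b. a \<in> carrier A \<Longrightarrow> b \<in> carrier B \<Longrightarrow> h (pure_tensor R A B a b) = \<beta> a b"
proof -
  interpret M: module R M by fact
  define L where "L = lin_ext R M (\<lambda>(a, b). \<beta> a b)"
  have L: "L \<in> lin_hom R U M"
    unfolding L_def using bilinD(3)[OF \<beta>] by (intro lin_ext_lin_hom[OF M]) auto
  have Le: "L (e (a, b)) = \<beta> a b" if "a \<in> carrier A" "b \<in> carrier B" for a b
    unfolding L_def using that bilinD(3)[OF \<beta>] by (subst lin_ext_single[OF M]) auto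
  note L_rules = lin_hom_minus[OF U.module_axioms M L] lin_hom_add[OF L] lin_hom_smult[OF L]
  have rel: "L x = \<zero>\<^bsub>M\<^esub>" if "x \<in> tensor_relators R A B" for x
    using that bilinD(3)[OF \<beta>] unfolding tensor_relators_def Let_def
    by (auto simp: L_rules Le e_closed lin_hom_add[OF bilinD(1)[OF \<beta>]] lin_hom_smult[OF bilinD(1)[OF \<beta>]]
        lin_hom_add[OF bilinD(2)[OF \<beta>]] lin_hom_smult[OF bilinD(2)[OF \<beta>]] M.r_neg a_minus_def[of M]
        simp del: monoid_algebra_simps)
  have "L x = \<zero>\<^bsub>M\<^esub>" if "x \<in> I" for x
  proof -
    have "submodule {\<zero>\<^bsub>M\<^esub>} R M"
      by (rule M.submoduleI) auto
    from lin_hom_span_image[OF U.module_axioms M L relators_subset this] rel that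
    show ?thesis by (simp add: tensor_kernel_def)
  qed
  then have const: "L x = L y" if "x \<in> carrier U" "y \<in> carrier U" "q x = q y" for x y
    using that U.coset_eq_iff[OF sub] lin_hom_closed[OF L] L_rules(1) by (metis M.minus_zero_iff)
  \<comment> \<open>The value on a coset is read at a chosen representative; \<open>const\<close>
    makes the choice irrelevant.\<close>
  define h where "h C = L (SOME x. x \<in> C)" for C
  have hq: "h (q x) = L x" if x: "x \<in> carrier U" for x
  proof -
    have "(SOME y. y \<in> q x) \<in> q x"
      by (rule someI[of "\<lambda>y. y \<in> q x", OF I.a_rcos_self[OF x]])
    then show ?thesis
      unfolding h_def using x U.coset_mem_iff[OF sub] by (intro const) blast+
  qed
  have "h \<in> lin_hom R T M"
    by (rule lin_homI, unfold q_surj)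
      (auto simp: hq lin_hom_closed[OF L] L_rules lin_hom_add[OF q_lin, symmetric] lin_hom_smult[OF q_lin, symmetric]
        simp del: monoid_algebra_simps tensor_simps)
  moreover have "h (pure_tensor R A B a b) = \<beta> a b" if "a \<in> carrier A" "b \<in> carrier B" for a b
    using that by (simp add: pure_tensor_def hq e_closed Le del: monoid_algebra_simps)
  ultimately show thesis
    by (rule that)
qed

end

text \<open>From here on the tensor product is handled through pure tensors and the universal
  property instead of cosets.\<close>

declare tensor_simps [simp del]

section \<open>Interior algebras\<close>

lemma make_interior_simps [simp]:
  "carrier (make_interior R M s) = carrier M"
  "x \<otimes>\<^bsub>make_interior R M s\<^esub> y = x \<otimes>\<^bsub>M\<^esub> y"
  "\<one>\<^bsub>make_interior R M s\<^esub> = \<one>\<^bsub>M\<^esub>"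
  "x \<oplus>\<^bsub>make_interior R M s\<^esub> y = x \<oplus>\<^bsub>M\<^esub> y"
  "\<zero>\<^bsub>make_interior R M s\<^esub> = \<zero>\<^bsub>M\<^esub>"
  "r \<odot>\<^bsub>make_interior R M s\<^esub> x = r \<odot>\<^bsub>M\<^esub> x"
  "structural (make_interior R M s) = lin_ext R M s"
  by (simp_all add: make_interior_def module.defs interior.defs)

lemma make_graded_interior_simps [simp]:
  "carrier (make_graded_interior R M s D) = carrier M"
  "x \<otimes>\<^bsub>make_graded_interior R M s D\<^esub> y = x \<otimes>\<^bsub>M\<^esub> y"
  "\<one>\<^bsub>make_graded_interior R M s D\<^esub> = \<one>\<^bsub>M\<^esub>"
  "x \<oplus>\<^bsub>make_graded_interior R M s D\<^esub> y = x \<oplus>\<^bsub>M\<^esub> y"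
  "\<zero>\<^bsub>make_graded_interior R M s D\<^esub> = \<zero>\<^bsub>M\<^esub>"
  "r \<odot>\<^bsub>make_graded_interior R M s D\<^esub> x = r \<odot>\<^bsub>M\<^esub> x"
  "structural (make_graded_interior R M s D) = lin_ext R M s"
  "homcomp (make_graded_interior R M s D) = D"
  by (simp_all add: make_graded_interior_def make_interior_def module.defs interior.defs graded_interior.defs)

lemma assoc_algebra_make_interior:
  "assoc_algebra R M \<Longrightarrow> assoc_algebra R (make_interior R M s)"
  by (rule assoc_algebra_surj_image[where \<rho> = "\<lambda>r. r" and q = "\<lambda>x. x"])
    (auto simp: ring_hom_def assoc_algebra_def module_def)

lemma assoc_algebra_make_graded_interior:
  "assoc_algebra R M \<Longrightarrow> assoc_algebra R (make_graded_interior R M s D)"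
  by (rule assoc_algebra_surj_image[where \<rho> = "\<lambda>r. r" and q = "\<lambda>x. x"])
    (auto simp: ring_hom_def assoc_algebra_def module_def)

lemma gimage_make_interior:
  "module R M \<Longrightarrow> s x \<in> carrier M \<Longrightarrow> gimage R (make_interior R M s) x = s x"
  by (simp add: gimage_def lin_ext_single)

lemma gimage_make_graded_interior:
  "module R M \<Longrightarrow> s x \<in> carrier M \<Longrightarrow> gimage R (make_graded_interior R M s D) x = s x"
  by (simp add: gimage_def lin_ext_single)

text \<open>A finite sum sees a record only through its carrier, addition and zero. The structural
  map is declared over the bare module, while later arguments evaluate it over the graded record;
  this identifies the two.\<close>

lemma lin_ext_make_graded_interior: "lin_ext R (make_graded_interior R' M s D) = lin_ext R M"
proof -
  have "(\<oplus>\<^bsub>make_graded_interior R' M s D\<^esub>) = (\<oplus>\<^bsub>M\<^esub>)"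
    by (intro ext) simp
  then have "lin_ext R (make_graded_interior R' M s D) t f = lin_ext R M t f" for t f
    by (simp add: lin_ext_def finsum_def finprod_def comp_def)
  then show ?thesis
    by (intro ext)
qed

lemma submodule_make_graded_interior:
  assumes "assoc_algebra k M" "submodule S k M"
  shows "submodule S k (make_graded_interior k M s D)"
proof -
  interpret M: assoc_algebra k M by fact
  interpret E: assoc_algebra k "make_graded_interior k M s D"
    by (rule assoc_algebra_make_graded_interior[OF assms(1)])
  have "(\<lambda>x. x) \<in> lin_hom k M (make_graded_interior k M s D)"
    by (rule lin_homI) auto
  from submodule_image[OF M.module_axioms E.module_axioms this assms(2)] show ?thesis
    by simp
qed

lemma lin_hom_make_graded_interior:
  "lin_hom k M (make_graded_interior k' N s D) = lin_hom k M N"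
  "lin_hom k (make_graded_interior k' N s D) M = lin_hom k N M"
  by (simp_all add: lin_hom_def)

text \<open>On delta functions multiplicativity is that of \<open>s\<close>. Both sides are linear
  in each argument, so it spreads over the span one argument at a time.\<close>

lemma lin_ext_alg_hom:
  assumes M: "assoc_algebra R M" and G: "Group.monoid G" and s: "s \<in> hom G M" and one: "s \<one>\<^bsub>G\<^esub> = \<one>\<^bsub>M\<^esub>"
  shows "lin_ext R M s \<in> alg_hom R (monoid_algebra R G) M"
proof -
  interpret M: assoc_algebra R M by fact
  let ?U = "monoid_algebra R G"
  note U_alg = assoc_algebra_monoid_algebra[OF M.R.is_cring G]
  interpret U: assoc_algebra R ?U by (rule U_alg)
  define L where "L = lin_ext R M s"
  have s': "s x \<in> carrier M" if "x \<in> carrier G" for x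
    using s that by (auto simp: hom_def)
  have L: "L \<in> lin_hom R ?U M"
    unfolding L_def using s by (intro lin_ext_lin_hom M.module_axioms) (auto simp: hom_def)
  note Lr = lin_hom_closed[OF L] lin_hom_add[OF L] lin_hom_smult[OF L]
  have Ls: "L (single R x) = s x" if "x \<in> carrier G" for x
    unfolding L_def by (rule lin_ext_single[where s = s and x = x, OF M.module_axioms s'[OF that]])
  have s_mult: "s (x \<otimes>\<^bsub>G\<^esub> y) = s x \<otimes>\<^bsub>M\<^esub> s y" if "x \<in> carrier G" "y \<in> carrier G" for x y
    using s that by (auto simp: hom_def)
  have gen: "single R ` carrier G \<subseteq> carrier ?U"
    using M.R.single_finsupp by auto
  have span: "f \<in> submodule_span R ?U (single R ` carrier G)" if "f \<in> carrier ?U" for f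
    using that M.R.monoid_algebra_span[of G] by simp
  have lin: "(\<lambda>f. L (f \<otimes>\<^bsub>?U\<^esub> g)) \<in> lin_hom R ?U M" "(\<lambda>f. L f \<otimes>\<^bsub>M\<^esub> L g) \<in> lin_hom R ?U M"
    "(\<lambda>f. L (g \<otimes>\<^bsub>?U\<^esub> f)) \<in> lin_hom R ?U M" "(\<lambda>f. L g \<otimes>\<^bsub>M\<^esub> L f) \<in> lin_hom R ?U M"
    if "g \<in> carrier ?U" for g
    by (rule lin_homI; simp add: that Lr U.l_distr U.r_distr U.smult_mult_left U.smult_mult_right
        M.l_distr M.r_distr M.smult_mult_left M.smult_mult_right del: monoid_algebra_simps)+
  note eq = lin_hom_eq_on_span[OF U.module_axioms M.module_axioms _ _ gen _ span]
  have 1: "L (f \<otimes>\<^bsub>?U\<^esub> single R y) = L f \<otimes>\<^bsub>M\<^esub> L (single R y)" if "f \<in> carrier ?U" "y \<in> carrier G" for f y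
  proof -
    have y: "single R y \<in> carrier ?U"
      using that(2) gen by blast
    show ?thesis
      by (rule eq[OF lin(1,2)[OF y] _ that(1)]) (use that(2) U_alg(2) Ls s_mult G in \<open>auto simp: monoid.m_closed\<close>)
  qed
  have "L (f \<otimes>\<^bsub>?U\<^esub> g) = L f \<otimes>\<^bsub>M\<^esub> L g" if "f \<in> carrier ?U" "g \<in> carrier ?U" for f g
    by (rule eq[OF lin(3,4)[OF that(1)] _ that(2)]) (use 1 that(1) in blast)
  then have "L \<in> ring_hom ?U M"
    using Lr Ls one G by (intro ring_hom_memI) (auto simp del: monoid_algebra_simps(1,3-) intro: monoid.one_closed)
  then show ?thesis
    using Lr(3) by (simp add: alg_hom_def L_def)
qed

lemma interior_algebra_make_interior:
  assumes "assoc_algebra R M" "group G" "s \<in> hom G M" "s \<one>\<^bsub>G\<^esub> = \<one>\<^bsub>M\<^esub>"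
  shows "interior_algebra R G (make_interior R M s)"
  using assms lin_ext_alg_hom[of R M G s] assoc_algebra_make_interior[of R M s]
  by (auto simp: interior_algebra_def interior_algebra_axioms_def alg_hom_def ring_hom_def group.is_monoid)

context interior_algebra begin

lemma gimage_closed [simp]: "x \<in> carrier G \<Longrightarrow> gimage R A x \<in> carrier A"
  using structural_hom ring_hom_closed[of "structural A" "monoid_algebra R G" A "single R x"]
  by (simp add: gimage_def alg_hom_def R.single_finsupp)

lemma gimage_mult: "x \<in> carrier G \<Longrightarrow> y \<in> carrier G \<Longrightarrow> gimage R A (x \<otimes>\<^bsub>G\<^esub> y) = gimage R A x \<otimes> gimage R A y"
  using structural_hom ring_hom_mult[of "structural A" "monoid_algebra R G" A "single R x" "single R y"]
  by (simp add: gimage_def alg_hom_def R.single_finsupp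
      assoc_algebra_monoid_algebra(2)[OF R.is_cring G.is_monoid])

lemma gimage_one: "gimage R A \<one>\<^bsub>G\<^esub> = \<one>"
  using structural_hom ring_hom_one[of "structural A" "monoid_algebra R G" A]
  unfolding gimage_def alg_hom_def by simp

end

text \<open>Pure tensors multiply factorwise, so sending a group element to the tensor of its two
  images is again multiplicative.\<close>

lemma
  assumes A: "interior_algebra R G A" and B: "interior_algebra R G B"
  shows interior_algebra_tensor: "interior_algebra R G (tensor_interior R A B)"
    and gimage_tensor_interior: "x \<in> carrier G \<Longrightarrow>
      gimage R (tensor_interior R A B) x = pure_tensor R A B (gimage R A x) (gimage R B x)"
proof -
  interpret A: interior_algebra R G A by fact
  interpret B: interior_algebra R G B by fact
  note alg = A.assoc_algebra_axioms B.assoc_algebra_axioms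
  interpret T: assoc_algebra R "tensor R A B"
    by (rule assoc_algebra_tensor[OF alg])
  have t: "pure_tensor R A B (gimage R A x) (gimage R B x) \<in> carrier (tensor R A B)" if "x \<in> carrier G" for x
    using that by (intro bilinD(3)[OF pure_tensor_bilin[OF alg]]) auto
  show "interior_algebra R G (tensor_interior R A B)"
    unfolding tensor_interior_def
    by (rule interior_algebra_make_interior)
      (auto intro!: homI t T.assoc_algebra_axioms A.G.group_axioms
        simp: pure_tensor_mult[OF alg] A.gimage_mult B.gimage_mult A.gimage_one B.gimage_one pure_tensor_one[OF alg])
  show "x \<in> carrier G \<Longrightarrow>
      gimage R (tensor_interior R A B) x = pure_tensor R A B (gimage R A x) (gimage R B x)"
    unfolding tensor_interior_def by (intro gimage_make_interior T.module_axioms t)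
qed


section \<open>The automorphism group of \<open>P\<close>\<close>

text \<open>The left factor is applied first. With this convention degrees multiply in the same
  order as the elements that carry them.\<close>

lemma aut_group_simps:
  "\<one>\<^bsub>aut_group G P\<^esub> = (\<lambda>x\<in>P. x)"
  "\<phi> \<in> carrier (aut_group G P) \<Longrightarrow> \<psi> \<in> carrier (aut_group G P) \<Longrightarrow> \<phi> \<otimes>\<^bsub>aut_group G P\<^esub> \<psi> = compose P \<psi> \<phi>"
  by (auto simp: aut_group_def AutoGroup_def BijGroup_def auto_def Let_def)

lemma group_aut_group:
  assumes "group G" "subgroup P G"
  shows "group (aut_group G P)"
proof -
  interpret H: group "AutoGroup (G\<lparr>carrier := P\<rparr>)"
    using assms by (intro group.AutoGroup subgroup.subgroup_is_group)
  show ?thesis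
    unfolding aut_group_def Let_def
    by (rule groupI) (auto simp: H.m_assoc intro: H.r_inv_ex)
qed

lemma aut_groupD:
  assumes "\<phi> \<in> carrier (aut_group G P)"
  shows "bij_betw \<phi> P P" "\<phi> \<in> extensional P"
    and "\<And>u v. u \<in> P \<Longrightarrow> v \<in> P \<Longrightarrow> \<phi> (u \<otimes>\<^bsub>G\<^esub> v) = \<phi> u \<otimes>\<^bsub>G\<^esub> \<phi> v"
    and "\<And>u. u \<in> P \<Longrightarrow> \<phi> u \<in> P"
  using assms by (auto simp: aut_group_def AutoGroup_def auto_def Let_def Bij_def hom_def bij_betw_apply)

lemma aut_group_apply:
  "u \<in> P \<Longrightarrow> \<one>\<^bsub>aut_group G P\<^esub> u = u"
  "\<phi> \<in> carrier (aut_group G P) \<Longrightarrow> \<psi> \<in> carrier (aut_group G P) \<Longrightarrow> u \<in> P \<Longrightarrow>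
    (\<phi> \<otimes>\<^bsub>aut_group G P\<^esub> \<psi>) u = \<psi> (\<phi> u)"
  by (simp_all add: aut_group_simps compose_def)

text \<open>Automorphisms are extensional on \<open>P\<close>, hence lie in a finite set of
  functions from \<open>P\<close> to \<open>P\<close>. This is what makes \<open>K\<close>
  finite.\<close>

lemma finite_aut_group: "finite P \<Longrightarrow> finite (carrier (aut_group G P))"
  by (rule finite_subset[of _ "P \<rightarrow>\<^sub>E P"]) (auto simp: PiE_iff intro: aut_groupD finite_PiE dest: extensional_arb[OF aut_groupD(2)])

section \<open>Twisted fixed points and relative traces\<close>

definition twisted_act ::
  "('r, 'm) ring_scheme \<Rightarrow> ('g, 'n) monoid_scheme \<Rightarrow> ('r, 'a, 'g, 'c) interior_scheme \<Rightarrow>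
   ('g \<Rightarrow> 'g) \<Rightarrow> 'g \<Rightarrow> 'a \<Rightarrow> 'a"
  where "twisted_act R G A \<phi> u a = gimage R A (inv\<^bsub>G\<^esub> u) \<otimes>\<^bsub>A\<^esub> a \<otimes>\<^bsub>A\<^esub> gimage R A (\<phi> u)"

locale brauer = A: assoc_algebra R A + G: group G + P: subgroup P G + J: ideal J R
  for R :: "('r, 'm) ring_scheme" and J :: "'r set" and G :: "('g, 'n) monoid_scheme"
    and P :: "'g set" and A :: "('r, 'a, 'g, 'c) interior_scheme" +
  assumes interior: "interior_algebra R G A" and finite_P: "finite P"
begin

abbreviation H where "H \<equiv> aut_group G P"
abbreviation PG where "PG \<equiv> G\<lparr>carrier := P\<rparr>"
abbreviation g where "g u \<equiv> gimage R A u"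
abbreviation act where "act \<equiv> twisted_act R G A"
abbreviation Fix where "Fix \<equiv> twisted_fixed R A"
abbreviation FA where "FA \<phi> \<equiv> A\<lparr>carrier := Fix \<phi> P\<rparr>"
abbreviation tr where "tr \<phi> Q c \<equiv> twisted_trace R G A P \<phi> Q c"
abbreviation ker where "ker \<phi> \<equiv> brauer_kernel R J G P A \<phi>"
abbreviation cls where "cls \<phi> a \<equiv> ker \<phi> +>\<^bsub>A\<^esub> a"
abbreviation Bq where "Bq \<equiv> brauer_quotient R J G P A"

sublocale H: group H
  by (rule group_aut_group[OF G.group_axioms P.subgroup_axioms])

sublocale PG: group PG
  by (rule P.subgroup_is_group[OF G.group_axioms])

lemmas g_closed = interior_algebra.gimage_closed[OF interior]
lemmas g_mult = interior_algebra.gimage_mult[OF interior]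
lemmas g_one = interior_algebra.gimage_one[OF interior]

lemma P_simps: "u \<in> P \<Longrightarrow> u \<in> carrier G" "u \<in> P \<Longrightarrow> inv\<^bsub>G\<^esub> u \<in> carrier G"
  "\<phi> \<in> carrier H \<Longrightarrow> u \<in> P \<Longrightarrow> \<phi> u \<in> P" "\<phi> \<in> carrier H \<Longrightarrow> u \<in> P \<Longrightarrow> \<phi> u \<in> carrier G"
  by (auto intro: P.mem_carrier aut_groupD(4))

lemma aut_one: "\<phi> \<in> carrier H \<Longrightarrow> \<phi> \<one>\<^bsub>G\<^esub> = \<one>\<^bsub>G\<^esub>"
  using aut_groupD(3)[of \<phi> G P "\<one>\<^bsub>G\<^esub>" "\<one>\<^bsub>G\<^esub>"] P_simps(4)[of \<phi> "\<one>\<^bsub>G\<^esub>"] P.one_closed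
  by (simp add: G.r_cancel_one')

lemma aut_inv:
  assumes "\<phi> \<in> carrier H" "u \<in> P"
  shows "\<phi> (inv\<^bsub>G\<^esub> u) = inv\<^bsub>G\<^esub> (\<phi> u)"
proof -
  have "\<phi> (inv\<^bsub>G\<^esub> u) \<otimes>\<^bsub>G\<^esub> \<phi> u = \<one>\<^bsub>G\<^esub>"
    using aut_groupD(3)[OF assms(1), of "inv\<^bsub>G\<^esub> u" u] assms aut_one[OF assms(1)] by (simp add: P_simps)
  then show ?thesis
    using assms by (intro G.inv_equality[symmetric]) (simp_all add: P_simps)
qed

lemma g_inv_cancel:
  assumes "u \<in> carrier G" "a \<in> carrier A"
  shows "g (inv\<^bsub>G\<^esub> u) \<otimes>\<^bsub>A\<^esub> (g u \<otimes>\<^bsub>A\<^esub> a) = a" "g u \<otimes>\<^bsub>A\<^esub> (g (inv\<^bsub>G\<^esub> u) \<otimes>\<^bsub>A\<^esub> a) = a"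
  using assms by (simp_all add: A.m_assoc[symmetric] g_closed g_one flip: g_mult)

lemma act_closed: "\<phi> \<in> carrier H \<Longrightarrow> u \<in> P \<Longrightarrow> a \<in> carrier A \<Longrightarrow> act \<phi> u a \<in> carrier A"
  by (simp add: twisted_act_def P_simps g_closed)

lemma act_lin: "\<phi> \<in> carrier H \<Longrightarrow> u \<in> P \<Longrightarrow> act \<phi> u \<in> lin_hom R A A"
  by (rule lin_homI)
    (simp_all add: twisted_act_def P_simps g_closed A.l_distr A.r_distr A.smult_mult_left A.smult_mult_right)

text \<open>The action is from the right because inversion reverses products; accordingly the trace
  runs over right cosets \<open>Qu\<close>.\<close>

lemma act_mult:
  assumes "\<phi> \<in> carrier H" "u \<in> P" "v \<in> P" "a \<in> carrier A"
  shows "act \<phi> (u \<otimes>\<^bsub>G\<^esub> v) a = act \<phi> v (act \<phi> u a)"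
  using assms
  by (simp add: twisted_act_def P_simps g_closed g_mult G.inv_mult_group aut_groupD(3) A.m_assoc)

lemma act_one: "\<phi> \<in> carrier H \<Longrightarrow> a \<in> carrier A \<Longrightarrow> act \<phi> \<one>\<^bsub>G\<^esub> a = a"
  by (simp add: twisted_act_def aut_one g_one)

lemma Fix_iff:
  assumes "\<phi> \<in> carrier H" "Q \<subseteq> P"
  shows "a \<in> Fix \<phi> Q \<longleftrightarrow> a \<in> carrier A \<and> (\<forall>u\<in>Q. act \<phi> u a = a)"
proof -
  have "g u \<otimes>\<^bsub>A\<^esub> a = a \<otimes>\<^bsub>A\<^esub> g (\<phi> u) \<longleftrightarrow> act \<phi> u a = a" if "a \<in> carrier A" "u \<in> P" for u
  proof
    assume "g u \<otimes>\<^bsub>A\<^esub> a = a \<otimes>\<^bsub>A\<^esub> g (\<phi> u)"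
    then show "act \<phi> u a = a"
      using that assms by (simp add: twisted_act_def P_simps g_closed A.m_assoc g_inv_cancel flip: \<open>g u \<otimes>\<^bsub>A\<^esub> a = _\<close>)
  next
    assume *: "act \<phi> u a = a"
    have "g u \<otimes>\<^bsub>A\<^esub> act \<phi> u a = a \<otimes>\<^bsub>A\<^esub> g (\<phi> u)"
      using that assms by (simp add: twisted_act_def P_simps g_closed A.m_assoc g_inv_cancel)
    then show "g u \<otimes>\<^bsub>A\<^esub> a = a \<otimes>\<^bsub>A\<^esub> g (\<phi> u)"
      by (simp add: *)
  qed
  then show ?thesis
    using assms(2) by (auto simp: twisted_fixed_def)
qed

lemma FixD:
  assumes "\<phi> \<in> carrier H" "Q \<subseteq> P" "a \<in> Fix \<phi> Q"
  shows "a \<in> carrier A" "u \<in> Q \<Longrightarrow> act \<phi> u a = a"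
  using assms Fix_iff by blast+

lemma Fix_carrier: "Fix \<phi> Q \<subseteq> carrier A"
  by (auto simp: twisted_fixed_def)

lemma Fix_submodule:
  assumes "\<phi> \<in> carrier H" "Q \<subseteq> P"
  shows "submodule (Fix \<phi> Q) R A"
proof -
  have lin: "act \<phi> u \<in> lin_hom R A A" if "u \<in> Q" for u
    using that assms act_lin by blast
  note rules = lin_hom_zero[OF A.module_axioms A.module_axioms lin]
    lin_hom_neg[OF A.module_axioms A.module_axioms lin] lin_hom_add[OF lin] lin_hom_smult[OF lin]
  show ?thesis
    by (rule A.submoduleI) (auto simp: Fix_iff[OF assms] rules)
qed

lemma FA_module: "\<phi> \<in> carrier H \<Longrightarrow> module R (FA \<phi>)"
  by (rule submodule.submodule_is_module[OF Fix_submodule A.module_axioms]) auto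

text \<open>Moving \<open>g (\<phi> u)\<close> past \<open>b\<close> turns it into
  \<open>g (\<psi> (\<phi> u))\<close>, the twist of the product degree; the acting element
  \<open>u\<close> stays the same.\<close>

lemma act_mult_right:
  assumes "\<phi> \<in> carrier H" "\<psi> \<in> carrier H" "u \<in> P" "c \<in> carrier A" "b \<in> Fix \<psi> P"
  shows "act \<phi> u c \<otimes>\<^bsub>A\<^esub> b = act (\<phi> \<otimes>\<^bsub>H\<^esub> \<psi>) u (c \<otimes>\<^bsub>A\<^esub> b)"
proof -
  have b: "b \<in> carrier A" "g (\<phi> u) \<otimes>\<^bsub>A\<^esub> b = b \<otimes>\<^bsub>A\<^esub> g (\<psi> (\<phi> u))"
    using assms P_simps by (auto simp: twisted_fixed_def)
  show ?thesis
    using assms b(1)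
    by (simp add: twisted_act_def P_simps g_closed A.m_assoc b(2) aut_group_apply(2))
qed

text \<open>Here the inverse of \<open>u\<close> has to pass \<open>b\<close>, which turns it into
  the inverse of \<open>\<phi> u\<close>. The second factor is therefore acted on through \<phi>,
  and subgroups will be transported along \<phi>.\<close>

lemma act_mult_left:
  assumes "\<phi> \<in> carrier H" "\<psi> \<in> carrier H" "u \<in> P" "c \<in> carrier A" "b \<in> Fix \<phi> P"
  shows "b \<otimes>\<^bsub>A\<^esub> act \<psi> (\<phi> u) c = act (\<phi> \<otimes>\<^bsub>H\<^esub> \<psi>) u (b \<otimes>\<^bsub>A\<^esub> c)"
proof -
  have b: "b \<in> carrier A" "g (inv\<^bsub>G\<^esub> u) \<otimes>\<^bsub>A\<^esub> b = b \<otimes>\<^bsub>A\<^esub> g (inv\<^bsub>G\<^esub> (\<phi> u))"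
    using assms P_simps aut_inv by (auto simp: twisted_fixed_def)
  have "b \<otimes>\<^bsub>A\<^esub> act \<psi> (\<phi> u) c = (b \<otimes>\<^bsub>A\<^esub> g (inv\<^bsub>G\<^esub> (\<phi> u))) \<otimes>\<^bsub>A\<^esub> c \<otimes>\<^bsub>A\<^esub> g (\<psi> (\<phi> u))"
    using assms b(1) by (simp add: twisted_act_def P_simps g_closed A.m_assoc)
  also have "\<dots> = act (\<phi> \<otimes>\<^bsub>H\<^esub> \<psi>) u (b \<otimes>\<^bsub>A\<^esub> c)"
    using assms b(1)
    by (simp add: twisted_act_def P_simps g_closed A.m_assoc b(2)[symmetric] aut_group_apply(2))
  finally show ?thesis .
qed

text \<open>The element fixed by all of \<open>P\<close> may stand on either side. Standing on the
  left it shifts the subgroup: elements of \<open>Q\<close> act on \<open>a\<close> through their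
  images under \<phi>, which lie in \<open>Q'\<close>.\<close>

lemma Fix_mult:
  assumes "\<phi> \<in> carrier H" "\<psi> \<in> carrier H" "subgroup Q PG"
  shows "a \<in> Fix \<phi> Q \<Longrightarrow> b \<in> Fix \<psi> P \<Longrightarrow> a \<otimes>\<^bsub>A\<^esub> b \<in> Fix (\<phi> \<otimes>\<^bsub>H\<^esub> \<psi>) Q"
    and "b \<in> Fix \<phi> P \<Longrightarrow> (\<And>u. u \<in> Q \<Longrightarrow> \<phi> u \<in> Q') \<Longrightarrow> Q' \<subseteq> P \<Longrightarrow> a \<in> Fix \<psi> Q' \<Longrightarrow>
      b \<otimes>\<^bsub>A\<^esub> a \<in> Fix (\<phi> \<otimes>\<^bsub>H\<^esub> \<psi>) Q"
proof -
  have Q: "Q \<subseteq> P"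
    using subgroup.subset[OF assms(3)] by simp
  note FQ = Fix_iff[OF H.m_closed[OF assms(1,2)] Q]
  show "a \<otimes>\<^bsub>A\<^esub> b \<in> Fix (\<phi> \<otimes>\<^bsub>H\<^esub> \<psi>) Q" if "a \<in> Fix \<phi> Q" "b \<in> Fix \<psi> P"
    unfolding FQ using that assms Q FixD[OF assms(1) Q that(1)] FixD(1)[OF assms(2) order_refl that(2)]
    by (auto simp: act_mult_right[symmetric])
  show "b \<otimes>\<^bsub>A\<^esub> a \<in> Fix (\<phi> \<otimes>\<^bsub>H\<^esub> \<psi>) Q"
    if "b \<in> Fix \<phi> P" "\<And>u. u \<in> Q \<Longrightarrow> \<phi> u \<in> Q'" "Q' \<subseteq> P" "a \<in> Fix \<psi> Q'"
    unfolding FQ using that assms Q FixD[OF assms(2) that(3,4)] FixD(1)[OF assms(1) order_refl that(1)]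
    by (auto simp: act_mult_left[symmetric])
qed

lemma one_Fix: "\<one>\<^bsub>A\<^esub> \<in> Fix \<one>\<^bsub>H\<^esub> P"
  by (simp add: twisted_fixed_def aut_group_apply P_simps g_closed)

section \<open>Right cosets and relative traces\<close>

lemma cosetD:
  assumes "subgroup Q PG" "C \<in> rcosets\<^bsub>PG\<^esub> Q"
  shows "C \<subseteq> P" "C \<noteq> {}" "u \<in> C \<Longrightarrow> v \<in> C \<Longrightarrow> \<exists>q\<in>Q. v = q \<otimes>\<^bsub>G\<^esub> u" "u \<in> C \<Longrightarrow> C = Q #>\<^bsub>PG\<^esub> u"
    "(SOME u. u \<in> C) \<in> C"
proof -
  obtain w where w: "w \<in> P" "C = Q #>\<^bsub>PG\<^esub> w"
    using assms(2) by (auto simp: RCOSETS_def)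
  have self: "w \<in> C"
    using PG.rcos_self[of w Q] w assms(1) by simp
  then show ne: "C \<noteq> {}" by blast
  then show "(SOME u. u \<in> C) \<in> C" by (simp add: some_in_eq)
  show sub: "C \<subseteq> P"
    using PG.r_coset_subset_G[of Q w] subgroup.subset[OF assms(1)] w by simp
  show eq: "C = Q #>\<^bsub>PG\<^esub> u" if "u \<in> C" for u
    using PG.repr_independence[of u Q w] that w assms(1) by simp
  show "\<exists>q\<in>Q. v = q \<otimes>\<^bsub>G\<^esub> u" if "u \<in> C" "v \<in> C"
    using eq[OF that(1)] that(2) by (auto simp: r_coset_def)
qed

lemma finite_rcosets: "finite (rcosets\<^bsub>PG\<^esub> Q)"
proof -
  have "rcosets\<^bsub>PG\<^esub> Q = (\<lambda>u. Q #>\<^bsub>PG\<^esub> u) ` P"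
    by (auto simp: RCOSETS_def)
  then show ?thesis
    using finite_P by simp
qed

text \<open>Two representatives of a right coset differ on the left by an element of
  \<open>Q\<close>, which acts first and fixes \<open>c\<close>.\<close>

lemma act_coset:
  assumes "\<phi> \<in> carrier H" "subgroup Q PG" "c \<in> Fix \<phi> Q" "C \<in> rcosets\<^bsub>PG\<^esub> Q" "u \<in> C"
  shows "act \<phi> (SOME u. u \<in> C) c = act \<phi> u c"
proof -
  note C = cosetD[OF assms(2,4)]
  have Q: "Q \<subseteq> P"
    using subgroup.subset[OF assms(2)] by simp
  obtain q where q: "q \<in> Q" "(SOME u. u \<in> C) = q \<otimes>\<^bsub>G\<^esub> u"
    using C(3)[OF assms(5) C(5)] by blast
  then show ?thesis
    using act_mult[OF assms(1), of q u c] FixD[OF assms(1) Q assms(3)] C(1) assms(5) Q by auto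
qed

lemma tr_eq: "tr \<phi> Q c = (\<Oplus>\<^bsub>A\<^esub>C\<in>rcosets\<^bsub>PG\<^esub> Q. act \<phi> (SOME u. u \<in> C) c)"
  by (simp add: twisted_trace_def twisted_act_def Let_def)

text \<open>Acting by \<open>v\<close> carries the term of a coset \<open>C\<close> to the term of
  \<open>Cv\<close>, so it merely permutes the summands.\<close>

lemma tr_Fix:
  assumes "\<phi> \<in> carrier H" "subgroup Q PG" "c \<in> Fix \<phi> Q"
  shows "tr \<phi> Q c \<in> Fix \<phi> P"
proof -
  define w where "w C = act \<phi> (SOME u. u \<in> C) c" for C
  have Q: "Q \<subseteq> P"
    using subgroup.subset[OF assms(2)] by simp
  note c = FixD[OF assms(1) Q assms(3)]
  have w_closed: "w C \<in> carrier A" if "C \<in> rcosets\<^bsub>PG\<^esub> Q" for C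
    unfolding w_def using cosetD(1,5)[OF assms(2) that] assms(1) c by (intro act_closed) auto
  have "act \<phi> v (tr \<phi> Q c) = tr \<phi> Q c" if v: "v \<in> P" for v
  proof -
    let ?s = "\<lambda>C. C #>\<^bsub>PG\<^esub> v"
    have s_cos: "?s (Q #>\<^bsub>PG\<^esub> u) = Q #>\<^bsub>PG\<^esub> (u \<otimes>\<^bsub>G\<^esub> v)" if "u \<in> P" for u
      using PG.coset_mult_assoc[of Q u v] that v Q by simp
    have s_mem: "?s C \<in> rcosets\<^bsub>PG\<^esub> Q" if "C \<in> rcosets\<^bsub>PG\<^esub> Q" for C
      using that v s_cos by (auto simp: RCOSETS_def)
    have inj: "inj_on ?s (rcosets\<^bsub>PG\<^esub> Q)"
    proof (rule inj_on_inverseI)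
      fix C assume C: "C \<in> rcosets\<^bsub>PG\<^esub> Q"
      then have "C \<subseteq> carrier PG" using cosetD(1)[OF assms(2)] by simp
      then show "(C #>\<^bsub>PG\<^esub> v) #>\<^bsub>PG\<^esub> (inv\<^bsub>PG\<^esub> v) = C"
        using v PG.coset_mult_assoc[of C v "inv\<^bsub>PG\<^esub> v"] PG.coset_mult_one[of C] PG.r_inv[of v] PG.inv_closed[of v]
        by simp
    qed
    have image: "?s ` (rcosets\<^bsub>PG\<^esub> Q) = rcosets\<^bsub>PG\<^esub> Q"
      using endo_inj_surj[OF finite_rcosets _ inj] s_mem by auto
    have ws: "w (?s C) = act \<phi> v (w C)" if C: "C \<in> rcosets\<^bsub>PG\<^esub> Q" for C
    proof -
      let ?u = "SOME u. u \<in> C"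
      have u: "?u \<in> C" "?u \<in> P"
        using cosetD(1,5)[OF assms(2) C] by auto
      then have "?u \<otimes>\<^bsub>G\<^esub> v \<in> ?s C"
        by (auto simp: r_coset_def)
      then have "w (?s C) = act \<phi> (?u \<otimes>\<^bsub>G\<^esub> v) c"
        unfolding w_def by (rule act_coset[OF assms s_mem[OF C]])
      then show ?thesis
        unfolding w_def using act_mult[OF assms(1) u(2) v c(1)] by simp
    qed
    have "act \<phi> v (tr \<phi> Q c) = (\<Oplus>\<^bsub>A\<^esub>C\<in>rcosets\<^bsub>PG\<^esub> Q. act \<phi> v (w C))"
      unfolding tr_eq w_def[symmetric] using w_closed
      by (intro lin_hom_finsum[OF A.module_axioms A.module_axioms act_lin[OF assms(1) v]]) auto
    also have "\<dots> = (\<Oplus>\<^bsub>A\<^esub>C\<in>rcosets\<^bsub>PG\<^esub> Q. w (?s C))"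
      using ws w_closed s_mem by (intro A.finsum_cong') auto
    also have "\<dots> = (\<Oplus>\<^bsub>A\<^esub>C\<in>?s ` (rcosets\<^bsub>PG\<^esub> Q). w C)"
      using w_closed s_mem by (intro A.finsum_reindex[symmetric] inj) auto
    finally show ?thesis
      unfolding image by (simp add: tr_eq w_def)
  qed
  then show ?thesis
    using w_closed unfolding Fix_iff[OF assms(1) order_refl] tr_eq w_def[symmetric]
    by (auto intro: A.finsum_closed)
qed

section \<open>Brauer quotients\<close>

definition ker_gens where "ker_gens \<phi> =
  (\<Union>Q\<in>{Q. subgroup Q PG \<and> Q \<noteq> P}. twisted_trace R G A P \<phi> Q ` twisted_fixed R A \<phi> Q)
       \<union> {r \<odot>\<^bsub>A\<^esub> a | r a. r \<in> J \<and> a \<in> twisted_fixed R A \<phi> P}"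

lemma ker_eq: "ker \<phi> = submodule_span R (FA \<phi>) (ker_gens \<phi>)"
  by (simp add: brauer_kernel_def ker_gens_def)

lemma ker_gens_subset: "\<phi> \<in> carrier H \<Longrightarrow> ker_gens \<phi> \<subseteq> carrier (FA \<phi>)"
  using submodule.smult_closed[OF Fix_submodule[OF _ order_refl]] J.Icarr
  by (auto simp: ker_gens_def intro: tr_Fix)

lemma ker_submodule: "\<phi> \<in> carrier H \<Longrightarrow> submodule (ker \<phi>) R (FA \<phi>)"
  unfolding ker_eq by (rule submodule_span_submodule[OF FA_module ker_gens_subset])

lemma tr_ker: "subgroup Q PG \<Longrightarrow> Q \<noteq> P \<Longrightarrow> c \<in> Fix \<phi> Q \<Longrightarrow> tr \<phi> Q c \<in> ker \<phi>"
  unfolding ker_eq by (rule subsetD[OF submodule_span_superset]) (auto simp: ker_gens_def)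

lemma smult_ker: "r \<in> J \<Longrightarrow> a \<in> Fix \<phi> P \<Longrightarrow> r \<odot>\<^bsub>A\<^esub> a \<in> ker \<phi>"
  unfolding ker_eq by (rule subsetD[OF submodule_span_superset]) (auto simp: ker_gens_def)

text \<open>The kernel is a span, so only traces from proper subgroups and multiples by
  \<open>J\<close> have to be checked. Stability of the kernels under products, pure tensors and
  coordinates is proved in this way.\<close>

lemma ker_induct:
  assumes "\<phi> \<in> carrier H" "module R M" "h \<in> lin_hom R (FA \<phi>) M" "submodule N R M"
    and "\<And>Q c. subgroup Q PG \<Longrightarrow> Q \<noteq> P \<Longrightarrow> c \<in> Fix \<phi> Q \<Longrightarrow> h (tr \<phi> Q c) \<in> N"
    and "\<And>r a. r \<in> J \<Longrightarrow> a \<in> Fix \<phi> P \<Longrightarrow> h (r \<odot>\<^bsub>A\<^esub> a) \<in> N"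
    and "x \<in> ker \<phi>"
  shows "h x \<in> N"
proof (rule lin_hom_span_image[OF FA_module[OF assms(1)] assms(2,3) ker_gens_subset[OF assms(1)] assms(4)])
  show "h y \<in> N" if "y \<in> ker_gens \<phi>" for y
    using that assms(5,6) unfolding ker_gens_def by blast
  show "x \<in> submodule_span R (FA \<phi>) (ker_gens \<phi>)"
    using assms(7) unfolding ker_eq .
qed

lemma ker_carrier: "\<phi> \<in> carrier H \<Longrightarrow> x \<in> ker \<phi> \<Longrightarrow> x \<in> Fix \<phi> P"
  using submodule_subset[OF ker_submodule] by auto

lemma ker_add: "\<phi> \<in> carrier H \<Longrightarrow> x \<in> ker \<phi> \<Longrightarrow> y \<in> ker \<phi> \<Longrightarrow> x \<oplus>\<^bsub>A\<^esub> y \<in> ker \<phi>"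
  using submodule_add[OF ker_submodule] by simp

text \<open>The factor \<open>b\<close> is fixed by the whole of \<open>P\<close> and can be pulled
  into the trace, which becomes a trace from the same subgroup in the product degree.\<close>

lemma ker_mult_right:
  assumes "\<phi> \<in> carrier H" "\<psi> \<in> carrier H" "x \<in> ker \<phi>" "b \<in> Fix \<psi> P"
  shows "x \<otimes>\<^bsub>A\<^esub> b \<in> ker (\<phi> \<otimes>\<^bsub>H\<^esub> \<psi>)"
proof -
  let ?\<chi> = "\<phi> \<otimes>\<^bsub>H\<^esub> \<psi>"
  have \<chi>: "?\<chi> \<in> carrier H" using assms by blast
  have b: "b \<in> carrier A" using FixD[OF assms(2) order_refl assms(4)] by blast
  have PP: "subgroup P PG" using PG.subgroup_self by simp
  show ?thesis
  proof (rule ker_induct[OF assms(1) FA_module[OF \<chi>] _ ker_submodule[OF \<chi>] _ _ assms(3)])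
    show "(\<lambda>x. x \<otimes>\<^bsub>A\<^esub> b) \<in> lin_hom R (FA \<phi>) (FA ?\<chi>)"
      using b FixD(1)[OF assms(1) order_refl] Fix_mult(1)[OF assms(1,2) PP _ assms(4)]
      by (intro lin_homI) (auto simp: A.l_distr A.smult_mult_left)
    show "r \<odot>\<^bsub>A\<^esub> a \<otimes>\<^bsub>A\<^esub> b \<in> ker ?\<chi>" if "r \<in> J" "a \<in> Fix \<phi> P" for r a
      using that b J.Icarr FixD(1)[OF assms(1) order_refl that(2)] Fix_mult(1)[OF assms(1,2) PP that(2) assms(4)]
      by (simp add: A.smult_mult_left smult_ker)
    show "tr \<phi> Q c \<otimes>\<^bsub>A\<^esub> b \<in> ker ?\<chi>" if Q: "subgroup Q PG" "Q \<noteq> P" and c: "c \<in> Fix \<phi> Q" for Q c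
    proof -
      have c': "c \<in> carrier A" using c Fix_carrier by blast
      have u: "(SOME u. u \<in> C) \<in> P" if "C \<in> rcosets\<^bsub>PG\<^esub> Q" for C
        using cosetD(1,5)[OF Q(1) that] by blast
      have "tr \<phi> Q c \<otimes>\<^bsub>A\<^esub> b = (\<Oplus>\<^bsub>A\<^esub>C\<in>rcosets\<^bsub>PG\<^esub> Q. act \<phi> (SOME u. u \<in> C) c \<otimes>\<^bsub>A\<^esub> b)"
        unfolding tr_eq using u c' assms(1) b
        by (intro A.finsum_ldistr finite_rcosets) (auto intro: act_closed)
      also have "\<dots> = tr ?\<chi> Q (c \<otimes>\<^bsub>A\<^esub> b)"
        unfolding tr_eq using u c' b \<chi> assms
        by (intro A.finsum_cong') (auto intro: act_closed simp: act_mult_right)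
      finally show ?thesis
        using tr_ker[OF Q Fix_mult(1)[OF assms(1,2) Q(1) c assms(4)]] by simp
    qed
  qed
qed

text \<open>As on the right, except that pulling \<open>b\<close> into the trace from the left
  replaces \<open>Q\<close> by its preimage under \<phi>. The preimage is proper again because
  \<phi> is bijective on \<open>P\<close>, so the result still lies in the kernel.\<close>

lemma ker_mult_left:
  assumes "\<phi> \<in> carrier H" "\<psi> \<in> carrier H" "b \<in> Fix \<phi> P" "x \<in> ker \<psi>"
  shows "b \<otimes>\<^bsub>A\<^esub> x \<in> ker (\<phi> \<otimes>\<^bsub>H\<^esub> \<psi>)"
proof -
  let ?\<chi> = "\<phi> \<otimes>\<^bsub>H\<^esub> \<psi>"
  have \<chi>: "?\<chi> \<in> carrier H" using assms by blast
  have b: "b \<in> carrier A" using FixD[OF assms(1) order_refl assms(3)] by blast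
  have PP: "subgroup P PG" using PG.subgroup_self by simp
  note \<phi> = aut_groupD[OF assms(1)]
  have Fix_b: "b \<otimes>\<^bsub>A\<^esub> a \<in> Fix ?\<chi> P" if "a \<in> Fix \<psi> P" for a
    using Fix_mult(2)[OF assms(1,2) PP assms(3) _ order_refl that] \<phi>(4) by blast
  show ?thesis
  proof (rule ker_induct[OF assms(2) FA_module[OF \<chi>] _ ker_submodule[OF \<chi>] _ _ assms(4)])
    show "(\<lambda>x. b \<otimes>\<^bsub>A\<^esub> x) \<in> lin_hom R (FA \<psi>) (FA ?\<chi>)"
      using b FixD(1)[OF assms(2) order_refl] Fix_b
      by (intro lin_homI) (auto simp: A.r_distr A.smult_mult_right)
    show "b \<otimes>\<^bsub>A\<^esub> (r \<odot>\<^bsub>A\<^esub> a) \<in> ker ?\<chi>" if "r \<in> J" "a \<in> Fix \<psi> P" for r a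
      using that b J.Icarr FixD(1)[OF assms(2) order_refl that(2)] Fix_b[OF that(2)]
      by (simp add: A.smult_mult_right smult_ker)
    show "b \<otimes>\<^bsub>A\<^esub> tr \<psi> Q c \<in> ker ?\<chi>" if Q: "subgroup Q PG" "Q \<noteq> P" and c: "c \<in> Fix \<psi> Q" for Q c
    proof -
      have c': "c \<in> carrier A" using c Fix_carrier by blast
      have QP: "Q \<subseteq> P" using subgroup.subset[OF Q(1)] by simp
      define Q' where "Q' = {u \<in> P. \<phi> u \<in> Q}"
      have im: "\<phi> ` P = P" and inj_\<phi>: "inj_on \<phi> P"
        using \<phi>(1) by (simp_all add: bij_betw_def)
      have img: "\<phi> ` Q' = Q"
      proof
        show "Q \<subseteq> \<phi> ` Q'"
        proof
          fix y assume y: "y \<in> Q"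
          then have "y \<in> \<phi> ` P" using QP im by blast
          then show "y \<in> \<phi> ` Q'" using y by (auto simp: Q'_def)
        qed
      qed (auto simp: Q'_def)
      have Q': "subgroup Q' PG"
      proof (rule PG.subgroupI)
        show "Q' \<subseteq> carrier PG" by (auto simp: Q'_def)
        have "\<one>\<^bsub>G\<^esub> \<in> Q" using subgroup.one_closed[OF Q(1)] by simp
        then have "\<one>\<^bsub>G\<^esub> \<in> Q'" using aut_one[OF assms(1)] by (simp add: Q'_def)
        then show "Q' \<noteq> {}" by blast
        show "inv\<^bsub>PG\<^esub> u \<in> Q'" if "u \<in> Q'" for u
          using that subgroup.m_inv_closed[OF Q(1), of "\<phi> u"] aut_inv[OF assms(1), of u] \<phi>(4)
          by (auto simp: Q'_def G.m_inv_consistent[OF P.subgroup_axioms])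
        show "u \<otimes>\<^bsub>PG\<^esub> v \<in> Q'" if "u \<in> Q'" "v \<in> Q'" for u v
          using that subgroup.m_closed[OF Q(1), of "\<phi> u" "\<phi> v"] \<phi>(3) by (auto simp: Q'_def)
      qed
      have Q'P: "Q' \<noteq> P"
        using img Q(2) im by auto
      have bc: "b \<otimes>\<^bsub>A\<^esub> c \<in> Fix ?\<chi> Q'"
        by (rule Fix_mult(2)[OF assms(1,2) Q' assms(3) _ QP c]) (simp add: Q'_def)
      define w where "w C = act \<psi> (SOME u. u \<in> C) c" for C
      have u: "(SOME u. u \<in> C) \<in> P" "(SOME u. u \<in> C) \<in> C" if "C \<in> rcosets\<^bsub>PG\<^esub> Q" for C
        using cosetD(1,5)[OF Q(1) that] by blast+
      have u': "(SOME u. u \<in> C) \<in> P" "(SOME u. u \<in> C) \<in> C" if "C \<in> rcosets\<^bsub>PG\<^esub> Q'" for C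
        using cosetD(1,5)[OF Q' that] by blast+
      have w_closed: "w C \<in> carrier A" if "C \<in> rcosets\<^bsub>PG\<^esub> Q" for C
        unfolding w_def using u[OF that] c' assms(2) by (intro act_closed)
      have coset_image: "\<phi> ` (Q' #>\<^bsub>PG\<^esub> u) = Q #>\<^bsub>PG\<^esub> (\<phi> u)" if "u \<in> P" for u
      proof -
        have "\<phi> ` (Q' #>\<^bsub>PG\<^esub> u) = (\<lambda>x. \<phi> (x \<otimes>\<^bsub>G\<^esub> u)) ` Q'"
          by (auto simp: r_coset_def)
        also have "\<dots> = (\<lambda>x. x \<otimes>\<^bsub>G\<^esub> \<phi> u) ` \<phi> ` Q'"
          unfolding image_image using that by (intro image_cong refl \<phi>(3)) (auto simp: Q'_def)
        finally show ?thesis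
          unfolding img by (auto simp: r_coset_def)
      qed
      \<comment> \<open>Taking images under \<phi> matches the cosets of \<open>Q'\<close> with
        those of \<open>Q\<close>, so the trace can be reindexed.\<close>
      have rc: "rcosets\<^bsub>PG\<^esub> Q = (\<lambda>C. \<phi> ` C) ` (rcosets\<^bsub>PG\<^esub> Q')"
      proof -
        have "rcosets\<^bsub>PG\<^esub> Q = (\<lambda>u. Q #>\<^bsub>PG\<^esub> u) ` \<phi> ` P"
          unfolding im by (auto simp: RCOSETS_def)
        also have "\<dots> = (\<lambda>C. \<phi> ` C) ` (\<lambda>u. Q' #>\<^bsub>PG\<^esub> u) ` P"
          using coset_image by (simp add: image_image)
        finally show ?thesis by (auto simp: RCOSETS_def)
      qed
      have inj: "inj_on (\<lambda>C. \<phi> ` C) (rcosets\<^bsub>PG\<^esub> Q')"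
        by (rule inj_onI) (simp add: inj_on_image_eq_iff[OF inj_\<phi>] cosetD(1)[OF Q'])
      have "b \<otimes>\<^bsub>A\<^esub> tr \<psi> Q c = (\<Oplus>\<^bsub>A\<^esub>C\<in>rcosets\<^bsub>PG\<^esub> Q. b \<otimes>\<^bsub>A\<^esub> w C)"
        unfolding tr_eq w_def[symmetric] using w_closed b by (intro A.finsum_rdistr finite_rcosets) auto
      also have "\<dots> = (\<Oplus>\<^bsub>A\<^esub>C\<in>rcosets\<^bsub>PG\<^esub> Q'. b \<otimes>\<^bsub>A\<^esub> w (\<phi> ` C))"
        unfolding rc using w_closed b unfolding rc by (intro A.finsum_reindex inj) auto
      also have "\<dots> = tr ?\<chi> Q' (b \<otimes>\<^bsub>A\<^esub> c)"
        unfolding tr_eq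
      proof (rule A.finsum_cong'[OF refl])
        show "(\<lambda>C. act ?\<chi> (SOME u. u \<in> C) (b \<otimes>\<^bsub>A\<^esub> c)) \<in> rcosets\<^bsub>PG\<^esub> Q' \<rightarrow> carrier A"
          using u' b c' \<chi> by (auto intro: act_closed)
        fix C assume C: "C \<in> rcosets\<^bsub>PG\<^esub> Q'"
        \<comment> \<open>The image of the chosen representative of \<open>C\<close> need not be the
          one chosen for the image coset; \<open>act_coset\<close> bridges the difference.\<close>
        then have "w (\<phi> ` C) = act \<psi> (\<phi> (SOME u. u \<in> C)) c"
          unfolding w_def using rc u'[OF C] by (intro act_coset[OF assms(2) Q(1) c]) auto
        then show "b \<otimes>\<^bsub>A\<^esub> w (\<phi> ` C) = act ?\<chi> (SOME u. u \<in> C) (b \<otimes>\<^bsub>A\<^esub> c)"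
          using act_mult_left[OF assms(1,2) u'(1)[OF C] c' assms(3)] by simp
      qed
      finally show ?thesis
        using tr_ker[OF Q' Q'P bc] by simp
    qed
  qed
qed

end

section \<open>Classes modulo the Brauer kernel and their operations\<close>

context brauer begin

abbreviation k where "k \<equiv> R Quot J"

lemma k_cring: "cring k"
  by (rule J.quotient_is_cring[OF A.R.is_cring])

lemma k_carrier: "carrier k = (+>\<^bsub>R\<^esub>) J ` carrier R"
  by (auto simp: FactRing_def A_RCOSETS_def')

text \<open>The negative in a record is singled out within its carrier, so after restricting the
  carrier it has to be shown to be the same element.\<close>

lemma FA_minus:
  assumes "\<phi> \<in> carrier H" "a \<in> Fix \<phi> P" "b \<in> Fix \<phi> P"
  shows "a \<ominus>\<^bsub>FA \<phi>\<^esub> b = a \<ominus>\<^bsub>A\<^esub> b"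
proof -
  interpret FA: module R "FA \<phi>" by (rule FA_module[OF assms(1)])
  have b: "b \<in> carrier A" using assms Fix_carrier by blast
  have "\<ominus>\<^bsub>A\<^esub> b \<in> Fix \<phi> P"
    using A.submoduleE(3)[OF Fix_submodule[OF assms(1) order_refl] assms(3)] .
  then have "\<ominus>\<^bsub>FA \<phi>\<^esub> b = \<ominus>\<^bsub>A\<^esub> b"
    using FA.minus_equality[of "\<ominus>\<^bsub>A\<^esub> b" b] assms(3) A.l_neg[OF b] by simp
  then show ?thesis by (simp add: a_minus_def)
qed

text \<open>A coset involves only the addition, which allows classes of the restricted module to be
  written over \<open>A\<close>.\<close>

lemma cls_FA: "ker \<phi> +>\<^bsub>FA \<phi>\<^esub> a = cls \<phi> a"
  by (simp add: a_r_coset_def r_coset_def)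

lemma cls_eq_iff:
  assumes "\<phi> \<in> carrier H" "a \<in> Fix \<phi> P" "b \<in> Fix \<phi> P"
  shows "cls \<phi> a = cls \<phi> b \<longleftrightarrow> a \<ominus>\<^bsub>A\<^esub> b \<in> ker \<phi>"
proof -
  interpret FA: module R "FA \<phi>" by (rule FA_module[OF assms(1)])
  show ?thesis
    using FA.coset_eq_iff[OF ker_submodule[OF assms(1)], of a b] assms by (simp add: cls_FA FA_minus)
qed

lemma cls_mem_iff:
  assumes "\<phi> \<in> carrier H" "a \<in> Fix \<phi> P"
  shows "b \<in> cls \<phi> a \<longleftrightarrow> b \<in> Fix \<phi> P \<and> cls \<phi> b = cls \<phi> a"
proof -
  interpret FA: module R "FA \<phi>" by (rule FA_module[OF assms(1)])
  show ?thesis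
    using FA.coset_mem_iff[OF ker_submodule[OF assms(1)], of a b] assms by (simp add: cls_FA)
qed

lemma cls_add:
  assumes "\<phi> \<in> carrier H" "a \<in> Fix \<phi> P" "b \<in> Fix \<phi> P"
  shows "cls \<phi> a \<oplus>\<^bsub>Bq \<phi>\<^esub> cls \<phi> b = cls \<phi> (a \<oplus>\<^bsub>A\<^esub> b)"
proof -
  interpret FA: module R "FA \<phi>" by (rule FA_module[OF assms(1)])
  interpret I: abelian_subgroup "ker \<phi>" "FA \<phi>"
    by (rule FA.submodule_abelian_subgroup[OF ker_submodule[OF assms(1)]])
  show ?thesis
    using I.a_rcos_sum[of a b] assms
    by (simp add: cls_FA brauer_quotient_def Let_def ring.defs module.defs FactRing_def)
qed

lemma Bq_carrier: "carrier (Bq \<phi>) = cls \<phi> ` Fix \<phi> P"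
  by (auto simp: brauer_quotient_def Let_def ring.defs module.defs FactRing_def A_RCOSETS_def' cls_FA)

lemma cls_zero_iff:
  assumes "\<phi> \<in> carrier H" "a \<in> Fix \<phi> P"
  shows "cls \<phi> a = \<zero>\<^bsub>Bq \<phi>\<^esub> \<longleftrightarrow> a \<in> ker \<phi>"
proof -
  interpret FA: module R "FA \<phi>" by (rule FA_module[OF assms(1)])
  show ?thesis
    using FA.coset_zero[OF ker_submodule[OF assms(1)], of a] assms
    by (simp add: cls_FA brauer_quotient_def Let_def ring.defs module.defs FactRing_def)
qed

lemma cls_zero: "\<phi> \<in> carrier H \<Longrightarrow> cls \<phi> \<zero>\<^bsub>A\<^esub> = \<zero>\<^bsub>Bq \<phi>\<^esub>"
  using cls_zero_iff[of \<phi> "\<zero>\<^bsub>A\<^esub>"] submodule_zero[OF ker_submodule[of \<phi>]] submodule_zero[OF Fix_submodule[of \<phi> P]]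
  by simp

lemma cls_closed: "a \<in> Fix \<phi> P \<Longrightarrow> cls \<phi> a \<in> carrier (Bq \<phi>)"
  by (simp add: Bq_carrier)

lemma cls_add_ker:
  assumes "\<phi> \<in> carrier H" "a \<in> Fix \<phi> P" "d \<in> ker \<phi>"
  shows "cls \<phi> (a \<oplus>\<^bsub>A\<^esub> d) = cls \<phi> a"
proof -
  have *: "a \<in> carrier A" "d \<in> Fix \<phi> P" "d \<in> carrier A"
    using assms ker_carrier Fix_carrier by blast+
  then have "(a \<oplus>\<^bsub>A\<^esub> d) \<ominus>\<^bsub>A\<^esub> a = d"
    using A.a_lcomm[of a d "\<ominus>\<^bsub>A\<^esub> a"] by (simp add: a_minus_def A.a_assoc A.r_neg)
  then show ?thesis
    using assms * submodule_add[OF Fix_submodule[OF assms(1) order_refl]] by (simp add: cls_eq_iff)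
qed

lemma cls_eqE:
  assumes "\<phi> \<in> carrier H" "a \<in> Fix \<phi> P" "b \<in> Fix \<phi> P" "cls \<phi> a = cls \<phi> b"
  obtains d where "d \<in> ker \<phi>" "a = b \<oplus>\<^bsub>A\<^esub> d"
proof
  show "a \<ominus>\<^bsub>A\<^esub> b \<in> ker \<phi>"
    using assms cls_eq_iff by blast
  show "a = b \<oplus>\<^bsub>A\<^esub> (a \<ominus>\<^bsub>A\<^esub> b)"
    using assms(2,3) Fix_carrier[of \<phi> P] A.a_lcomm[of b a "\<ominus>\<^bsub>A\<^esub> b"]
    by (simp add: a_minus_def A.r_neg subset_iff)
qed

text \<open>The definition unites over representatives of the scalar and of the class at once; both
  choices disappear modulo the kernel.\<close>

lemma cls_smult:
  assumes "\<phi> \<in> carrier H" "r \<in> carrier R" "a \<in> Fix \<phi> P"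
  shows "(J +>\<^bsub>R\<^esub> r) \<odot>\<^bsub>Bq \<phi>\<^esub> cls \<phi> a = cls \<phi> (r \<odot>\<^bsub>A\<^esub> a)"
proof -
  note F = Fix_submodule[OF assms(1) order_refl]
  have "(J +>\<^bsub>R\<^esub> r) \<odot>\<^bsub>Bq \<phi>\<^esub> cls \<phi> a = (\<Union>s\<in>J +>\<^bsub>R\<^esub> r. \<Union>b\<in>cls \<phi> a. cls \<phi> (s \<odot>\<^bsub>A\<^esub> b))"
    by (simp add: brauer_quotient_def Let_def ring.defs module.defs FactRing_def)
  also have "\<dots> = cls \<phi> (r \<odot>\<^bsub>A\<^esub> a)"
  proof (rule UN_const[where x = r], rule J.a_rcos_self[OF assms(2)], rule UN_const[where x = a])
    show "a \<in> cls \<phi> a" using assms cls_mem_iff by blast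
    fix s b assume s: "s \<in> J +>\<^bsub>R\<^esub> r" and b: "b \<in> cls \<phi> a"
    then obtain j where j: "j \<in> J" "s = j \<oplus>\<^bsub>R\<^esub> r"
      by (auto simp: a_r_coset_def')
    have b': "b \<in> Fix \<phi> P" "cls \<phi> b = cls \<phi> a"
      using b cls_mem_iff[OF assms(1,3)] by auto
    then obtain d where d: "d \<in> ker \<phi>" "b = a \<oplus>\<^bsub>A\<^esub> d"
      using cls_eqE[OF assms(1) b'(1) assms(3)] by metis
    have car: "a \<in> carrier A" "d \<in> carrier A" "b \<in> carrier A" "j \<in> carrier R"
      using assms d(1) b'(1) ker_carrier[OF assms(1)] Fix_carrier J.Icarr j by blast+
    \<comment> \<open>Changing \<open>r\<close> by \<open>j\<close> in \<open>J\<close> and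
      \<open>a\<close> by \<open>d\<close> in the kernel adds \<open>r d + j b\<close>. The first
      term is a multiple of \<open>d\<close>, the second a multiple by \<open>J\<close>, so both lie
      in the kernel.\<close>
    have "s \<odot>\<^bsub>A\<^esub> b = r \<odot>\<^bsub>A\<^esub> a \<oplus>\<^bsub>A\<^esub> (r \<odot>\<^bsub>A\<^esub> d \<oplus>\<^bsub>A\<^esub> j \<odot>\<^bsub>A\<^esub> b)"
      using car assms(2) by (simp add: j(2) d(2) A.smult_l_distr A.smult_r_distr A.a_ac)
    moreover have "r \<odot>\<^bsub>A\<^esub> d \<oplus>\<^bsub>A\<^esub> j \<odot>\<^bsub>A\<^esub> b \<in> ker \<phi>"
      using smult_ker[OF j(1) b'(1)] submodule.smult_closed[OF ker_submodule[OF assms(1)] assms(2) d(1)]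
        ker_add[OF assms(1)] by simp
    ultimately show "cls \<phi> (s \<odot>\<^bsub>A\<^esub> b) = cls \<phi> (r \<odot>\<^bsub>A\<^esub> a)"
      using cls_add_ker[OF assms(1)] submodule.smult_closed[OF F assms(2,3)] by simp
  qed
  finally show ?thesis .
qed

lemma Bq_module: "\<phi> \<in> carrier H \<Longrightarrow> module k (Bq \<phi>)"
  by (rule module_surj_image[where \<rho> = "(+>\<^bsub>R\<^esub>) J" and q = "cls \<phi>", OF FA_module k_cring k_carrier J.rcos_ring_hom])
    (auto simp: Bq_carrier cls_add cls_smult cls_zero)

text \<open>With \<open>a' = a + d\<close> and \<open>b' = b + d'\<close> the two products differ by
  \<open>a d' + d b'\<close>, and both terms lie in the kernel of the product degree by
  \<open>ker_mult_left\<close> and \<open>ker_mult_right\<close>.\<close>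

lemma cls_mult_cong:
  assumes "\<phi> \<in> carrier H" "\<psi> \<in> carrier H" "a \<in> Fix \<phi> P" "a' \<in> Fix \<phi> P" "b \<in> Fix \<psi> P" "b' \<in> Fix \<psi> P"
    and "cls \<phi> a' = cls \<phi> a" "cls \<psi> b' = cls \<psi> b"
  shows "cls (\<phi> \<otimes>\<^bsub>H\<^esub> \<psi>) (a' \<otimes>\<^bsub>A\<^esub> b') = cls (\<phi> \<otimes>\<^bsub>H\<^esub> \<psi>) (a \<otimes>\<^bsub>A\<^esub> b)"
proof -
  have \<chi>: "\<phi> \<otimes>\<^bsub>H\<^esub> \<psi> \<in> carrier H" using assms by blast
  have PP: "subgroup P PG" using PG.subgroup_self by simp
  obtain d where d: "d \<in> ker \<phi>" "a' = a \<oplus>\<^bsub>A\<^esub> d"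
    using cls_eqE[OF assms(1,4,3,7)] .
  obtain d' where d': "d' \<in> ker \<psi>" "b' = b \<oplus>\<^bsub>A\<^esub> d'"
    using cls_eqE[OF assms(2,6,5,8)] .
  have car: "a \<in> carrier A" "d \<in> carrier A" "b \<in> carrier A" "d' \<in> carrier A" "b' \<in> carrier A"
    using assms d(1) d'(1) ker_carrier Fix_carrier by blast+
  have "a' \<otimes>\<^bsub>A\<^esub> b' = a \<otimes>\<^bsub>A\<^esub> b \<oplus>\<^bsub>A\<^esub> (a \<otimes>\<^bsub>A\<^esub> d' \<oplus>\<^bsub>A\<^esub> d \<otimes>\<^bsub>A\<^esub> b')"
    using car by (simp add: d d' A.l_distr A.r_distr A.a_ac)
  moreover have "a \<otimes>\<^bsub>A\<^esub> d' \<oplus>\<^bsub>A\<^esub> d \<otimes>\<^bsub>A\<^esub> b' \<in> ker (\<phi> \<otimes>\<^bsub>H\<^esub> \<psi>)"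
    using ker_mult_left[OF assms(1,2,3) d'(1)] ker_mult_right[OF assms(1,2) d(1) assms(6)] ker_add[OF \<chi>] by simp
  ultimately show ?thesis
    using cls_add_ker[OF \<chi>] Fix_mult(1)[OF assms(1,2) PP assms(3,5)] by simp
qed

lemma Fix_mult': "\<phi> \<in> carrier H \<Longrightarrow> \<psi> \<in> carrier H \<Longrightarrow> a \<in> Fix \<phi> P \<Longrightarrow> b \<in> Fix \<psi> P \<Longrightarrow>
    a \<otimes>\<^bsub>A\<^esub> b \<in> Fix (\<phi> \<otimes>\<^bsub>H\<^esub> \<psi>) P"
  using Fix_mult(1)[of \<phi> \<psi> P] PG.subgroup_self by simp

lemma cls_mult:
  assumes "\<phi> \<in> carrier H" "\<psi> \<in> carrier H" "a \<in> Fix \<phi> P" "b \<in> Fix \<psi> P"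
  shows "rcoset_mult A (ker (\<phi> \<otimes>\<^bsub>H\<^esub> \<psi>)) (cls \<phi> a) (cls \<psi> b) = cls (\<phi> \<otimes>\<^bsub>H\<^esub> \<psi>) (a \<otimes>\<^bsub>A\<^esub> b)"
  unfolding rcoset_mult_def
proof (rule UN_const[where x = a], use assms cls_mem_iff in blast, rule UN_const[where x = b])
  show "b \<in> cls \<psi> b" using assms cls_mem_iff by blast
  fix a' b' assume "a' \<in> cls \<phi> a" "b' \<in> cls \<psi> b"
  then show "cls (\<phi> \<otimes>\<^bsub>H\<^esub> \<psi>) (a' \<otimes>\<^bsub>A\<^esub> b') = cls (\<phi> \<otimes>\<^bsub>H\<^esub> \<psi>) (a \<otimes>\<^bsub>A\<^esub> b)"
    using assms cls_mem_iff by (intro cls_mult_cong) auto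
qed

lemma rcoset_mult_bilin:
  assumes "\<phi> \<in> carrier H" "\<psi> \<in> carrier H"
  shows "rcoset_mult A (ker (\<phi> \<otimes>\<^bsub>H\<^esub> \<psi>)) \<in> bilin k (Bq \<phi>) (Bq \<psi>) (Bq (\<phi> \<otimes>\<^bsub>H\<^esub> \<psi>))"
proof -
  have \<chi>: "\<phi> \<otimes>\<^bsub>H\<^esub> \<psi> \<in> carrier H" using assms by blast
  have car: "a \<in> carrier A" if "a \<in> Fix \<theta> P" for a \<theta> using that Fix_carrier by blast
  note add = submodule_add[OF Fix_submodule[OF _ order_refl]]
  note sm = submodule.smult_closed[OF Fix_submodule[OF _ order_refl]]
  show ?thesis
    by (rule bilinI)
      (auto simp: Bq_carrier k_carrier cls_mult[OF assms] cls_add cls_smult assms \<chi> Fix_mult'[OF assms] add sm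
        A.l_distr A.r_distr A.smult_mult_left A.smult_mult_right car)
qed

lemma Bq_one_mult:
  "x \<otimes>\<^bsub>Bq \<phi>\<^esub> y = rcoset_mult A (ker \<phi>) x y" "\<one>\<^bsub>Bq \<phi>\<^esub> = cls \<phi> \<one>\<^bsub>A\<^esub>"
  by (simp_all add: brauer_quotient_def Let_def ring.defs module.defs FactRing_def cls_FA rcoset_mult_def)

text \<open>The identity is the only degree equal to its own square. Its fixed points therefore form
  an algebra, and A(P) is the image of that algebra.\<close>

lemma assoc_algebra_Bq_one: "assoc_algebra k (Bq \<one>\<^bsub>H\<^esub>)"
proof (rule assoc_algebra_surj_image[where \<rho> = "(+>\<^bsub>R\<^esub>) J" and q = "cls \<one>\<^bsub>H\<^esub>", OF _ k_cring k_carrier J.rcos_ring_hom])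
  have car: "a \<in> carrier A" if "a \<in> Fix \<one>\<^bsub>H\<^esub> P" for a using that Fix_carrier by blast
  interpret FA: module R "FA \<one>\<^bsub>H\<^esub>" by (rule FA_module) simp
  have "ring (FA \<one>\<^bsub>H\<^esub>)"
    by (intro ringI FA.abelian_group_axioms monoidI)
      (use Fix_mult'[of "\<one>\<^bsub>H\<^esub>" "\<one>\<^bsub>H\<^esub>"] one_Fix in \<open>auto simp: car A.m_assoc A.l_distr A.r_distr\<close>)
  then show "assoc_algebra R (FA \<one>\<^bsub>H\<^esub>)"
    unfolding assoc_algebra_def assoc_algebra_axioms_def
    using FA.module_axioms by (auto simp: car A.smult_mult_left A.smult_mult_right)
qed (use cls_mult[of "\<one>\<^bsub>H\<^esub>" "\<one>\<^bsub>H\<^esub>"] in \<open>auto simp: Bq_carrier cls_add cls_smult cls_zero Bq_one_mult\<close>)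

end


section \<open>The graded algebra of Brauer quotients\<close>

locale brauer_graded = brauer R J G P A + K: subgroup K "aut_group G P"
  for R :: "('r, 'm) ring_scheme" and J :: "'r set" and G :: "('g, 'n) monoid_scheme"
    and P :: "'g set" and A :: "('r, 'a, 'g, 'c) interior_scheme" and K
begin

abbreviation NB where "NB \<equiv> N_bar R J G P K A"
abbreviation m where "m \<chi> \<equiv> rcoset_mult A (ker \<chi>)"

definition inj_comp where "inj_comp \<phi> b = (\<lambda>\<psi>\<in>K. if \<psi> = \<phi> then b else \<zero>\<^bsub>Bq \<psi>\<^esub>)"

lemma K_H: "\<phi> \<in> K \<Longrightarrow> \<phi> \<in> carrier H"
  using K.subset by blast

lemma finite_K: "finite K"
  using finite_aut_group[OF finite_P] K.subset finite_subset by blast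

lemma Bq_module': "\<phi> \<in> K \<Longrightarrow> module k (Bq \<phi>)"
  using Bq_module K_H by blast

text \<open>Since \<open>K\<close> is finite, the finite-support condition of the direct sum is
  automatic and the carrier is the full product.\<close>

lemma NB_carrier: "carrier NB = (\<Pi>\<^sub>E \<phi>\<in>K. carrier (Bq \<phi>))"
proof -
  have "group (add_monoid (Bq \<phi>))" if "\<phi> \<in> K" for \<phi>
    using Bq_module'[OF that] by (simp add: module_def abelian_group.a_group)
  then have "carrier (sum_group K (\<lambda>\<phi>. add_monoid (Bq \<phi>))) = (\<Pi>\<^sub>E \<phi>\<in>K. carrier (Bq \<phi>))"
    using finite_K by (subst carrier_sum_group) auto
  then show ?thesis
    by (simp add: N_bar_def brauer_algebra_def Let_def)
qed

lemma NB_simps: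
  "f \<oplus>\<^bsub>NB\<^esub> h = (\<lambda>\<phi>\<in>K. f \<phi> \<oplus>\<^bsub>Bq \<phi>\<^esub> h \<phi>)"
  "\<zero>\<^bsub>NB\<^esub> = (\<lambda>\<phi>\<in>K. \<zero>\<^bsub>Bq \<phi>\<^esub>)"
  "c \<odot>\<^bsub>NB\<^esub> f = (\<lambda>\<phi>\<in>K. c \<odot>\<^bsub>Bq \<phi>\<^esub> f \<phi>)"
  "f \<otimes>\<^bsub>NB\<^esub> h = (\<lambda>\<chi>\<in>K. \<Oplus>\<^bsub>Bq \<chi>\<^esub>w\<in>{(\<phi>, \<psi>). \<phi> \<in> K \<and> \<psi> \<in> K \<and> \<phi> \<otimes>\<^bsub>H\<^esub> \<psi> = \<chi>}. m \<chi> (f (fst w)) (h (snd w)))"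
  by (simp_all add: N_bar_def brauer_algebra_def Let_def fun_eq_iff)

lemma NB_one: "\<one>\<^bsub>NB\<^esub> = inj_comp \<one>\<^bsub>H\<^esub> (cls \<one>\<^bsub>H\<^esub> \<one>\<^bsub>A\<^esub>)"
  by (simp add: N_bar_def brauer_algebra_def Let_def inj_comp_def cong: if_cong)

lemma NB_homcomp: "homcomp NB \<phi> = {f \<in> carrier NB. \<forall>\<psi>\<in>K. \<psi> \<noteq> \<phi> \<longrightarrow> f \<psi> = \<zero>\<^bsub>Bq \<psi>\<^esub>}"
  by (simp add: N_bar_def Let_def)

lemma NB_app: "f \<in> carrier NB \<Longrightarrow> \<phi> \<in> K \<Longrightarrow> f \<phi> \<in> carrier (Bq \<phi>)"
  by (auto simp: NB_carrier)

lemma NB_ext: "f \<in> carrier NB \<Longrightarrow> h \<in> carrier NB \<Longrightarrow> (\<And>\<phi>. \<phi> \<in> K \<Longrightarrow> f \<phi> = h \<phi>) \<Longrightarrow> f = h"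
  unfolding NB_carrier by (rule PiE_ext)

lemma NB_module: "module k NB"
proof -
  note ag = Bq_module'[THEN module.axioms(2)]
  note simps = NB_carrier NB_simps PiE_iff
  have ab: "abelian_group NB"
  proof (rule abelian_groupI)
    show "\<exists>y\<in>carrier NB. y \<oplus>\<^bsub>NB\<^esub> x = \<zero>\<^bsub>NB\<^esub>" if x: "x \<in> carrier NB" for x
      by (rule bexI[of _ "\<lambda>\<phi>\<in>K. \<ominus>\<^bsub>Bq \<phi>\<^esub> x \<phi>"])
        (use x ag in \<open>auto simp: simps abelian_group.l_neg abelian_group.a_inv_closed intro!: restrict_ext\<close>)
    show "x \<oplus>\<^bsub>NB\<^esub> y \<oplus>\<^bsub>NB\<^esub> z = x \<oplus>\<^bsub>NB\<^esub> (y \<oplus>\<^bsub>NB\<^esub> z)"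
      if "x \<in> carrier NB" "y \<in> carrier NB" "z \<in> carrier NB" for x y z
      unfolding NB_simps by (rule restrict_ext) (use that ag in \<open>simp add: NB_app abelian_groupE(3)\<close>)
    show "x \<oplus>\<^bsub>NB\<^esub> y = y \<oplus>\<^bsub>NB\<^esub> x" if "x \<in> carrier NB" "y \<in> carrier NB" for x y
      unfolding NB_simps by (rule restrict_ext) (intro abelian_groupE(4) ag NB_app that)
    show "\<zero>\<^bsub>NB\<^esub> \<oplus>\<^bsub>NB\<^esub> x = x" if "x \<in> carrier NB" for x
    proof -
      have "\<zero>\<^bsub>NB\<^esub> \<oplus>\<^bsub>NB\<^esub> x = restrict x K"
        unfolding NB_simps by (rule restrict_ext) (use that ag in \<open>simp add: NB_app abelian_groupE(5)\<close>)
      then show ?thesis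
        using that by (simp add: NB_carrier PiE_iff extensional_restrict)
    qed
    show "x \<oplus>\<^bsub>NB\<^esub> y \<in> carrier NB" if "x \<in> carrier NB" "y \<in> carrier NB" for x y
      using that ag by (simp add: simps abelian_groupE(1))
    show "\<zero>\<^bsub>NB\<^esub> \<in> carrier NB"
      using ag by (simp add: simps abelian_groupE(2))
  qed
  show ?thesis
  proof (rule moduleI[OF k_cring ab])
    fix r x assume rx: "r \<in> carrier k" "x \<in> carrier NB"
    show "r \<odot>\<^bsub>NB\<^esub> x \<in> carrier NB"
      using rx by (simp add: simps module.smult_closed[OF Bq_module'])
    show "(r \<oplus>\<^bsub>k\<^esub> s) \<odot>\<^bsub>NB\<^esub> x = r \<odot>\<^bsub>NB\<^esub> x \<oplus>\<^bsub>NB\<^esub> s \<odot>\<^bsub>NB\<^esub> x" if "s \<in> carrier k" for s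
      unfolding NB_simps by (rule restrict_ext) (use rx that in \<open>simp add: NB_app module.smult_l_distr[OF Bq_module']\<close>)
    show "r \<odot>\<^bsub>NB\<^esub> (x \<oplus>\<^bsub>NB\<^esub> y) = r \<odot>\<^bsub>NB\<^esub> x \<oplus>\<^bsub>NB\<^esub> r \<odot>\<^bsub>NB\<^esub> y" if "y \<in> carrier NB" for y
      unfolding NB_simps by (rule restrict_ext) (use rx that in \<open>simp add: NB_app module.smult_r_distr[OF Bq_module']\<close>)
    show "(r \<otimes>\<^bsub>k\<^esub> s) \<odot>\<^bsub>NB\<^esub> x = r \<odot>\<^bsub>NB\<^esub> (s \<odot>\<^bsub>NB\<^esub> x)" if "s \<in> carrier k" for s
      unfolding NB_simps by (rule restrict_ext) (use rx that in \<open>simp add: NB_app module.smult_assoc1[OF Bq_module']\<close>)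
  next
    fix x assume x: "x \<in> carrier NB"
    have "\<one>\<^bsub>k\<^esub> \<odot>\<^bsub>NB\<^esub> x = restrict x K"
      unfolding NB_simps by (rule restrict_ext) (use x in \<open>simp add: NB_app module.smult_one[OF Bq_module']\<close>)
    then show "\<one>\<^bsub>k\<^esub> \<odot>\<^bsub>NB\<^esub> x = x"
      using x by (simp add: NB_carrier PiE_iff extensional_restrict)
  qed
qed

lemma Bq_zero_closed: "\<phi> \<in> K \<Longrightarrow> \<zero>\<^bsub>Bq \<phi>\<^esub> \<in> carrier (Bq \<phi>)"
  by (intro abelian_groupE(2) module.axioms(2)[OF Bq_module'])

lemma NB_proj: "\<phi> \<in> K \<Longrightarrow> (\<lambda>f. f \<phi>) \<in> lin_hom k NB (Bq \<phi>)"
  by (rule lin_homI) (auto simp: NB_app NB_simps)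

lemma inj_comp_closed: "\<phi> \<in> K \<Longrightarrow> b \<in> carrier (Bq \<phi>) \<Longrightarrow> inj_comp \<phi> b \<in> carrier NB"
  using Bq_zero_closed by (auto simp: NB_carrier inj_comp_def)

lemma inj_comp_app: "\<psi> \<in> K \<Longrightarrow> inj_comp \<phi> b \<psi> = (if \<psi> = \<phi> then b else \<zero>\<^bsub>Bq \<psi>\<^esub>)"
  by (simp add: inj_comp_def)

lemma inj_comp_lin:
  assumes "\<phi> \<in> K"
  shows "inj_comp \<phi> \<in> lin_hom k (Bq \<phi>) NB"
proof -
  have z: "\<zero>\<^bsub>Bq \<psi>\<^esub> = \<zero>\<^bsub>Bq \<psi>\<^esub> \<oplus>\<^bsub>Bq \<psi>\<^esub> \<zero>\<^bsub>Bq \<psi>\<^esub>" "r \<in> carrier k \<Longrightarrow> \<zero>\<^bsub>Bq \<psi>\<^esub> = r \<odot>\<^bsub>Bq \<psi>\<^esub> \<zero>\<^bsub>Bq \<psi>\<^esub>"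
    if "\<psi> \<in> K" for \<psi> r
  proof -
    interpret module k "Bq \<psi>" by (rule Bq_module'[OF that])
    show "\<zero>\<^bsub>Bq \<psi>\<^esub> = \<zero>\<^bsub>Bq \<psi>\<^esub> \<oplus>\<^bsub>Bq \<psi>\<^esub> \<zero>\<^bsub>Bq \<psi>\<^esub>" "r \<in> carrier k \<Longrightarrow> \<zero>\<^bsub>Bq \<psi>\<^esub> = r \<odot>\<^bsub>Bq \<psi>\<^esub> \<zero>\<^bsub>Bq \<psi>\<^esub>"
      by simp_all
  qed
  show ?thesis
  proof (rule lin_homI)
    show "inj_comp \<phi> b \<in> carrier NB" if "b \<in> carrier (Bq \<phi>)" for b
      using assms that by (rule inj_comp_closed)
    show "inj_comp \<phi> (b \<oplus>\<^bsub>Bq \<phi>\<^esub> c) = inj_comp \<phi> b \<oplus>\<^bsub>NB\<^esub> inj_comp \<phi> c" for b c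
      unfolding NB_simps inj_comp_def by (rule restrict_ext) (simp add: z(1)[symmetric])
    show "inj_comp \<phi> (r \<odot>\<^bsub>Bq \<phi>\<^esub> b) = r \<odot>\<^bsub>NB\<^esub> inj_comp \<phi> b" if "r \<in> carrier k" for r b
      unfolding NB_simps inj_comp_def by (rule restrict_ext) (simp add: z(2)[OF _ that, symmetric])
  qed
qed

lemma NB_sum:
  assumes "f \<in> carrier NB"
  shows "f = (\<Oplus>\<^bsub>NB\<^esub>\<phi>\<in>K. inj_comp \<phi> (f \<phi>))"
proof (rule NB_ext[OF assms])
  interpret NB: module k NB by (rule NB_module)
  have c: "(\<lambda>\<phi>. inj_comp \<phi> (f \<phi>)) \<in> K \<rightarrow> carrier NB"
    using assms by (auto intro: inj_comp_closed NB_app)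
  then show "(\<Oplus>\<^bsub>NB\<^esub>\<phi>\<in>K. inj_comp \<phi> (f \<phi>)) \<in> carrier NB"
    by (rule NB.finsum_closed)
  fix \<psi> assume \<psi>: "\<psi> \<in> K"
  interpret B: module k "Bq \<psi>" by (rule Bq_module'[OF \<psi>])
  have "(\<Oplus>\<^bsub>NB\<^esub>\<phi>\<in>K. inj_comp \<phi> (f \<phi>)) \<psi> = (\<Oplus>\<^bsub>Bq \<psi>\<^esub>\<phi>\<in>K. inj_comp \<phi> (f \<phi>) \<psi>)"
    by (rule lin_hom_finsum[OF NB_module B.module_axioms NB_proj[OF \<psi>] c])
  also have "\<dots> = inj_comp \<psi> (f \<psi>) \<psi>"
    using \<psi> NB_app[OF assms \<psi>] by (intro B.finsum_single finite_K) (auto simp: inj_comp_app)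
  finally show "f \<psi> = (\<Oplus>\<^bsub>NB\<^esub>\<phi>\<in>K. inj_comp \<phi> (f \<phi>)) \<psi>"
    using \<psi> by (simp add: inj_comp_app)
qed

lemma homcomp_eq: "\<phi> \<in> K \<Longrightarrow> homcomp NB \<phi> = inj_comp \<phi> ` carrier (Bq \<phi>)"
proof (intro equalityI subsetI)
  fix f assume \<phi>: "\<phi> \<in> K" and f: "f \<in> homcomp NB \<phi>"
  then have "f = inj_comp \<phi> (f \<phi>)"
    by (intro NB_ext) (auto simp: NB_homcomp inj_comp_app intro: inj_comp_closed NB_app)
  then show "f \<in> inj_comp \<phi> ` carrier (Bq \<phi>)"
    using \<phi> f NB_app[of f \<phi>] by (auto simp: NB_homcomp)
qed (auto simp: NB_homcomp inj_comp_app intro: inj_comp_closed)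

lemma m_bilin: "\<phi> \<in> K \<Longrightarrow> \<psi> \<in> K \<Longrightarrow> m (\<phi> \<otimes>\<^bsub>H\<^esub> \<psi>) \<in> bilin k (Bq \<phi>) (Bq \<psi>) (Bq (\<phi> \<otimes>\<^bsub>H\<^esub> \<psi>))"
  using rcoset_mult_bilin K_H by blast

lemma m_zero:
  assumes "\<phi> \<in> K" "\<psi> \<in> K"
  shows "b \<in> carrier (Bq \<phi>) \<Longrightarrow> m (\<phi> \<otimes>\<^bsub>H\<^esub> \<psi>) b \<zero>\<^bsub>Bq \<psi>\<^esub> = \<zero>\<^bsub>Bq (\<phi> \<otimes>\<^bsub>H\<^esub> \<psi>)\<^esub>"
    "c \<in> carrier (Bq \<psi>) \<Longrightarrow> m (\<phi> \<otimes>\<^bsub>H\<^esub> \<psi>) \<zero>\<^bsub>Bq \<phi>\<^esub> c = \<zero>\<^bsub>Bq (\<phi> \<otimes>\<^bsub>H\<^esub> \<psi>)\<^esub>"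
proof -
  have \<chi>: "\<phi> \<otimes>\<^bsub>H\<^esub> \<psi> \<in> K" using assms by blast
  note mods = Bq_module'[OF assms(1)] Bq_module'[OF assms(2)] Bq_module'[OF \<chi>]
  show "b \<in> carrier (Bq \<phi>) \<Longrightarrow> m (\<phi> \<otimes>\<^bsub>H\<^esub> \<psi>) b \<zero>\<^bsub>Bq \<psi>\<^esub> = \<zero>\<^bsub>Bq (\<phi> \<otimes>\<^bsub>H\<^esub> \<psi>)\<^esub>"
    by (rule lin_hom_zero[OF mods(2,3) bilinD(1)[OF m_bilin[OF assms]]])
  show "c \<in> carrier (Bq \<psi>) \<Longrightarrow> m (\<phi> \<otimes>\<^bsub>H\<^esub> \<psi>) \<zero>\<^bsub>Bq \<phi>\<^esub> c = \<zero>\<^bsub>Bq (\<phi> \<otimes>\<^bsub>H\<^esub> \<psi>)\<^esub>"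
    by (rule lin_hom_zero[OF mods(1,3) bilinD(2)[OF m_bilin[OF assms]]])
qed

text \<open>Only the pair (\<phi>, \<psi>) contributes to the convolution; every other term has a
  zero factor and vanishes by \<open>m_zero\<close>.\<close>

lemma inj_comp_mult:
  assumes "\<phi> \<in> K" "\<psi> \<in> K" "b \<in> carrier (Bq \<phi>)" "c \<in> carrier (Bq \<psi>)"
  shows "inj_comp \<phi> b \<otimes>\<^bsub>NB\<^esub> inj_comp \<psi> c = inj_comp (\<phi> \<otimes>\<^bsub>H\<^esub> \<psi>) (m (\<phi> \<otimes>\<^bsub>H\<^esub> \<psi>) b c)"
proof -
  have fin: "finite {(\<phi>, \<psi>). \<phi> \<in> K \<and> \<psi> \<in> K \<and> \<phi> \<otimes>\<^bsub>H\<^esub> \<psi> = \<chi>}" for \<chi>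
    by (rule finite_subset[of _ "K \<times> K"]) (use finite_K in auto)
  \<comment> \<open>The target degree is kept in the form of a product, because bilinearity of
    \<open>m\<close> is available only when its index is the product of the two source
    degrees.\<close>
  have summand: "m (\<phi>' \<otimes>\<^bsub>H\<^esub> \<psi>') (inj_comp \<phi> b \<phi>') (inj_comp \<psi> c \<psi>') = 
     (if \<phi>' = \<phi> \<and> \<psi>' = \<psi> then m (\<phi> \<otimes>\<^bsub>H\<^esub> \<psi>) b c else \<zero>\<^bsub>Bq (\<phi>' \<otimes>\<^bsub>H\<^esub> \<psi>')\<^esub>)" if "\<phi>' \<in> K" "\<psi>' \<in> K" for \<phi>' \<psi>'
    using that assms m_zero Bq_zero_closed by (auto simp: inj_comp_app)
  show ?thesis
    unfolding NB_simps inj_comp_def[of "\<phi> \<otimes>\<^bsub>H\<^esub> \<psi>"]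
  proof (rule restrict_ext)
    fix \<chi> assume \<chi>: "\<chi> \<in> K"
    interpret B: module k "Bq \<chi>" by (rule Bq_module'[OF \<chi>])
    let ?W = "{(\<phi>, \<psi>). \<phi> \<in> K \<and> \<psi> \<in> K \<and> \<phi> \<otimes>\<^bsub>H\<^esub> \<psi> = \<chi>}"
    let ?f = "\<lambda>w. m \<chi> (inj_comp \<phi> b (fst w)) (inj_comp \<psi> c (snd w))"
    have f: "?f w = (if w = (\<phi>, \<psi>) then m (\<phi> \<otimes>\<^bsub>H\<^esub> \<psi>) b c else \<zero>\<^bsub>Bq \<chi>\<^esub>)" if "w \<in> ?W" for w
    proof -
      from that obtain \<phi>' \<psi>' where w: "w = (\<phi>', \<psi>')" "\<phi>' \<in> K" "\<psi>' \<in> K" "\<phi>' \<otimes>\<^bsub>H\<^esub> \<psi>' = \<chi>"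
        by auto
      show ?thesis
        using summand[OF w(2,3)] unfolding w(4) by (simp add: w(1))
    qed
    show "finsum (Bq \<chi>) ?f ?W = (if \<chi> = \<phi> \<otimes>\<^bsub>H\<^esub> \<psi> then m (\<phi> \<otimes>\<^bsub>H\<^esub> \<psi>) b c else \<zero>\<^bsub>Bq \<chi>\<^esub>)"
    proof (cases "\<chi> = \<phi> \<otimes>\<^bsub>H\<^esub> \<psi>")
      case True
      have "finsum (Bq \<chi>) ?f ?W = ?f (\<phi>, \<psi>)"
      proof (rule B.finsum_single[OF fin])
        show W: "(\<phi>, \<psi>) \<in> ?W" using assms True by simp
        show "?f (\<phi>, \<psi>) \<in> carrier (Bq \<chi>)"
          using f[OF W] bilinD(3)[OF m_bilin[OF assms(1,2)] assms(3,4)] True by simp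
        show "?f w = \<zero>\<^bsub>Bq \<chi>\<^esub>" if "w \<in> ?W" "w \<noteq> (\<phi>, \<psi>)" for w
          using f[OF that(1)] that(2) by simp
      qed
      also have "?f (\<phi>, \<psi>) = m (\<phi> \<otimes>\<^bsub>H\<^esub> \<psi>) b c"
        using f[of "(\<phi>, \<psi>)"] True assms by simp
      finally show ?thesis
        using True by simp
    next
      case False
      have "finsum (Bq \<chi>) ?f ?W = (\<Oplus>\<^bsub>Bq \<chi>\<^esub>w\<in>?W. \<zero>\<^bsub>Bq \<chi>\<^esub>)"
      proof (rule B.finsum_cong'[OF refl])
        fix w assume w: "w \<in> ?W"
        then have "w \<noteq> (\<phi>, \<psi>)" using False by auto
        then show "?f w = \<zero>\<^bsub>Bq \<chi>\<^esub>" using f[OF w] by simp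
      qed simp
      then show ?thesis
        using False by simp
    qed
  qed
qed

lemma inj_comp_cls_mult:
  assumes "\<phi> \<in> K" "\<psi> \<in> K" "a \<in> Fix \<phi> P" "b \<in> Fix \<psi> P"
  shows "inj_comp \<phi> (cls \<phi> a) \<otimes>\<^bsub>NB\<^esub> inj_comp \<psi> (cls \<psi> b) = inj_comp (\<phi> \<otimes>\<^bsub>H\<^esub> \<psi>) (cls (\<phi> \<otimes>\<^bsub>H\<^esub> \<psi>) (a \<otimes>\<^bsub>A\<^esub> b))"
  using assms by (simp add: inj_comp_mult cls_closed cls_mult K_H)

lemma NB_mult_bilin: "(\<otimes>\<^bsub>NB\<^esub>) \<in> bilin k NB NB NB"
proof -
  have summand: "m \<chi> (f (fst w)) (h (snd w)) \<in> carrier (Bq \<chi>)"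
    if "f \<in> carrier NB" "h \<in> carrier NB" "w \<in> {(\<phi>, \<psi>). \<phi> \<in> K \<and> \<psi> \<in> K \<and> \<phi> \<otimes>\<^bsub>H\<^esub> \<psi> = \<chi>}" for f h \<chi> w
  proof -
    from that(3) obtain \<phi> \<psi> where w: "w = (\<phi>, \<psi>)" "\<phi> \<in> K" "\<psi> \<in> K" "\<chi> = \<phi> \<otimes>\<^bsub>H\<^esub> \<psi>"
      by auto
    show ?thesis
      unfolding w(4) using w bilinD(3)[OF m_bilin[OF w(2,3)]] NB_app[OF that(1) w(2)] NB_app[OF that(2) w(3)] by simp
  qed
  note lin = lin_hom_add[OF bilinD(1)[OF m_bilin]] lin_hom_add[OF bilinD(2)[OF m_bilin]]
    lin_hom_smult[OF bilinD(1)[OF m_bilin]] lin_hom_smult[OF bilinD(2)[OF m_bilin]]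
  have fin: "finite {(\<phi>, \<psi>). \<phi> \<in> K \<and> \<psi> \<in> K \<and> \<phi> \<otimes>\<^bsub>H\<^esub> \<psi> = \<chi>}" for \<chi>
    by (rule finite_subset[of _ "K \<times> K"]) (use finite_K in auto)
  have mn: "abelian_monoid (Bq \<chi>)" if "\<chi> \<in> K" for \<chi>
    using module.axioms(2)[OF Bq_module'[OF that]] by (simp add: abelian_group_def)
  show ?thesis
  proof (rule bilinI)
    show "f \<otimes>\<^bsub>NB\<^esub> h \<in> carrier NB" if "f \<in> carrier NB" "h \<in> carrier NB" for f h
      using summand[OF that] mn unfolding NB_simps(4) NB_carrier
      by (intro restrict_PiE_iff[THEN iffD2] ballI abelian_monoid.finsum_closed) auto
    show "(f \<oplus>\<^bsub>NB\<^esub> f') \<otimes>\<^bsub>NB\<^esub> h = f \<otimes>\<^bsub>NB\<^esub> h \<oplus>\<^bsub>NB\<^esub> f' \<otimes>\<^bsub>NB\<^esub> h"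
      if f: "f \<in> carrier NB" "f' \<in> carrier NB" "h \<in> carrier NB" for f f' h
      unfolding NB_simps
    proof (rule restrict_ext, goal_cases)
      case (1 \<chi>)
      interpret B: module k "Bq \<chi>" by (rule Bq_module'[OF 1])
      have "(\<Oplus>\<^bsub>Bq \<chi>\<^esub>w\<in>{(\<phi>, \<psi>). \<phi> \<in> K \<and> \<psi> \<in> K \<and> \<phi> \<otimes>\<^bsub>H\<^esub> \<psi> = \<chi>}. m \<chi> ((\<lambda>\<phi>\<in>K. f \<phi> \<oplus>\<^bsub>Bq \<phi>\<^esub> f' \<phi>) (fst w)) (h (snd w))) =
        (\<Oplus>\<^bsub>Bq \<chi>\<^esub>w\<in>{(\<phi>, \<psi>). \<phi> \<in> K \<and> \<psi> \<in> K \<and> \<phi> \<otimes>\<^bsub>H\<^esub> \<psi> = \<chi>}. m \<chi> (f (fst w)) (h (snd w)) \<oplus>\<^bsub>Bq \<chi>\<^esub> m \<chi> (f' (fst w)) (h (snd w)))"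
        using f summand by (intro B.finsum_cong') (auto simp: lin NB_app)
      then show ?case
        using 1 summand f by (simp add: B.finsum_addf)
    qed
    show "h \<otimes>\<^bsub>NB\<^esub> (f \<oplus>\<^bsub>NB\<^esub> f') = h \<otimes>\<^bsub>NB\<^esub> f \<oplus>\<^bsub>NB\<^esub> h \<otimes>\<^bsub>NB\<^esub> f'"
      if f: "h \<in> carrier NB" "f \<in> carrier NB" "f' \<in> carrier NB" for f f' h
      unfolding NB_simps
    proof (rule restrict_ext, goal_cases)
      case (1 \<chi>)
      interpret B: module k "Bq \<chi>" by (rule Bq_module'[OF 1])
      have "(\<Oplus>\<^bsub>Bq \<chi>\<^esub>w\<in>{(\<phi>, \<psi>). \<phi> \<in> K \<and> \<psi> \<in> K \<and> \<phi> \<otimes>\<^bsub>H\<^esub> \<psi> = \<chi>}. m \<chi> (h (fst w)) ((\<lambda>\<phi>\<in>K. f \<phi> \<oplus>\<^bsub>Bq \<phi>\<^esub> f' \<phi>) (snd w))) =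
        (\<Oplus>\<^bsub>Bq \<chi>\<^esub>w\<in>{(\<phi>, \<psi>). \<phi> \<in> K \<and> \<psi> \<in> K \<and> \<phi> \<otimes>\<^bsub>H\<^esub> \<psi> = \<chi>}. m \<chi> (h (fst w)) (f (snd w)) \<oplus>\<^bsub>Bq \<chi>\<^esub> m \<chi> (h (fst w)) (f' (snd w)))"
        using f summand by (intro B.finsum_cong') (auto simp: lin NB_app)
      then show ?case
        using 1 summand f by (simp add: B.finsum_addf)
    qed
    show "(r \<odot>\<^bsub>NB\<^esub> f) \<otimes>\<^bsub>NB\<^esub> h = r \<odot>\<^bsub>NB\<^esub> (f \<otimes>\<^bsub>NB\<^esub> h)" 
      if f: "r \<in> carrier k" "f \<in> carrier NB" "h \<in> carrier NB" for r f h
      unfolding NB_simps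
    proof (rule restrict_ext, goal_cases)
      case (1 \<chi>)
      interpret B: module k "Bq \<chi>" by (rule Bq_module'[OF 1])
      have "(\<Oplus>\<^bsub>Bq \<chi>\<^esub>w\<in>{(\<phi>, \<psi>). \<phi> \<in> K \<and> \<psi> \<in> K \<and> \<phi> \<otimes>\<^bsub>H\<^esub> \<psi> = \<chi>}. m \<chi> ((\<lambda>\<phi>\<in>K. r \<odot>\<^bsub>Bq \<phi>\<^esub> f \<phi>) (fst w)) (h (snd w))) =
        (\<Oplus>\<^bsub>Bq \<chi>\<^esub>w\<in>{(\<phi>, \<psi>). \<phi> \<in> K \<and> \<psi> \<in> K \<and> \<phi> \<otimes>\<^bsub>H\<^esub> \<psi> = \<chi>}. r \<odot>\<^bsub>Bq \<chi>\<^esub> m \<chi> (f (fst w)) (h (snd w)))"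
        using f summand by (intro B.finsum_cong') (auto simp: lin NB_app)
      then show ?case
        using 1 summand f by (simp add: B.finsum_smult_ldistr fin)
    qed
    show "f \<otimes>\<^bsub>NB\<^esub> (r \<odot>\<^bsub>NB\<^esub> h) = r \<odot>\<^bsub>NB\<^esub> (f \<otimes>\<^bsub>NB\<^esub> h)" 
      if f: "r \<in> carrier k" "f \<in> carrier NB" "h \<in> carrier NB" for r f h
      unfolding NB_simps
    proof (rule restrict_ext, goal_cases)
      case (1 \<chi>)
      interpret B: module k "Bq \<chi>" by (rule Bq_module'[OF 1])
      have "(\<Oplus>\<^bsub>Bq \<chi>\<^esub>w\<in>{(\<phi>, \<psi>). \<phi> \<in> K \<and> \<psi> \<in> K \<and> \<phi> \<otimes>\<^bsub>H\<^esub> \<psi> = \<chi>}. m \<chi> (f (fst w)) ((\<lambda>\<phi>\<in>K. r \<odot>\<^bsub>Bq \<phi>\<^esub> h \<phi>) (snd w))) =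
        (\<Oplus>\<^bsub>Bq \<chi>\<^esub>w\<in>{(\<phi>, \<psi>). \<phi> \<in> K \<and> \<psi> \<in> K \<and> \<phi> \<otimes>\<^bsub>H\<^esub> \<psi> = \<chi>}. r \<odot>\<^bsub>Bq \<chi>\<^esub> m \<chi> (f (fst w)) (h (snd w)))"
        using f summand by (intro B.finsum_cong') (auto simp: lin NB_app)
      then show ?case
        using 1 summand f by (simp add: B.finsum_smult_ldistr fin)
    qed
  qed
qed

text \<open>Homogeneous elements generate additively. On them the product is the class of a product
  in \<open>A\<close>, placed in the product degree, so associativity comes from \<open>A\<close>
  together with the automorphism group.\<close>

lemma assoc_algebra_NB: "assoc_algebra k NB"
proof -
  interpret NB: module k NB by (rule NB_module)
  note bl = bilinD[OF NB_mult_bilin]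
  let ?S = "\<Union>\<phi>\<in>K. (\<lambda>a. inj_comp \<phi> (cls \<phi> a)) ` Fix \<phi> P"
  have "ring NB"
  proof (rule ringI_generators[where S = ?S])
    show "\<one>\<^bsub>NB\<^esub> \<in> carrier NB"
      unfolding NB_one using one_Fix K.one_closed by (intro inj_comp_closed cls_closed) auto
    show "?S \<subseteq> carrier NB"
      by (auto intro!: inj_comp_closed cls_closed)
    show "carrier NB \<subseteq> S" if S: "S \<subseteq> carrier NB" "?S \<subseteq> S" "\<zero>\<^bsub>NB\<^esub> \<in> S"
      "\<And>x y. x \<in> S \<Longrightarrow> y \<in> S \<Longrightarrow> x \<oplus>\<^bsub>NB\<^esub> y \<in> S" for S
    proof
      fix f assume f: "f \<in> carrier NB"
      have mem: "inj_comp \<phi> (f \<phi>) \<in> S" if "\<phi> \<in> K" for \<phi>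
      proof -
        obtain a where "a \<in> Fix \<phi> P" "f \<phi> = cls \<phi> a"
          using NB_app[OF f \<open>\<phi> \<in> K\<close>] by (auto simp: Bq_carrier)
        then show ?thesis
          using S(2) that by (auto simp: subset_iff)
      qed
      \<comment> \<open>Partial sums over finite subsets of \<open>K\<close> remain in the
        additively closed set; the sum over \<open>K\<close> itself is \<open>f\<close>.\<close>
      have "L \<subseteq> K \<Longrightarrow> (\<Oplus>\<^bsub>NB\<^esub>\<phi>\<in>L. inj_comp \<phi> (f \<phi>)) \<in> S" if "finite L" for L
        using that
      proof (induction L rule: finite_induct)
        case (insert \<phi> L)
        then have "(\<Oplus>\<^bsub>NB\<^esub>\<phi>\<in>insert \<phi> L. inj_comp \<phi> (f \<phi>)) = inj_comp \<phi> (f \<phi>) \<oplus>\<^bsub>NB\<^esub> (\<Oplus>\<^bsub>NB\<^esub>\<phi>\<in>L. inj_comp \<phi> (f \<phi>))"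
          using mem S(1) by (intro NB.finsum_insert) auto
        then show ?case using insert S(4) mem by auto
      qed (use S(3) in auto)
      then have "(\<Oplus>\<^bsub>NB\<^esub>\<phi>\<in>K. inj_comp \<phi> (f \<phi>)) \<in> S"
        using finite_K by blast
      then show "f \<in> S" using NB_sum[OF f] by simp
    qed
    show "x \<otimes>\<^bsub>NB\<^esub> y \<otimes>\<^bsub>NB\<^esub> z = x \<otimes>\<^bsub>NB\<^esub> (y \<otimes>\<^bsub>NB\<^esub> z)" if xyz: "x \<in> ?S" "y \<in> ?S" "z \<in> ?S" for x y z
    proof -
      have car: "a \<in> carrier A" if "a \<in> Fix \<theta> P" for a \<theta> using that Fix_carrier by blast
      obtain \<phi> a \<psi> b \<theta> c where *: "\<phi> \<in> K" "a \<in> Fix \<phi> P" "\<psi> \<in> K" "b \<in> Fix \<psi> P" "\<theta> \<in> K" "c \<in> Fix \<theta> P"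
        "x = inj_comp \<phi> (cls \<phi> a)" "y = inj_comp \<psi> (cls \<psi> b)" "z = inj_comp \<theta> (cls \<theta> c)"
        using xyz by blast
      then show ?thesis
        using car[OF *(2)] car[OF *(4)] car[OF *(6)]
        by (simp add: inj_comp_cls_mult K.m_closed Fix_mult' K_H H.m_assoc A.m_assoc)
    qed
    show "\<one>\<^bsub>NB\<^esub> \<otimes>\<^bsub>NB\<^esub> x = x" "x \<otimes>\<^bsub>NB\<^esub> \<one>\<^bsub>NB\<^esub> = x" if x: "x \<in> ?S" for x
    proof -
      obtain \<phi> a where *: "\<phi> \<in> K" "a \<in> Fix \<phi> P" "x = inj_comp \<phi> (cls \<phi> a)"
        using x by blast
      then have "a \<in> carrier A" using Fix_carrier by blast
      then show "\<one>\<^bsub>NB\<^esub> \<otimes>\<^bsub>NB\<^esub> x = x" "x \<otimes>\<^bsub>NB\<^esub> \<one>\<^bsub>NB\<^esub> = x"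
        using * by (simp_all add: NB_one inj_comp_cls_mult K.one_closed one_Fix K_H)
    qed
  qed (auto intro: NB.abelian_group_axioms bl(3) simp: lin_hom_add[OF bl(1)] lin_hom_add[OF bl(2)])
  then show ?thesis
    unfolding assoc_algebra_def assoc_algebra_axioms_def
    using NB_module lin_hom_smult[OF bl(1)] lin_hom_smult[OF bl(2)] by blast
qed

section \<open>The interior structure over the normalizer\<close>

abbreviation NGK where "NGK \<equiv> normalizer_in G P K"

text \<open>The last claim is the identity \<open>u x = x (inv x u x)\<close>: the image of
  \<open>x\<close> commutes with \<open>P\<close> up to conjugation by \<open>x\<close>, which
  determines its degree.\<close>

lemma NGK_D:
  assumes "x \<in> carrier NGK"
  shows "x \<in> carrier G" "conj_aut G P x \<in> K" "g x \<in> Fix (conj_aut G P x) P"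
proof -
  show x: "x \<in> carrier G" and K: "conj_aut G P x \<in> K"
    using assms by (auto simp: normalizer_in_def normalizer_def stabilizer_def)
  have "g u \<otimes>\<^bsub>A\<^esub> g x = g x \<otimes>\<^bsub>A\<^esub> g (conj_aut G P x u)" if "u \<in> P" for u
    using x that by (simp add: conj_aut_def P_simps g_closed g_mult A.m_assoc g_inv_cancel)
  then show "g x \<in> Fix (conj_aut G P x) P"
    using x by (simp add: twisted_fixed_def g_closed)
qed

lemma gimage_NB:
  assumes "x \<in> carrier NGK"
  shows "gimage k NB x = inj_comp (conj_aut G P x) (cls (conj_aut G P x) (g x))"
proof -
  let ?s = "\<lambda>x. \<lambda>\<phi>\<in>K. if \<phi> = conj_aut G P x then cls \<phi> (g x) else \<zero>\<^bsub>Bq \<phi>\<^esub>"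
  have s: "?s x = inj_comp (conj_aut G P x) (cls (conj_aut G P x) (g x))" for x
    by (auto simp: inj_comp_def cong: if_cong)
  have "?s x \<in> carrier NB"
    unfolding s using NGK_D[OF assms] by (intro inj_comp_closed cls_closed)
  then have "lin_ext k NB ?s (single k x) = ?s x"
    by (intro lin_ext_single[OF NB_module])
  \<comment> \<open>The structural map is a linear extension over the ungraded record, whereas its
    value was computed over the graded one.\<close>
  moreover have "lin_ext k (brauer_algebra R J G P K A) ?s (single k x) = lin_ext k NB ?s (single k x)"
    by (simp add: N_bar_def Let_def lin_ext_make_graded_interior)
  ultimately show ?thesis
    by (simp add: gimage_def s N_bar_def Let_def)
qed

end

section \<open>Permuted decompositions\<close>

context brauer begin

text \<open>Fixed points form a module over \<open>R\<close> but the target is one over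
  \<open>R Quot J\<close>, so the hypotheses spell out linearity along the projection of rings. The
  purpose is to turn coordinates of fixed elements into maps on classes.\<close>

lemma Bq_lift:
  assumes "\<phi> \<in> carrier H" "module k M"
    and closed: "\<And>a. a \<in> Fix \<phi> P \<Longrightarrow> f a \<in> carrier M"
    and add: "\<And>a b. a \<in> Fix \<phi> P \<Longrightarrow> b \<in> Fix \<phi> P \<Longrightarrow> f (a \<oplus>\<^bsub>A\<^esub> b) = f a \<oplus>\<^bsub>M\<^esub> f b"
    and smult: "\<And>r a. r \<in> carrier R \<Longrightarrow> a \<in> Fix \<phi> P \<Longrightarrow> f (r \<odot>\<^bsub>A\<^esub> a) = (J +>\<^bsub>R\<^esub> r) \<odot>\<^bsub>M\<^esub> f a"
    and ker: "\<And>a. a \<in> ker \<phi> \<Longrightarrow> f a = \<zero>\<^bsub>M\<^esub>"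
  obtains h where "h \<in> lin_hom k (Bq \<phi>) M" "\<And>a. a \<in> Fix \<phi> P \<Longrightarrow> h (cls \<phi> a) = f a"
proof -
  interpret M: module k M by fact
  define h where "h C = f (SOME a. a \<in> C)" for C
  have h: "h (cls \<phi> a) = f a" if a: "a \<in> Fix \<phi> P" for a
  proof -
    define b where "b = (SOME b. b \<in> cls \<phi> a)"
    have "b \<in> cls \<phi> a"
      unfolding b_def by (rule someI[of "\<lambda>b. b \<in> cls \<phi> a" a]) (use cls_mem_iff[OF assms(1) a] a in blast)
    then have b: "b \<in> Fix \<phi> P" "cls \<phi> b = cls \<phi> a"
      using cls_mem_iff[OF assms(1) a] by auto
    obtain d where d: "d \<in> ker \<phi>" "b = a \<oplus>\<^bsub>A\<^esub> d"
      using cls_eqE[OF assms(1) b(1) a b(2)] .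
    then have "f b = f a"
      using add[OF a ker_carrier[OF assms(1) d(1)]] ker closed[OF a] by simp
    then show ?thesis
      by (simp add: h_def b_def)
  qed
  have "h \<in> lin_hom k (Bq \<phi>) M"
    using submodule_add[OF Fix_submodule[OF assms(1) order_refl]]
      submodule.smult_closed[OF Fix_submodule[OF assms(1) order_refl]]
    by (intro lin_homI) (auto simp: Bq_carrier k_carrier h closed add smult cls_add cls_smult assms(1))
  then show thesis
    using h that by blast
qed

text \<open>On an orbit with stabiliser \<open>Q\<close> the terms are the translates of one
  \<open>Q\<close>-fixed term along the cosets of \<open>Q\<close>, so they sum to a trace, which
  lies in the kernel when \<open>Q\<close> is proper. Only the fixed indices survive in the class.
  The set \<open>S\<close> is left free between the nonzero fixed terms and all fixed indices, so
  that each application can use its own support; the lemma is applied to expansions in A' and in A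
  \<otimes> A'.\<close>

lemma cls_orbit_sum:
  fixes ya :: "'g \<Rightarrow> 'y \<Rightarrow> 'y"
  assumes \<phi>: "\<phi> \<in> carrier H" and x: "x \<in> Fix \<phi> P"
    and ya: "\<And>u y. u \<in> P \<Longrightarrow> y \<in> Y \<Longrightarrow> ya u y \<in> Y"
      "\<And>y. y \<in> Y \<Longrightarrow> ya \<one>\<^bsub>G\<^esub> y = y"
      "\<And>u v y. u \<in> P \<Longrightarrow> v \<in> P \<Longrightarrow> y \<in> Y \<Longrightarrow> ya (u \<otimes>\<^bsub>G\<^esub> v) y = ya v (ya u y)"
    and \<pi>: "\<And>y. y \<in> Y \<Longrightarrow> \<pi> y \<in> carrier A"
      "\<And>u y. u \<in> P \<Longrightarrow> y \<in> Y \<Longrightarrow> \<pi> (ya u y) = act \<phi> u (\<pi> y)"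
    and fin: "finite {y \<in> Y. \<pi> y \<noteq> \<zero>\<^bsub>A\<^esub>}"
    and sum: "x = (\<Oplus>\<^bsub>A\<^esub>y\<in>{y \<in> Y. \<pi> y \<noteq> \<zero>\<^bsub>A\<^esub>}. \<pi> y)"
    and S: "finite S" "{y \<in> Y. (\<forall>u\<in>P. ya u y = y) \<and> \<pi> y \<noteq> \<zero>\<^bsub>A\<^esub>} \<subseteq> S" "S \<subseteq> {y \<in> Y. \<forall>u\<in>P. ya u y = y}"
  shows "(\<Oplus>\<^bsub>A\<^esub>y\<in>S. \<pi> y) \<in> Fix \<phi> P" "cls \<phi> x = cls \<phi> (\<Oplus>\<^bsub>A\<^esub>y\<in>S. \<pi> y)"
proof -
  define Yf where "Yf = {y \<in> Y. \<forall>u\<in>P. ya u y = y}"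
  have Fix_sub: "submodule (Fix \<phi> P) R A"
    by (rule Fix_submodule[OF \<phi> order_refl])
  \<comment> \<open>Induction on the size of a finite stable set of indices that are not fixed; each
    step splits off one orbit.\<close>
  have orbit: "(\<Oplus>\<^bsub>A\<^esub>y\<in>Z. \<pi> y) \<in> ker \<phi>"
    if "finite Z" "Z \<subseteq> Y - Yf" "\<And>u y. u \<in> P \<Longrightarrow> y \<in> Z \<Longrightarrow> ya u y \<in> Z" for Z
    using that
  proof (induction "card Z" arbitrary: Z rule: less_induct)
    case less
    show ?case
    proof (cases "Z = {}")
      case True
      then show ?thesis
        using submodule_zero[OF ker_submodule[OF \<phi>]] by simp
    next
      case False
      then obtain y0 where y0: "y0 \<in> Z" by blast
      then have y0Y: "y0 \<in> Y" "y0 \<notin> Yf" using less.prems(2) by auto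
      define Orb where "Orb = (\<lambda>u. ya u y0) ` P"
      \<comment> \<open>The stabiliser of \<open>y0\<close>, a proper subgroup because
        \<open>y0\<close> is not a fixed index.\<close>
      define Q where "Q = {u \<in> P. ya u y0 = y0}"
      have OrbZ: "Orb \<subseteq> Z" using less.prems(3) y0 by (auto simp: Orb_def)
      have y0O: "y0 \<in> Orb" using imageI[OF P.one_closed, of "\<lambda>u. ya u y0"] ya(2)[OF y0Y(1)] unfolding Orb_def by simp
      have inv1: "ya (inv\<^bsub>G\<^esub> u) (ya u y) = y" "ya u (ya (inv\<^bsub>G\<^esub> u) y) = y" if "u \<in> P" "y \<in> Y" for u y
        using ya(3)[OF that(1) P.m_inv_closed[OF that(1)] that(2)] ya(3)[OF P.m_inv_closed[OF that(1)] that(1,2)]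
          ya(2)[OF that(2)] P_simps(1)[OF that(1)] by simp_all
      have stab: "ya u y \<in> Z - Orb" if "u \<in> P" "y \<in> Z - Orb" for u y
      proof -
        have yY: "y \<in> Y" using that less.prems(2) by blast
        have "ya u y \<notin> Orb"
        proof
          assume "ya u y \<in> Orb"
          then obtain v where v: "v \<in> P" "ya u y = ya v y0" by (auto simp: Orb_def)
          then have "y = ya (v \<otimes>\<^bsub>G\<^esub> inv\<^bsub>G\<^esub> u) y0"
            using inv1(1)[OF that(1) yY] ya(3)[OF v(1) P.m_inv_closed[OF that(1)] y0Y(1)] by simp
          then have "y \<in> Orb" using v(1) that(1) by (auto simp: Orb_def)
          then show False using that(2) by blast
        qed
        then show ?thesis using that less.prems(3) by blast
      qed
      have "card (Z - Orb) < card Z"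
        using y0 y0O less.prems(1) by (intro psubset_card_mono) auto
      then have rest: "(\<Oplus>\<^bsub>A\<^esub>y\<in>Z - Orb. \<pi> y) \<in> ker \<phi>"
        using less.prems(1,2) stab by (intro less.hyps) auto
      have Q: "subgroup Q PG"
      proof (rule PG.subgroupI)
        show "Q \<subseteq> carrier PG" by (auto simp: Q_def)
        show "Q \<noteq> {}"
          unfolding Q_def using P.one_closed ya(2)[OF y0Y(1)] by blast
        show "inv\<^bsub>PG\<^esub> u \<in> Q" if "u \<in> Q" for u
          using that inv1(1)[of u y0] y0Y(1) by (auto simp: Q_def G.m_inv_consistent[OF P.subgroup_axioms])
        show "u \<otimes>\<^bsub>PG\<^esub> v \<in> Q" if "u \<in> Q" "v \<in> Q" for u v
          using that ya(3) y0Y(1) by (auto simp: Q_def)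
      qed
      have QP: "Q \<noteq> P" using y0Y by (auto simp: Q_def Yf_def)
      have fixQ: "\<pi> y0 \<in> Fix \<phi> Q"
      proof -
        have "Q \<subseteq> P" by (auto simp: Q_def)
        then show ?thesis
          using \<pi>(1)[OF y0Y(1)] \<pi>(2)[OF _ y0Y(1)] unfolding Fix_iff[OF \<phi> \<open>Q \<subseteq> P\<close>]
          by (auto simp: Q_def) metis
      qed
      let ?s = "\<lambda>C. SOME u. u \<in> C"
      \<comment> \<open>The orbit-stabiliser bijection, written with the same coset representatives
        as the trace.\<close>
      let ?f = "\<lambda>C. ya (?s C) y0"
      have u: "?s C \<in> P" "?s C \<in> C" if "C \<in> rcosets\<^bsub>PG\<^esub> Q" for C
        using cosetD(1,5)[OF Q that] by blast+
      have coset_f: "ya v y0 = ya w y0" if "C \<in> rcosets\<^bsub>PG\<^esub> Q" "v \<in> C" "w \<in> C" for C v w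
      proof -
        from cosetD(3)[OF Q that] obtain q where q: "q \<in> Q" "w = q \<otimes>\<^bsub>G\<^esub> v" by blast
        have "v \<in> P" using cosetD(1)[OF Q that(1)] that(2) by blast
        then show ?thesis using q ya(3)[of q v y0] y0Y(1) by (simp add: Q_def)
      qed
      have inj: "inj_on ?f (rcosets\<^bsub>PG\<^esub> Q)"
      proof (rule inj_onI)
        fix C D assume CD: "C \<in> rcosets\<^bsub>PG\<^esub> Q" "D \<in> rcosets\<^bsub>PG\<^esub> Q" "?f C = ?f D"
        let ?u = "?s C" and ?v = "?s D"
        have "ya (?u \<otimes>\<^bsub>G\<^esub> inv\<^bsub>G\<^esub> ?v) y0 = y0"
          using ya(3)[OF u(1)[OF CD(1)] P.m_inv_closed[OF u(1)[OF CD(2)]] y0Y(1)] CD(3)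
            inv1(1)[OF u(1)[OF CD(2)] y0Y(1)] by simp
        then have "?u \<otimes>\<^bsub>G\<^esub> inv\<^bsub>G\<^esub> ?v \<in> Q"
          using u(1)[OF CD(1)] u(1)[OF CD(2)] by (simp add: Q_def)
        then have "(?u \<otimes>\<^bsub>G\<^esub> inv\<^bsub>G\<^esub> ?v) \<otimes>\<^bsub>G\<^esub> ?v \<in> Q #>\<^bsub>PG\<^esub> ?v"
          by (auto simp: r_coset_def)
        then have "?u \<in> Q #>\<^bsub>PG\<^esub> ?v"
          using u(1)[OF CD(1)] u(1)[OF CD(2)] by (simp add: G.m_assoc P_simps)
        then have "?u \<in> D" using cosetD(4)[OF Q CD(2) u(2)[OF CD(2)]] by simp
        then show "C = D"
          using cosetD(4)[OF Q CD(2), of ?u] cosetD(4)[OF Q CD(1) u(2)[OF CD(1)]] by simp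
      qed
      have image: "?f ` (rcosets\<^bsub>PG\<^esub> Q) = Orb"
      proof
        show "?f ` (rcosets\<^bsub>PG\<^esub> Q) \<subseteq> Orb" using u by (auto simp: Orb_def)
        show "Orb \<subseteq> ?f ` (rcosets\<^bsub>PG\<^esub> Q)"
        proof
          fix y assume "y \<in> Orb"
          then obtain v where v: "v \<in> P" "y = ya v y0" by (auto simp: Orb_def)
          let ?C = "Q #>\<^bsub>PG\<^esub> v"
          have C: "?C \<in> rcosets\<^bsub>PG\<^esub> Q" using v(1) by (auto simp: RCOSETS_def)
          have "v \<in> ?C" using PG.rcos_self[OF _ Q, of v] v(1) by simp
          then have "?f ?C = y" using coset_f[OF C u(2)[OF C]] v(2) by simp
          then show "y \<in> ?f ` (rcosets\<^bsub>PG\<^esub> Q)" using C by blast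
        qed
      qed
      have piY: "\<pi> \<in> Z \<rightarrow> carrier A" using less.prems(2) \<pi>(1) by auto
      have "tr \<phi> Q (\<pi> y0) = (\<Oplus>\<^bsub>A\<^esub>C\<in>rcosets\<^bsub>PG\<^esub> Q. \<pi> (?f C))"
        unfolding tr_eq using u \<pi> y0Y(1) \<phi> by (intro A.finsum_cong') (simp_all add: Pi_iff act_closed)
      also have "\<dots> = (\<Oplus>\<^bsub>A\<^esub>y\<in>?f ` (rcosets\<^bsub>PG\<^esub> Q). \<pi> y)"
        unfolding image by (rule A.finsum_reindex[OF _ inj, unfolded image, symmetric]) (use OrbZ piY in auto)
      finally have "(\<Oplus>\<^bsub>A\<^esub>y\<in>Orb. \<pi> y) \<in> ker \<phi>"
        unfolding image using tr_ker[OF Q QP fixQ] by simp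
      moreover have "(\<Oplus>\<^bsub>A\<^esub>y\<in>Z. \<pi> y) = (\<Oplus>\<^bsub>A\<^esub>y\<in>Orb. \<pi> y) \<oplus>\<^bsub>A\<^esub> (\<Oplus>\<^bsub>A\<^esub>y\<in>Z - Orb. \<pi> y)"
      proof -
        have "Z = Orb \<union> (Z - Orb)" using OrbZ by blast
        then show ?thesis
          using A.finsum_Un_disjoint[of Orb "Z - Orb" \<pi>] less.prems(1) OrbZ piY
          by (auto simp: Pi_iff intro: finite_subset)
      qed
      ultimately show ?thesis
        using rest ker_add[OF \<phi>] by simp
    qed
  qed
  have fix_pi: "\<pi> y \<in> Fix \<phi> P" if "y \<in> Yf" for y
    using that \<pi> unfolding Fix_iff[OF \<phi> order_refl] Yf_def by auto metis
  define T where "T = {y \<in> Y. \<pi> y \<noteq> \<zero>\<^bsub>A\<^esub>}"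
  have T: "finite T" "T \<subseteq> Y" using fin by (auto simp: T_def)
  have piT: "\<pi> \<in> Y \<rightarrow> carrier A" using \<pi>(1) by auto
  \<comment> \<open>The nonzero terms at non-fixed indices form a stable set: the action is
    invertible, so a translate of a nonzero term is nonzero.\<close>
  have "ya u y \<in> T - Yf" if "u \<in> P" "y \<in> T - Yf" for u y
  proof -
    have y: "y \<in> Y" "y \<notin> Yf" "\<pi> y \<noteq> \<zero>\<^bsub>A\<^esub>" using that by (auto simp: T_def)
    have inv: "ya (inv\<^bsub>G\<^esub> u) (ya u y) = y"
      using that ya(2)[OF y(1)] ya(3)[of u "inv\<^bsub>G\<^esub> u" y] y(1) by (simp add: P_simps)
    have "\<pi> (ya u y) \<noteq> \<zero>\<^bsub>A\<^esub>"
    proof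
      assume "\<pi> (ya u y) = \<zero>\<^bsub>A\<^esub>"
      then have "\<pi> y = act \<phi> (inv\<^bsub>G\<^esub> u) \<zero>\<^bsub>A\<^esub>"
        using inv \<pi>(2)[OF P.m_inv_closed[OF that(1)] ya(1)[OF that(1) y(1)]] by simp
      also have "\<dots> = \<zero>\<^bsub>A\<^esub>"
        by (rule lin_hom_zero[OF A.module_axioms A.module_axioms act_lin[OF \<phi> P.m_inv_closed[OF that(1)]]])
      finally show False using y(3) by simp
    qed
    moreover have "ya u y \<notin> Yf"
    proof
      assume Yf: "ya u y \<in> Yf"
      then have "ya (inv\<^bsub>G\<^esub> u) (ya u y) = ya u y"
        using P.m_inv_closed[OF that(1)] by (simp add: Yf_def)
      then show False
        using inv y(2) Yf by simp
    qed
    ultimately show ?thesis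
      using ya(1)[OF that(1) y(1)] by (simp add: T_def)
  qed
  then have ker: "(\<Oplus>\<^bsub>A\<^esub>y\<in>T - Yf. \<pi> y) \<in> ker \<phi>"
    using T by (intro orbit) auto
  have eq: "(\<Oplus>\<^bsub>A\<^esub>y\<in>T \<inter> Yf. \<pi> y) = (\<Oplus>\<^bsub>A\<^esub>y\<in>S. \<pi> y)"
    using S \<pi>(1) by (intro A.finsum_superset) (auto simp: T_def Yf_def)
  have "x = (\<Oplus>\<^bsub>A\<^esub>y\<in>(T \<inter> Yf) \<union> (T - Yf). \<pi> y)"
    using sum by (simp add: T_def Int_Diff_Un)
  also have "\<dots> = (\<Oplus>\<^bsub>A\<^esub>y\<in>S. \<pi> y) \<oplus>\<^bsub>A\<^esub> (\<Oplus>\<^bsub>A\<^esub>y\<in>T - Yf. \<pi> y)"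
    unfolding eq[symmetric] using T piT by (intro A.finsum_Un_disjoint) auto
  finally have x_eq: "x = (\<Oplus>\<^bsub>A\<^esub>y\<in>S. \<pi> y) \<oplus>\<^bsub>A\<^esub> (\<Oplus>\<^bsub>A\<^esub>y\<in>T - Yf. \<pi> y)" .
  show F: "(\<Oplus>\<^bsub>A\<^esub>y\<in>S. \<pi> y) \<in> Fix \<phi> P"
    using S(3) fix_pi by (intro submodule_finsum[OF A.module_axioms Fix_sub]) (auto simp: Yf_def)
  show "cls \<phi> x = cls \<phi> (\<Oplus>\<^bsub>A\<^esub>y\<in>S. \<pi> y)"
    using cls_add_ker[OF \<phi> F ker] x_eq by simp
qed

end

text \<open>The coefficients come from inverting the bijection in \<open>module_basis\<close>; the
  inverse is linear because the bijection is. They are exported as one scalar-valued map for each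
  index, the form in which equivariance can be stated.\<close>

lemma module_basis_coordinates:
  fixes R :: "('r, 'm) ring_scheme" and M :: "('r, 'b, 'c) module_scheme"
  assumes "module R M" "module_basis R M Y"
  obtains \<beta> where
    "\<And>y b. b \<in> carrier M \<Longrightarrow> \<beta> y b \<in> carrier R"
    "\<And>y b c. b \<in> carrier M \<Longrightarrow> c \<in> carrier M \<Longrightarrow> \<beta> y (b \<oplus>\<^bsub>M\<^esub> c) = \<beta> y b \<oplus>\<^bsub>R\<^esub> \<beta> y c"
    "\<And>r y b. r \<in> carrier R \<Longrightarrow> b \<in> carrier M \<Longrightarrow> \<beta> y (r \<odot>\<^bsub>M\<^esub> b) = r \<otimes>\<^bsub>R\<^esub> \<beta> y b"
    "\<And>b. b \<in> carrier M \<Longrightarrow> finite {y \<in> Y. \<beta> y b \<noteq> \<zero>\<^bsub>R\<^esub>}"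
    "\<And>b. b \<in> carrier M \<Longrightarrow> b = (\<Oplus>\<^bsub>M\<^esub>y\<in>{y \<in> Y. \<beta> y b \<noteq> \<zero>\<^bsub>R\<^esub>}. \<beta> y b \<odot>\<^bsub>M\<^esub> y)"
    "\<And>y z. z \<in> Y \<Longrightarrow> \<beta> y z = (if y = z then \<one>\<^bsub>R\<^esub> else \<zero>\<^bsub>R\<^esub>)"
proof -
  interpret module R M by fact
  \<comment> \<open>Only the module structure of the monoid algebra is used, so the multiplication on \<open>Y\<close> is irrelevant.\<close>
  let ?MY = "\<lparr>carrier = Y, monoid.mult = undefined, one = undefined\<rparr> :: 'b monoid"
  let ?U = "monoid_algebra R ?MY"
  interpret U: module R ?U by (rule module_monoid_algebra)
  define L where "L = lin_ext R M (\<lambda>b. b)"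
  have Y: "Y \<subseteq> carrier M" and bij: "bij_betw L (finsupp R Y) (carrier M)"
    using assms(2) by (simp_all add: module_basis_def L_def)
  have L: "L \<in> lin_hom R ?U M"
    unfolding L_def using Y by (intro lin_ext_lin_hom assms(1)) auto
  define c where "c = the_inv_into (finsupp R Y) L"
  have inj: "inj_on L (finsupp R Y)" and surj: "L ` finsupp R Y = carrier M"
    using bij by (auto simp: bij_betw_def)
  have c: "c b \<in> finsupp R Y" "L (c b) = b" if "b \<in> carrier M" for b
    using that the_inv_into_into[OF inj, of b "finsupp R Y"] f_the_inv_into_f[OF inj, of b] surj
    by (simp_all add: c_def)
  have cL: "c (L f) = f" if "f \<in> finsupp R Y" for f
    unfolding c_def by (rule the_inv_into_f_f[OF inj that])
  have cD: "c b y \<in> carrier R" "finite {y \<in> Y. c b y \<noteq> \<zero>\<^bsub>R\<^esub>}" "{y. c b y \<noteq> \<zero>\<^bsub>R\<^esub>} = {y \<in> Y. c b y \<noteq> \<zero>\<^bsub>R\<^esub>}"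
    if "b \<in> carrier M" for b y
    using finsuppD[OF c(1)[OF that]] by (auto intro: finite_subset)
  show thesis
  proof (rule that[of "\<lambda>y b. c b y"])
    show "c b y \<in> carrier R" if "b \<in> carrier M" for y b
      by (rule cD[OF that])
    show "finite {y \<in> Y. c b y \<noteq> \<zero>\<^bsub>R\<^esub>}" if "b \<in> carrier M" for b
      by (rule cD[OF that])
    show "b = (\<Oplus>\<^bsub>M\<^esub>y\<in>{y \<in> Y. c b y \<noteq> \<zero>\<^bsub>R\<^esub>}. c b y \<odot>\<^bsub>M\<^esub> y)" if "b \<in> carrier M" for b
      using c(2)[OF that] unfolding L_def lin_ext_def cD(3)[OF that] by simp
    show "c (b \<oplus>\<^bsub>M\<^esub> d) y = c b y \<oplus>\<^bsub>R\<^esub> c d y" if "b \<in> carrier M" "d \<in> carrier M" for y b d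
    proof -
      have "L (c b \<oplus>\<^bsub>?U\<^esub> c d) = b \<oplus>\<^bsub>M\<^esub> d"
        using that c by (subst lin_hom_add[OF L]) auto
      then show ?thesis
        using cL[of "c b \<oplus>\<^bsub>?U\<^esub> c d"] U.a_closed[of "c b" "c d"] c(1) that by simp
    qed
    show "c (r \<odot>\<^bsub>M\<^esub> b) y = r \<otimes>\<^bsub>R\<^esub> c b y" if "r \<in> carrier R" "b \<in> carrier M" for r y b
    proof -
      have "L (r \<odot>\<^bsub>?U\<^esub> c b) = r \<odot>\<^bsub>M\<^esub> b"
        using that c by (subst lin_hom_smult[OF L]) auto
      then show ?thesis
        using cL[of "r \<odot>\<^bsub>?U\<^esub> c b"] U.smult_closed[of r "c b"] c(1) that by simp
    qed
    show "c z y = (if y = z then \<one>\<^bsub>R\<^esub> else \<zero>\<^bsub>R\<^esub>)" if "z \<in> Y" for y z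
    proof -
      have "L (single R z) = z"
        unfolding L_def using that Y by (intro lin_ext_single assms(1)) auto
      then have "c z = single R z"
        using cL[OF single_finsupp[OF that]] by simp
      then show ?thesis by (simp add: single_def)
    qed
  qed
qed

section \<open>Isomorphisms of graded interior algebras\<close>

lemma graded_interior_isoD:
  assumes "F \<in> graded_interior_iso k N K C D"
  shows "F \<in> alg_hom k C D" "F \<in> ring_hom C D" "bij_betw F (carrier C) (carrier D)"
    "\<And>\<phi>. \<phi> \<in> K \<Longrightarrow> F ` homcomp C \<phi> = homcomp D \<phi>"
    "\<And>f. f \<in> carrier (monoid_algebra k N) \<Longrightarrow> F (structural C f) = structural D f"
    "F \<in> lin_hom k C D"
  using assms unfolding graded_interior_iso_def alg_hom_def lin_hom_def ring_hom_def by auto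

lemma graded_interior_iso_comp:
  assumes "F \<in> graded_interior_iso k N K C D" "G \<in> graded_interior_iso k N K D E"
  shows "(\<lambda>x. G (F x)) \<in> graded_interior_iso k N K C E"
proof -
  note F = graded_interior_isoD[OF assms(1)] and G = graded_interior_isoD[OF assms(2)]
  have "(\<lambda>x. G (F x)) \<in> ring_hom C E"
    using F(2) G(2) unfolding ring_hom_def by (auto simp: Pi_iff)
  moreover have "bij_betw (\<lambda>x. G (F x)) (carrier C) (carrier E)"
    using bij_betw_trans[OF F(3) G(3)] by (simp add: comp_def)
  moreover have "(\<lambda>x. G (F x)) ` homcomp C \<phi> = homcomp E \<phi>" if "\<phi> \<in> K" for \<phi>
    using F(4)[OF that] G(4)[OF that] by (metis image_image)
  ultimately show ?thesis
    using lin_hom_smult[OF lin_hom_comp[OF F(6) G(6)]] F(5) G(5)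
    unfolding graded_interior_iso_def alg_hom_def by simp
qed

text \<open>The isomorphisms are constructed out of the diagonal subalgebra, while the first claim
  asks for one into it. Membership in \<open>graded_interior_iso\<close> says nothing about closure
  of the source under its operations, so this appears as separate premises.\<close>

lemma graded_interior_iso_inv:
  assumes F: "F \<in> graded_interior_iso k N K C D"
    and mult: "\<And>x y. x \<in> carrier C \<Longrightarrow> y \<in> carrier C \<Longrightarrow> x \<otimes>\<^bsub>C\<^esub> y \<in> carrier C"
    and "\<one>\<^bsub>C\<^esub> \<in> carrier C" "module k C"
    and homcomp: "\<And>\<phi>. \<phi> \<in> K \<Longrightarrow> homcomp C \<phi> \<subseteq> carrier C"
    and struct: "\<And>f. f \<in> carrier (monoid_algebra k N) \<Longrightarrow> structural C f \<in> carrier C"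
  shows "inv_into (carrier C) F \<in> graded_interior_iso k N K D C"
proof -
  interpret C: module k C by fact
  note F = graded_interior_isoD[OF F]
  define G where "G = inv_into (carrier C) F"
  have GF: "G (F x) = x" if "x \<in> carrier C" for x
    unfolding G_def using that F(3) by (intro inv_into_f_f) (auto simp: bij_betw_def)
  have surj: "carrier D = F ` carrier C"
    using F(3) by (auto simp: bij_betw_def)
  have ring: "G \<in> ring_hom D C"
    using GF mult C.a_closed assms(3)
    by (intro ring_hom_memI)
      (auto simp: surj simp flip: F(6)[THEN lin_hom_add] ring_hom_mult[OF F(2)] ring_hom_one[OF F(2)])
  have "G (r \<odot>\<^bsub>D\<^esub> x) = r \<odot>\<^bsub>C\<^esub> G x" if "r \<in> carrier k" "x \<in> carrier D" for r x
    using that GF C.smult_closed by (auto simp: surj simp flip: F(6)[THEN lin_hom_smult])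
  moreover have "bij_betw G (carrier D) (carrier C)"
    unfolding G_def by (rule bij_betw_inv_into[OF F(3)])
  moreover have "G ` homcomp D \<phi> = homcomp C \<phi>" if "\<phi> \<in> K" for \<phi>
    using GF homcomp[OF that] by (force simp flip: F(4)[OF that] simp: image_image)
  moreover have "G (structural D f) = structural C f" if "f \<in> carrier (monoid_algebra k N)" for f
    using GF[OF struct[OF that]] F(5)[OF that] by simp
  ultimately show ?thesis
    using ring unfolding graded_interior_iso_def alg_hom_def G_def by simp
qed

text \<open>The diagonal construction needs products, units and group images to be homogeneous of
  one common degree in both factors. The common degree is given by an existence statement, which
  frees the locale from a group structure on the degrees.\<close>

locale graded_pair = C: assoc_algebra k C + D: assoc_algebra k D
  for k :: "('k, 'm) ring_scheme" and N :: "('g, 'n) monoid_scheme" and K :: "'d set"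
    and C :: "('k, 'a, 'g, 'd, 'c) graded_interior_scheme"
    and D :: "('k, 'b, 'g, 'd, 'e) graded_interior_scheme" +
  assumes homcomp_subset: "\<phi> \<in> K \<Longrightarrow> homcomp C \<phi> \<subseteq> carrier C" "\<phi> \<in> K \<Longrightarrow> homcomp D \<phi> \<subseteq> carrier D"
    and graded_mult: "\<phi> \<in> K \<Longrightarrow> \<psi> \<in> K \<Longrightarrow> \<exists>\<chi>\<in>K.
      (\<forall>c\<in>homcomp C \<phi>. \<forall>c'\<in>homcomp C \<psi>. c \<otimes>\<^bsub>C\<^esub> c' \<in> homcomp C \<chi>) \<and>
      (\<forall>d\<in>homcomp D \<phi>. \<forall>d'\<in>homcomp D \<psi>. d \<otimes>\<^bsub>D\<^esub> d' \<in> homcomp D \<chi>)"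
    and graded_one: "\<exists>\<chi>\<in>K. \<one>\<^bsub>C\<^esub> \<in> homcomp C \<chi> \<and> \<one>\<^bsub>D\<^esub> \<in> homcomp D \<chi>"
    and graded_gimage: "x \<in> carrier N \<Longrightarrow>
      \<exists>\<chi>\<in>K. gimage k C x \<in> homcomp C \<chi> \<and> gimage k D x \<in> homcomp D \<chi>"
begin

abbreviation T where "T \<equiv> tensor k C D"
abbreviation tau where "tau \<equiv> pure_tensor k C D"
abbreviation Diag where "Diag \<equiv> diagonal_subalgebra k K C D"

definition gens where "gens = {tau c d | c d. \<exists>\<phi>\<in>K. c \<in> homcomp C \<phi> \<and> d \<in> homcomp D \<phi>}"

definition comp where
  "comp \<phi> = submodule_span k T {tau c d | c d. c \<in> homcomp C \<phi> \<and> d \<in> homcomp D \<phi>}"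

lemmas alg = C.assoc_algebra_axioms D.assoc_algebra_axioms

sublocale T: assoc_algebra k T
  by (rule assoc_algebra_tensor[OF alg])

lemmas tau_bilin = pure_tensor_bilin[OF alg]
lemmas tau_closed = bilinD(3)[OF tau_bilin]
lemmas tau_mult = pure_tensor_mult[OF alg]

lemma comp_gens_subset: "\<phi> \<in> K \<Longrightarrow> {tau c d | c d. c \<in> homcomp C \<phi> \<and> d \<in> homcomp D \<phi>} \<subseteq> gens"
  by (auto simp: gens_def)

lemma gens_subset: "gens \<subseteq> carrier T"
  using homcomp_subset by (auto simp: gens_def intro!: tau_closed)

lemma span_gens: "submodule (submodule_span k T gens) k T"
  by (rule submodule_span_submodule[OF T.module_axioms gens_subset])

lemma comp_submodule: "\<phi> \<in> K \<Longrightarrow> submodule (comp \<phi>) k T"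
  unfolding comp_def using comp_gens_subset gens_subset
  by (intro submodule_span_submodule T.module_axioms) blast

lemma comp_mem: "c \<in> homcomp C \<phi> \<Longrightarrow> d \<in> homcomp D \<phi> \<Longrightarrow> tau c d \<in> comp \<phi>"
  unfolding comp_def by (rule subsetD[OF submodule_span_superset]) blast

lemma comp_subset_span: "\<phi> \<in> K \<Longrightarrow> comp \<phi> \<subseteq> submodule_span k T gens"
  unfolding comp_def using comp_gens_subset[of \<phi>] submodule_span_superset[of gens k T]
  by (intro submodule_span_minimal[OF span_gens]) blast

text \<open>Replacing the union of the components by pure tensors of equal degree as generators
  reduces later checks to these tensors.\<close>

lemma Diag_carrier: "submodule_span k T (\<Union>\<phi>\<in>K. comp \<phi>) = submodule_span k T gens"
proof
  show "submodule_span k T (\<Union>\<phi>\<in>K. comp \<phi>) \<subseteq> submodule_span k T gens"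
    using comp_subset_span by (intro submodule_span_minimal[OF span_gens]) blast
  have "(\<Union>\<phi>\<in>K. comp \<phi>) \<subseteq> carrier T"
    using comp_subset_span submodule_subset[OF span_gens] by blast
  note sub = submodule_span_submodule[OF T.module_axioms this]
  have "gens \<subseteq> (\<Union>\<phi>\<in>K. comp \<phi>)"
    using comp_mem by (auto simp: gens_def)
  then show "submodule_span k T gens \<subseteq> submodule_span k T (\<Union>\<phi>\<in>K. comp \<phi>)"
    by (intro submodule_span_minimal[OF sub] order_trans[OF _ submodule_span_superset])
qed

abbreviation S where "S \<equiv> submodule_span k T gens"
abbreviation TS where "TS \<equiv> T\<lparr>carrier := S\<rparr>"

lemma Diag_eq: "Diag = make_graded_interior k TS (\<lambda>x. tau (gimage k C x) (gimage k D x)) comp"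
  unfolding diagonal_subalgebra_def Let_def comp_def[symmetric] Diag_carrier ..

lemma Diag_simps:
  "carrier Diag = S" "x \<otimes>\<^bsub>Diag\<^esub> y = x \<otimes>\<^bsub>T\<^esub> y" "\<one>\<^bsub>Diag\<^esub> = \<one>\<^bsub>T\<^esub>"
  "x \<oplus>\<^bsub>Diag\<^esub> y = x \<oplus>\<^bsub>T\<^esub> y" "\<zero>\<^bsub>Diag\<^esub> = \<zero>\<^bsub>T\<^esub>" "r \<odot>\<^bsub>Diag\<^esub> x = r \<odot>\<^bsub>T\<^esub> x"
  "structural Diag = lin_ext k TS (\<lambda>x. tau (gimage k C x) (gimage k D x))" "homcomp Diag = comp"
  by (simp_all add: Diag_eq)

lemma S_carrier: "S \<subseteq> carrier T"
  by (rule submodule_subset[OF span_gens])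

lemma S_gens: "x \<in> gens \<Longrightarrow> x \<in> S"
  by (rule subsetD[OF submodule_span_superset])

text \<open>Pure tensors multiply factorwise, and \<open>graded_mult\<close> places both resulting
  factors in the same degree.\<close>

lemma gens_mult: "x \<in> gens \<Longrightarrow> y \<in> gens \<Longrightarrow> x \<otimes>\<^bsub>T\<^esub> y \<in> gens"
proof -
  assume "x \<in> gens" "y \<in> gens"
  then obtain c d \<phi> c' d' \<psi> where *: "x = tau c d" "\<phi> \<in> K" "c \<in> homcomp C \<phi>" "d \<in> homcomp D \<phi>"
    "y = tau c' d'" "\<psi> \<in> K" "c' \<in> homcomp C \<psi>" "d' \<in> homcomp D \<psi>"
    unfolding gens_def by blast
  then have "c \<in> carrier C" "c' \<in> carrier C" "d \<in> carrier D" "d' \<in> carrier D"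
    using homcomp_subset by blast+
  then have eq: "x \<otimes>\<^bsub>T\<^esub> y = tau (c \<otimes>\<^bsub>C\<^esub> c') (d \<otimes>\<^bsub>D\<^esub> d')"
    using *(1,5) by (simp add: tau_mult)
  obtain \<chi> where "\<chi> \<in> K" "c \<otimes>\<^bsub>C\<^esub> c' \<in> homcomp C \<chi>" "d \<otimes>\<^bsub>D\<^esub> d' \<in> homcomp D \<chi>"
    using graded_mult[OF *(2,6)] * by blast
  then show "x \<otimes>\<^bsub>T\<^esub> y \<in> gens"
    unfolding gens_def eq by blast
qed

lemma S_mult:
  assumes "x \<in> S" "y \<in> S"
  shows "x \<otimes>\<^bsub>T\<^esub> y \<in> S"
proof -
  have lin: "(\<lambda>x. x \<otimes>\<^bsub>T\<^esub> y) \<in> lin_hom k T T" "(\<lambda>x. y \<otimes>\<^bsub>T\<^esub> x) \<in> lin_hom k T T" if "y \<in> carrier T" for y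
    by (rule lin_homI; simp add: that T.l_distr T.r_distr T.smult_mult_left T.smult_mult_right)+
  have 1: "x \<otimes>\<^bsub>T\<^esub> y \<in> S" if "x \<in> gens" "y \<in> S" for x y
    by (rule lin_hom_span_image[OF T.module_axioms T.module_axioms lin(2) gens_subset span_gens _ that(2)])
      (use that(1) gens_subset gens_mult S_gens in auto)
  show ?thesis
    by (rule lin_hom_span_image[OF T.module_axioms T.module_axioms lin(1) gens_subset span_gens _ assms(1)])
      (use assms(2) 1 S_carrier in auto)
qed

lemma one_gens: "\<one>\<^bsub>T\<^esub> \<in> gens"
  using graded_one unfolding gens_def pure_tensor_one[OF alg, symmetric] by blast

lemma gimage_gens: "x \<in> carrier N \<Longrightarrow> tau (gimage k C x) (gimage k D x) \<in> gens"
  using graded_gimage unfolding gens_def by blast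

lemma TS_module: "module k TS"
  by (rule submodule.submodule_is_module[OF span_gens T.module_axioms])

lemma Diag_module: "module k Diag"
  by (rule module_surj_image[where \<rho> = "\<lambda>r. r" and q = "\<lambda>x. x", OF TS_module C.R.is_cring])
    (auto simp: Diag_simps ring_hom_def)

lemma Diag_structural: "f \<in> finsupp k (carrier N) \<Longrightarrow> structural Diag f \<in> S"
  using lin_hom_closed[OF lin_ext_lin_hom[OF TS_module, of _ N]] gimage_gens S_gens
  by (simp add: Diag_simps Pi_iff)

text \<open>The criterion behind both isomorphisms. The map \<open>h\<close> lives on the whole
  tensor product, where it need not be multiplicative, and \<open>h'\<close> takes values there.
  Their identities are required only on pure tensors of equal degree, and linearity carries them to
  the span \<open>S\<close>.\<close>

lemma diag_iso:
  assumes E: "assoc_algebra k E"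
    and h: "h \<in> lin_hom k T E" and h': "h' \<in> lin_hom k E T"
    and sub: "\<And>\<phi>. \<phi> \<in> K \<Longrightarrow> submodule (homcomp E \<phi>) k E"
    and h_homcomp: "\<And>\<phi> c d. \<phi> \<in> K \<Longrightarrow> c \<in> homcomp C \<phi> \<Longrightarrow> d \<in> homcomp D \<phi> \<Longrightarrow> h (tau c d) \<in> homcomp E \<phi>"
    and h'_homcomp: "\<And>\<phi> w. \<phi> \<in> K \<Longrightarrow> w \<in> homcomp E \<phi> \<Longrightarrow> h' w \<in> comp \<phi>"
    and h'_S: "\<And>w. w \<in> carrier E \<Longrightarrow> h' w \<in> S"
    and h'h: "\<And>\<phi> c d. \<phi> \<in> K \<Longrightarrow> c \<in> homcomp C \<phi> \<Longrightarrow> d \<in> homcomp D \<phi> \<Longrightarrow> h' (h (tau c d)) = tau c d"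
    and hh': "\<And>w. w \<in> carrier E \<Longrightarrow> h (h' w) = w"
    and mult: "\<And>x y. x \<in> gens \<Longrightarrow> y \<in> gens \<Longrightarrow> h (x \<otimes>\<^bsub>T\<^esub> y) = h x \<otimes>\<^bsub>E\<^esub> h y"
    and one: "h \<one>\<^bsub>T\<^esub> = \<one>\<^bsub>E\<^esub>"
    and struct: "structural E = lin_ext k E s"
      "\<And>x. x \<in> carrier N \<Longrightarrow> h (tau (gimage k C x) (gimage k D x)) = s x"
  shows "h \<in> graded_interior_iso k N K Diag E"
proof -
  interpret E: assoc_algebra k E by fact
  note hr = lin_hom_closed[OF h] lin_hom_add[OF h] lin_hom_smult[OF h]
  have h_S: "h x \<in> carrier E" if "x \<in> S" for x
    using that S_carrier hr(1) by blast
  have gens_h'h: "h' (h x) = x" if "x \<in> S" for x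
    by (rule lin_hom_eq_on_span[OF T.module_axioms T.module_axioms lin_hom_comp[OF h h'] _ gens_subset _ that])
      (auto simp: gens_def h'h intro!: lin_homI)
  have lin: "(\<lambda>x. h (x \<otimes>\<^bsub>T\<^esub> y)) \<in> lin_hom k T E" "(\<lambda>x. h x \<otimes>\<^bsub>E\<^esub> h y) \<in> lin_hom k T E"
    "(\<lambda>x. h (y \<otimes>\<^bsub>T\<^esub> x)) \<in> lin_hom k T E" "(\<lambda>x. h y \<otimes>\<^bsub>E\<^esub> h x) \<in> lin_hom k T E" if "y \<in> carrier T" for y
    by (rule lin_homI; simp add: that hr T.l_distr T.r_distr T.smult_mult_left T.smult_mult_right
        E.l_distr E.r_distr E.smult_mult_left E.smult_mult_right)+
  note eq = lin_hom_eq_on_span[OF T.module_axioms E.module_axioms _ _ gens_subset]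
  have 1: "h (x \<otimes>\<^bsub>T\<^esub> y) = h x \<otimes>\<^bsub>E\<^esub> h y" if "x \<in> gens" "y \<in> S" for x y
    by (rule eq[OF lin(3,4) _ that(2)]) (use that(1) gens_subset mult in auto)
  have h_mult: "h (x \<otimes>\<^bsub>T\<^esub> y) = h x \<otimes>\<^bsub>E\<^esub> h y" if "x \<in> S" "y \<in> S" for x y
    by (rule eq[OF lin(1,2) _ that(1)]) (use that(2) S_carrier 1 in auto)
  have "h \<in> ring_hom Diag E"
    using h_S h_mult one hr(2) S_carrier by (intro ring_hom_memI) (auto simp: Diag_simps subset_iff)
  moreover have "bij_betw h S (carrier E)"
    by (rule bij_betw_byWitness[where f' = h']) (use gens_h'h hh' h_S h'_S in auto)
  moreover have "h ` comp \<phi> = homcomp E \<phi>" if \<phi>: "\<phi> \<in> K" for \<phi>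
  proof
    show "h ` comp \<phi> \<subseteq> homcomp E \<phi>"
    proof
      fix w assume "w \<in> h ` comp \<phi>"
      then obtain x where x: "x \<in> comp \<phi>" "w = h x" by blast
      have "h x \<in> homcomp E \<phi>"
        by (rule lin_hom_span_image[OF T.module_axioms E.module_axioms h _ sub[OF \<phi>] _ x(1)[unfolded comp_def]])
          (use comp_gens_subset[OF \<phi>] gens_subset h_homcomp[OF \<phi>] in auto)
      then show "w \<in> homcomp E \<phi>" using x(2) by simp
    qed
    show "homcomp E \<phi> \<subseteq> h ` comp \<phi>"
    proof
      fix w assume w: "w \<in> homcomp E \<phi>"
      then have "w = h (h' w)" using submodule_subset[OF sub[OF \<phi>]] hh' by auto
      then show "w \<in> h ` comp \<phi>" using h'_homcomp[OF \<phi> w] by blast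
    qed
  qed
  moreover have "h (structural Diag f) = structural E f" if f: "f \<in> finsupp k (carrier N)" for f
  proof -
    have supp: "{x. f x \<noteq> \<zero>\<^bsub>k\<^esub>} \<subseteq> carrier N" "\<And>x. f x \<in> carrier k"
      using finsuppD[OF f] by auto
    interpret TS: module k TS by (rule TS_module)
    let ?s = "\<lambda>x. tau (gimage k C x) (gimage k D x)"
    have s: "?s x \<in> S" "?s x \<in> carrier T" if "f x \<noteq> \<zero>\<^bsub>k\<^esub>" for x
      using that supp(1) gimage_gens S_gens gens_subset by blast+
    \<comment> \<open>The structural map of the diagonal is a finite sum over group elements; the
      linear \<open>h\<close> passes through it, and \<open>struct\<close> prescribes the individual
      terms.\<close>
    have "h (structural Diag f) = (\<Oplus>\<^bsub>E\<^esub>x\<in>{x. f x \<noteq> \<zero>\<^bsub>k\<^esub>}. h (f x \<odot>\<^bsub>T\<^esub> ?s x))"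
      unfolding Diag_simps lin_ext_def
      using s supp TS.smult_closed
      by (subst lin_hom_finsum[OF TS_module E.module_axioms lin_hom_submodule_source[OF span_gens h]]) auto
    also have "\<dots> = structural E f"
      unfolding struct lin_ext_def
    proof (rule E.finsum_cong'[OF refl])
      fix x assume x: "x \<in> {x. f x \<noteq> \<zero>\<^bsub>k\<^esub>}"
      then have "s x = h (?s x)" using supp(1) struct(2) by auto
      then show "h (f x \<odot>\<^bsub>T\<^esub> ?s x) = f x \<odot>\<^bsub>E\<^esub> s x"
        using x s supp(2) hr(3) by simp
    next
      show "(\<lambda>x. f x \<odot>\<^bsub>E\<^esub> s x) \<in> {x. f x \<noteq> \<zero>\<^bsub>k\<^esub>} \<rightarrow> carrier E"
        using supp s hr(1) struct(2)[symmetric] by (auto intro!: E.smult_closed)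
    qed
    finally show ?thesis .
  qed
  ultimately show ?thesis
    using hr(3) S_carrier unfolding graded_interior_iso_def alg_hom_def by (auto simp: Diag_simps)
qed

lemma diag_iso_inv:
  assumes "h \<in> graded_interior_iso k N K Diag E"
  shows "inv_into (carrier Diag) h \<in> graded_interior_iso k N K E Diag"
  using assms Diag_module S_mult S_gens[OF one_gens] comp_subset_span Diag_structural
  by (intro graded_interior_iso_inv) (auto simp: Diag_simps)

end

section \<open>Brauer quotients of a tensor product\<close>

locale brauer_pair = B1: brauer_graded R J G P A K + B2: brauer_graded R J G P B K
  for R :: "('r, 'm) ring_scheme" and J :: "'r set" and G :: "('g, 'n) monoid_scheme"
    and P :: "'g set" and A :: "('r, 'a, 'g, 'c) interior_scheme"
    and B :: "('r, 'b, 'g, 'd) interior_scheme" and K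
begin

abbreviation TI where "TI \<equiv> tensor_interior R A B"
abbreviation t where "t \<equiv> pure_tensor R A B"

lemmas alg = B1.A.assoc_algebra_axioms B2.A.assoc_algebra_axioms

sublocale BT: brauer_graded R J G P TI K
proof -
  have i: "interior_algebra R G TI"
    by (rule interior_algebra_tensor[OF B1.interior B2.interior])
  then have "assoc_algebra R TI"
    by (simp add: interior_algebra_def)
  then show "brauer_graded R J G P TI K"
    using i B1.finite_P B1.G.group_axioms B1.P.subgroup_axioms B1.J.ideal_axioms B1.K.subgroup_axioms
    by (simp add: brauer_graded_def brauer_def brauer_axioms_def)
qed

lemma TI_simps:
  "carrier TI = carrier (tensor R A B)" "x \<otimes>\<^bsub>TI\<^esub> y = x \<otimes>\<^bsub>tensor R A B\<^esub> y"
  "x \<oplus>\<^bsub>TI\<^esub> y = x \<oplus>\<^bsub>tensor R A B\<^esub> y" "r \<odot>\<^bsub>TI\<^esub> x = r \<odot>\<^bsub>tensor R A B\<^esub> x"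
  "\<one>\<^bsub>TI\<^esub> = \<one>\<^bsub>tensor R A B\<^esub>"
  by (simp_all add: tensor_interior_def)

lemma lin_hom_TI: "lin_hom R TI M = lin_hom R (tensor R A B) M" "lin_hom R M TI = lin_hom R M (tensor R A B)"
  by (simp_all add: lin_hom_def TI_simps)

lemma t_bilin: "t \<in> bilin R A B TI"
  using pure_tensor_bilin[OF alg] by (simp add: bilin_def lin_hom_TI)

lemmas t_closed = bilinD(3)[OF t_bilin]

lemma t_mult: "a \<in> carrier A \<Longrightarrow> b \<in> carrier B \<Longrightarrow> c \<in> carrier A \<Longrightarrow> d \<in> carrier B \<Longrightarrow>
    t a b \<otimes>\<^bsub>TI\<^esub> t c d = t (a \<otimes>\<^bsub>A\<^esub> c) (b \<otimes>\<^bsub>B\<^esub> d)"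
  by (simp add: TI_simps pure_tensor_mult[OF alg])

text \<open>Pure tensors span. The restatement over \<open>TI\<close> hides the passage between the
  interior record and the bare tensor product.\<close>

lemma TI_lin_eq:
  assumes "module R M" "f \<in> lin_hom R TI M" "h \<in> lin_hom R TI M" "x \<in> carrier TI"
    and "\<And>a b. a \<in> carrier A \<Longrightarrow> b \<in> carrier B \<Longrightarrow> f (t a b) = h (t a b)"
  shows "f x = h x"
proof -
  interpret T0: assoc_algebra R "tensor R A B" by (rule assoc_algebra_tensor[OF alg])
  show ?thesis
  proof (rule lin_hom_eq_on_span[OF T0.module_axioms assms(1) assms(2,3)[unfolded lin_hom_TI]])
    show "x \<in> submodule_span R (tensor R A B) {t a b | a b. a \<in> carrier A \<and> b \<in> carrier B}"
      using assms(4) by (simp add: pure_tensor_span[OF alg] TI_simps)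
  qed (use assms(5) t_closed in \<open>auto simp: TI_simps\<close>)
qed

lemma t_act:
  assumes "\<phi> \<in> carrier B1.H" "u \<in> P" "a \<in> carrier A" "b \<in> carrier B"
  shows "BT.act \<phi> u (t a b) = t (B1.act \<phi> u a) (B2.act \<phi> u b)"
  using assms
  by (simp add: B1.P_simps twisted_act_def gimage_tensor_interior[OF B1.interior B2.interior] t_mult B1.g_closed B2.g_closed)

lemma t_Fix:
  assumes "\<phi> \<in> carrier B1.H" "Q \<subseteq> P" "a \<in> B1.Fix \<phi> Q" "b \<in> B2.Fix \<phi> Q"
  shows "t a b \<in> BT.Fix \<phi> Q"
proof -
  note a = B1.FixD[OF assms(1-3)] and b = B2.FixD[OF assms(1,2,4)]
  have "BT.act \<phi> u (t a b) = t a b" if "u \<in> Q" for u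
    using t_act[OF assms(1) _ a(1) b(1), of u] that assms(2) a(2) b(2) by auto
  then show ?thesis
    using a(1) b(1) t_closed BT.Fix_iff[OF assms(1,2)] by blast
qed

section \<open>Compatibility of traces and Brauer kernels with pure tensors\<close>

lemma Fix_mono: "Q \<subseteq> P \<Longrightarrow> a \<in> twisted_fixed R D \<phi> P \<Longrightarrow> a \<in> twisted_fixed R D \<phi> Q"
  by (auto simp: twisted_fixed_def)

text \<open>Since \<open>b\<close> is fixed by all of \<open>P\<close>, every summand in the trace
  of \<open>t c b\<close> has the same second factor \<open>b\<close>, and \<open>t\<close> is
  additive in the first.\<close>

lemma t_tr_left:
  assumes "\<phi> \<in> carrier B1.H" "subgroup Q B1.PG" "c \<in> B1.Fix \<phi> Q" "b \<in> B2.Fix \<phi> P"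
  shows "t (B1.tr \<phi> Q c) b = BT.tr \<phi> Q (t c b)"
proof -
  have c: "c \<in> carrier A" using assms(3) B1.Fix_carrier by blast
  note b = B2.FixD[OF assms(1) order_refl assms(4)]
  have u: "(SOME u. u \<in> C) \<in> P" if "C \<in> rcosets\<^bsub>B1.PG\<^esub> Q" for C
    using B1.cosetD(1,5)[OF assms(2) that] by blast
  have "t (B1.tr \<phi> Q c) b = (\<Oplus>\<^bsub>TI\<^esub>C\<in>rcosets\<^bsub>B1.PG\<^esub> Q. t (B1.act \<phi> (SOME u. u \<in> C) c) b)"
    unfolding B1.tr_eq using u c assms(1)
    by (intro lin_hom_finsum[OF B1.A.module_axioms BT.A.module_axioms bilinD(2)[OF t_bilin b(1)]])
      (auto intro: B1.act_closed)
  also have "\<dots> = BT.tr \<phi> Q (t c b)"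
    unfolding BT.tr_eq using u c assms(1) b
    by (intro BT.A.finsum_cong') (simp_all add: Pi_iff t_act t_closed B1.act_closed)
  finally show ?thesis .
qed

lemma t_tr_right:
  assumes "\<phi> \<in> carrier B1.H" "subgroup Q B1.PG" "a \<in> B1.Fix \<phi> P" "c \<in> B2.Fix \<phi> Q"
  shows "t a (B2.tr \<phi> Q c) = BT.tr \<phi> Q (t a c)"
proof -
  have c: "c \<in> carrier B" using assms(4) B2.Fix_carrier by blast
  note a = B1.FixD[OF assms(1) order_refl assms(3)]
  have u: "(SOME u. u \<in> C) \<in> P" if "C \<in> rcosets\<^bsub>B1.PG\<^esub> Q" for C
    using B1.cosetD(1,5)[OF assms(2) that] by blast
  have "t a (B2.tr \<phi> Q c) = (\<Oplus>\<^bsub>TI\<^esub>C\<in>rcosets\<^bsub>B1.PG\<^esub> Q. t a (B2.act \<phi> (SOME u. u \<in> C) c))"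
    unfolding B2.tr_eq using u c assms(1)
    by (intro lin_hom_finsum[OF B2.A.module_axioms BT.A.module_axioms bilinD(1)[OF t_bilin a(1)]])
      (auto intro: B2.act_closed)
  also have "\<dots> = BT.tr \<phi> Q (t a c)"
    unfolding BT.tr_eq using u c assms(1) a
    by (intro BT.A.finsum_cong') (simp_all add: Pi_iff t_act t_closed B2.act_closed)
  finally show ?thesis .
qed

text \<open>A trace tensored with a fixed element is again a trace, and a scalar from
  \<open>J\<close> moves out of the pure tensor. Together with the mirror statement this makes the
  pairing of classes well defined.\<close>

lemma t_ker_left:
  assumes "\<phi> \<in> carrier B1.H" "x \<in> B1.ker \<phi>" "b \<in> B2.Fix \<phi> P"
  shows "t x b \<in> BT.ker \<phi>"
proof (rule B1.ker_induct[OF assms(1) BT.FA_module[OF assms(1)] _ BT.ker_submodule[OF assms(1)] _ _ assms(2)])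
  have b: "b \<in> carrier B" using assms(3) B2.Fix_carrier by blast
  note lin = bilinD(2)[OF t_bilin b]
  show "(\<lambda>x. t x b) \<in> lin_hom R (B1.FA \<phi>) (BT.FA \<phi>)"
    using t_Fix[OF assms(1) order_refl _ assms(3)] B1.FixD(1)[OF assms(1) order_refl]
    by (intro lin_homI) (auto simp: lin_hom_add[OF lin] lin_hom_smult[OF lin])
  show "t (B1.tr \<phi> Q c) b \<in> BT.ker \<phi>" if "subgroup Q B1.PG" "Q \<noteq> P" "c \<in> B1.Fix \<phi> Q" for Q c
  proof -
    have QP: "Q \<subseteq> P" using subgroup.subset[OF that(1)] by simp
    have "t c b \<in> BT.Fix \<phi> Q"
      by (rule t_Fix[OF assms(1) QP that(3) Fix_mono[OF QP assms(3)]])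
    then show ?thesis
      using BT.tr_ker[OF that(1,2)] t_tr_left[OF assms(1) that(1,3) assms(3)] by simp
  qed
  show "t (r \<odot>\<^bsub>A\<^esub> a) b \<in> BT.ker \<phi>" if "r \<in> J" "a \<in> B1.Fix \<phi> P" for r a
    using that BT.smult_ker[OF that(1) t_Fix[OF assms(1) order_refl that(2) assms(3)]]
      lin_hom_smult[OF lin B1.J.Icarr[OF that(1)] B1.FixD(1)[OF assms(1) order_refl that(2)]] by simp
qed

lemma t_ker_right:
  assumes "\<phi> \<in> carrier B1.H" "a \<in> B1.Fix \<phi> P" "x \<in> B2.ker \<phi>"
  shows "t a x \<in> BT.ker \<phi>"
proof (rule B2.ker_induct[OF assms(1) BT.FA_module[OF assms(1)] _ BT.ker_submodule[OF assms(1)] _ _ assms(3)])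
  have a: "a \<in> carrier A" using assms(2) B1.Fix_carrier by blast
  note lin = bilinD(1)[OF t_bilin a]
  show "(\<lambda>x. t a x) \<in> lin_hom R (B2.FA \<phi>) (BT.FA \<phi>)"
    using t_Fix[OF assms(1) order_refl assms(2)] B2.FixD(1)[OF assms(1) order_refl]
    by (intro lin_homI) (auto simp: lin_hom_add[OF lin] lin_hom_smult[OF lin])
  show "t a (B2.tr \<phi> Q c) \<in> BT.ker \<phi>" if "subgroup Q B1.PG" "Q \<noteq> P" "c \<in> B2.Fix \<phi> Q" for Q c
  proof -
    have QP: "Q \<subseteq> P" using subgroup.subset[OF that(1)] by simp
    have "t a c \<in> BT.Fix \<phi> Q"
      by (rule t_Fix[OF assms(1) QP Fix_mono[OF QP assms(2)] that(3)])
    then show ?thesis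
      using BT.tr_ker[OF that(1,2)] t_tr_right[OF assms(1) that(1) assms(2) that(3)] by simp
  qed
  show "t a (r \<odot>\<^bsub>B\<^esub> b) \<in> BT.ker \<phi>" if "r \<in> J" "b \<in> B2.Fix \<phi> P" for r b
    using that BT.smult_ker[OF that(1) t_Fix[OF assms(1) order_refl assms(2) that(2)]]
      lin_hom_smult[OF lin B1.J.Icarr[OF that(1)] B2.FixD(1)[OF assms(1) order_refl that(2)]] by simp
qed

text \<open>Written as a union over representatives, like the quotient operations, so that
  \<open>UN_const\<close> evaluates it.\<close>

definition tcls where "tcls \<phi> C D = (\<Union>a\<in>C. \<Union>b\<in>D. BT.cls \<phi> (t a b))"

lemma tcls_cls:
  assumes \<phi>: "\<phi> \<in> carrier B1.H" and a: "a \<in> B1.Fix \<phi> P" and b: "b \<in> B2.Fix \<phi> P"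
  shows "tcls \<phi> (B1.cls \<phi> a) (B2.cls \<phi> b) = BT.cls \<phi> (t a b)"
  unfolding tcls_def
proof (rule UN_const[where x = a], use assms B1.cls_mem_iff in blast, rule UN_const[where x = b])
  show "b \<in> B2.cls \<phi> b" using assms B2.cls_mem_iff by blast
  fix a' b' assume a'm: "a' \<in> B1.cls \<phi> a" and b'm: "b' \<in> B2.cls \<phi> b"
  have a': "a' \<in> B1.Fix \<phi> P" "B1.cls \<phi> a' = B1.cls \<phi> a"
    using a'm B1.cls_mem_iff[OF \<phi> a] by auto
  have b': "b' \<in> B2.Fix \<phi> P" "B2.cls \<phi> b' = B2.cls \<phi> b"
    using b'm B2.cls_mem_iff[OF \<phi> b] by auto
  obtain d where d: "d \<in> B1.ker \<phi>" "a' = a \<oplus>\<^bsub>A\<^esub> d"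
    using B1.cls_eqE[OF \<phi> a'(1) a a'(2)] .
  obtain d' where d': "d' \<in> B2.ker \<phi>" "b' = b \<oplus>\<^bsub>B\<^esub> d'"
    using B2.cls_eqE[OF \<phi> b'(1) b b'(2)] .
  have car: "a \<in> carrier A" "b \<in> carrier B" "d \<in> carrier A" "d' \<in> carrier B" "b' \<in> carrier B"
    using a b b'(1) B1.ker_carrier[OF \<phi> d(1)] B2.ker_carrier[OF \<phi> d'(1)] B1.Fix_carrier B2.Fix_carrier by blast+
  \<comment> \<open>With \<open>a' = a + d\<close> and \<open>b' = b + d'\<close>, bilinearity
    leaves two error terms, each with one factor in a Brauer kernel.\<close>
  have "t a' b' = t a b \<oplus>\<^bsub>TI\<^esub> (t a d' \<oplus>\<^bsub>TI\<^esub> t d b')"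
    unfolding d(2) using car
    by (simp add: lin_hom_add[OF bilinD(2)[OF t_bilin car(5)]])
      (simp add: d'(2) lin_hom_add[OF bilinD(1)[OF t_bilin car(1)]] t_closed BT.A.a_assoc)
  moreover have "t a d' \<oplus>\<^bsub>TI\<^esub> t d b' \<in> BT.ker \<phi>"
    using t_ker_right[OF \<phi> a d'(1)] t_ker_left[OF \<phi> d(1) b'(1)] BT.ker_add[OF \<phi>] by blast
  ultimately show "BT.cls \<phi> (t a' b') = BT.cls \<phi> (t a b)"
    using BT.cls_add_ker[OF \<phi> t_Fix[OF \<phi> order_refl a b]] by simp
qed

lemma tcls_bilin:
  assumes \<phi>: "\<phi> \<in> carrier B1.H"
  shows "tcls \<phi> \<in> bilin B1.k (B1.Bq \<phi>) (B2.Bq \<phi>) (BT.Bq \<phi>)"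
proof -
  have car: "a \<in> B1.Fix \<phi> P \<Longrightarrow> a \<in> carrier A" "b \<in> B2.Fix \<phi> P \<Longrightarrow> b \<in> carrier B" for a b
    using B1.Fix_carrier B2.Fix_carrier by blast+
  note add1 = submodule_add[OF B1.Fix_submodule[OF \<phi> order_refl]]
  note sm1 = submodule.smult_closed[OF B1.Fix_submodule[OF \<phi> order_refl]]
  note add2 = submodule_add[OF B2.Fix_submodule[OF \<phi> order_refl]]
  note sm2 = submodule.smult_closed[OF B2.Fix_submodule[OF \<phi> order_refl]]
  note tF = t_Fix[OF \<phi> order_refl]
  note tr = lin_hom_add[OF bilinD(1)[OF t_bilin]] lin_hom_add[OF bilinD(2)[OF t_bilin]]
    lin_hom_smult[OF bilinD(1)[OF t_bilin]] lin_hom_smult[OF bilinD(2)[OF t_bilin]]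
  show ?thesis
    by (rule bilinI; clarsimp simp: B1.Bq_carrier B2.Bq_carrier BT.Bq_carrier B1.k_carrier)
      (simp_all add: tcls_cls \<phi> B1.cls_add B2.cls_add BT.cls_add B1.cls_smult B2.cls_smult BT.cls_smult
        add1 add2 sm1 sm2 tF tr car)
qed

text \<open>Stated for an arbitrary interior algebra \<open>D\<close> because it is needed for
  \<open>A\<close> and for \<open>B\<close>, whose carriers have different types.\<close>

lemma N_bar_graded:
  assumes "brauer_graded R J G P D K"
  shows "homcomp (N_bar R J G P K D) \<phi> \<subseteq> carrier (N_bar R J G P K D)"
    and "\<phi> \<in> K \<Longrightarrow> \<psi> \<in> K \<Longrightarrow> c \<in> homcomp (N_bar R J G P K D) \<phi> \<Longrightarrow> c' \<in> homcomp (N_bar R J G P K D) \<psi> \<Longrightarrow>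
      c \<otimes>\<^bsub>N_bar R J G P K D\<^esub> c' \<in> homcomp (N_bar R J G P K D) (\<phi> \<otimes>\<^bsub>aut_group G P\<^esub> \<psi>)"
    and "\<one>\<^bsub>N_bar R J G P K D\<^esub> \<in> homcomp (N_bar R J G P K D) \<one>\<^bsub>aut_group G P\<^esub>"
    and "x \<in> carrier (normalizer_in G P K) \<Longrightarrow>
      gimage (R Quot J) (N_bar R J G P K D) x \<in> homcomp (N_bar R J G P K D) (conj_aut G P x)"
proof -
  interpret D: brauer_graded R J G P D K by fact
  show "homcomp D.NB \<phi> \<subseteq> carrier D.NB"
    by (auto simp: D.NB_homcomp)
  show "c \<otimes>\<^bsub>D.NB\<^esub> c' \<in> homcomp D.NB (\<phi> \<otimes>\<^bsub>D.H\<^esub> \<psi>)"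
    if "\<phi> \<in> K" "\<psi> \<in> K" "c \<in> homcomp D.NB \<phi>" "c' \<in> homcomp D.NB \<psi>"
    using that bilinD(3)[OF D.m_bilin[OF that(1,2)]] by (auto simp: D.homcomp_eq D.inj_comp_mult)
  show "\<one>\<^bsub>D.NB\<^esub> \<in> homcomp D.NB \<one>\<^bsub>D.H\<^esub>"
    by (simp add: D.homcomp_eq D.NB_one D.cls_closed D.one_Fix)
  show "x \<in> carrier D.NGK \<Longrightarrow> gimage D.k D.NB x \<in> homcomp D.NB (conj_aut G P x)"
    using D.NGK_D by (simp add: D.homcomp_eq D.gimage_NB D.cls_closed)
qed

lemmas gp1 = N_bar_graded[OF B1.brauer_graded_axioms]
lemmas gp2 = N_bar_graded[OF B2.brauer_graded_axioms]

sublocale GP: graded_pair B1.k B1.NGK K B1.NB B2.NB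
proof (intro graded_pair.intro B1.assoc_algebra_NB B2.assoc_algebra_NB graded_pair_axioms.intro)
  show "homcomp B1.NB \<phi> \<subseteq> carrier B1.NB" "homcomp B2.NB \<phi> \<subseteq> carrier B2.NB" for \<phi>
    by (rule gp1 gp2)+
  show "\<exists>\<chi>\<in>K. (\<forall>c\<in>homcomp B1.NB \<phi>. \<forall>c'\<in>homcomp B1.NB \<psi>. c \<otimes>\<^bsub>B1.NB\<^esub> c' \<in> homcomp B1.NB \<chi>) \<and>
      (\<forall>d\<in>homcomp B2.NB \<phi>. \<forall>d'\<in>homcomp B2.NB \<psi>. d \<otimes>\<^bsub>B2.NB\<^esub> d' \<in> homcomp B2.NB \<chi>)"
    if "\<phi> \<in> K" "\<psi> \<in> K" for \<phi> \<psi>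
    using gp1(2)[OF that] gp2(2)[OF that] B1.K.m_closed[OF that] by blast
  show "\<exists>\<chi>\<in>K. \<one>\<^bsub>B1.NB\<^esub> \<in> homcomp B1.NB \<chi> \<and> \<one>\<^bsub>B2.NB\<^esub> \<in> homcomp B2.NB \<chi>"
    using gp1(3) gp2(3) B1.K.one_closed by blast
  show "\<exists>\<chi>\<in>K. gimage B1.k B1.NB x \<in> homcomp B1.NB \<chi> \<and> gimage B1.k B2.NB x \<in> homcomp B2.NB \<chi>"
    if "x \<in> carrier B1.NGK" for x
    using gp1(4)[OF that] gp2(4)[OF that] B1.NGK_D(2)[OF that] by blast
qed

text \<open>Pairing degree by degree is defined on all pairs and sends elements of different degrees
  to zero. It therefore induces a map on the full tensor product, to be restricted to the
  diagonal.\<close>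

lemma Psi_bilin: "(\<lambda>c d. \<lambda>\<phi>\<in>K. tcls \<phi> (c \<phi>) (d \<phi>)) \<in> bilin B1.k B1.NB B2.NB BT.NB"
proof -
  have tb: "tcls \<phi> \<in> bilin B1.k (B1.Bq \<phi>) (B2.Bq \<phi>) (BT.Bq \<phi>)" if "\<phi> \<in> K" for \<phi>
    by (rule tcls_bilin[OF B1.K_H[OF that]])
  note tr = lin_hom_add[OF bilinD(1)[OF tb]] lin_hom_add[OF bilinD(2)[OF tb]]
    lin_hom_smult[OF bilinD(1)[OF tb]] lin_hom_smult[OF bilinD(2)[OF tb]]
  show ?thesis
  proof (rule bilinI)
    show "(\<lambda>\<phi>\<in>K. tcls \<phi> (c \<phi>) (d \<phi>)) \<in> carrier BT.NB" if "c \<in> carrier B1.NB" "d \<in> carrier B2.NB" for c d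
      using that by (auto simp: BT.NB_carrier intro!: bilinD(3)[OF tb] B1.NB_app B2.NB_app)
  qed (unfold B1.NB_simps B2.NB_simps BT.NB_simps,
      (rule restrict_ext, simp add: tr B1.NB_app B2.NB_app)+)
qed

lemma Psi_exists:
  obtains Psi where "Psi \<in> lin_hom B1.k GP.T BT.NB"
    "\<And>\<phi> C D. \<phi> \<in> K \<Longrightarrow> C \<in> carrier (B1.Bq \<phi>) \<Longrightarrow> D \<in> carrier (B2.Bq \<phi>) \<Longrightarrow>
      Psi (GP.tau (B1.inj_comp \<phi> C) (B2.inj_comp \<phi> D)) = BT.inj_comp \<phi> (tcls \<phi> C D)"
proof (rule tensor_lift[OF B1.assoc_algebra_NB B2.assoc_algebra_NB BT.NB_module Psi_bilin])
  fix h assume h: "h \<in> lin_hom B1.k GP.T BT.NB"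
    "\<And>c d. c \<in> carrier B1.NB \<Longrightarrow> d \<in> carrier B2.NB \<Longrightarrow> h (GP.tau c d) = (\<lambda>\<phi>\<in>K. tcls \<phi> (c \<phi>) (d \<phi>))"
  have "h (GP.tau (B1.inj_comp \<phi> C) (B2.inj_comp \<phi> D)) = BT.inj_comp \<phi> (tcls \<phi> C D)"
    if \<phi>: "\<phi> \<in> K" and C: "C \<in> carrier (B1.Bq \<phi>)" and D: "D \<in> carrier (B2.Bq \<phi>)" for \<phi> C D
  proof -
    have z: "tcls \<psi> \<zero>\<^bsub>B1.Bq \<psi>\<^esub> \<zero>\<^bsub>B2.Bq \<psi>\<^esub> = \<zero>\<^bsub>BT.Bq \<psi>\<^esub>" if "\<psi> \<in> K" for \<psi>
      by (rule lin_hom_zero[OF B2.Bq_module'[OF that] BT.Bq_module'[OF that]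
            bilinD(1)[OF tcls_bilin[OF B1.K_H[OF that]] B1.Bq_zero_closed[OF that]]])
    have "h (GP.tau (B1.inj_comp \<phi> C) (B2.inj_comp \<phi> D)) =
        (\<lambda>\<psi>\<in>K. tcls \<psi> (B1.inj_comp \<phi> C \<psi>) (B2.inj_comp \<phi> D \<psi>))"
      using \<phi> C D by (intro h(2) B1.inj_comp_closed B2.inj_comp_closed)
    also have "\<dots> = BT.inj_comp \<phi> (tcls \<phi> C D)"
      unfolding BT.inj_comp_def by (rule restrict_ext) (auto simp: B1.inj_comp_app B2.inj_comp_app z)
    finally show ?thesis .
  qed
  with h(1) show thesis
    using that by blast
qed

text \<open>At representatives both sides are the class of the product of \<open>a\<close> and
  \<open>a'\<close> tensored with the product of \<open>b\<close> and \<open>b'\<close>.\<close>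

lemma tcls_mult:
  assumes "\<phi> \<in> K" "\<psi> \<in> K" "C \<in> carrier (B1.Bq \<phi>)" "D \<in> carrier (B2.Bq \<phi>)"
    and "C' \<in> carrier (B1.Bq \<psi>)" "D' \<in> carrier (B2.Bq \<psi>)"
  shows "BT.inj_comp \<phi> (tcls \<phi> C D) \<otimes>\<^bsub>BT.NB\<^esub> BT.inj_comp \<psi> (tcls \<psi> C' D') =
    BT.inj_comp (\<phi> \<otimes>\<^bsub>B1.H\<^esub> \<psi>) (tcls (\<phi> \<otimes>\<^bsub>B1.H\<^esub> \<psi>) (B1.m (\<phi> \<otimes>\<^bsub>B1.H\<^esub> \<psi>) C C') (B2.m (\<phi> \<otimes>\<^bsub>B1.H\<^esub> \<psi>) D D'))"
proof -
  note H = B1.K_H[OF assms(1)] B1.K_H[OF assms(2)]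
  have \<chi>: "\<phi> \<otimes>\<^bsub>B1.H\<^esub> \<psi> \<in> carrier B1.H" using H by blast
  obtain a b a' b' where *: "a \<in> B1.Fix \<phi> P" "C = B1.cls \<phi> a" "b \<in> B2.Fix \<phi> P" "D = B2.cls \<phi> b"
    "a' \<in> B1.Fix \<psi> P" "C' = B1.cls \<psi> a'" "b' \<in> B2.Fix \<psi> P" "D' = B2.cls \<psi> b'"
    using assms(3-) by (auto simp: B1.Bq_carrier B2.Bq_carrier)
  have car: "a \<in> carrier A" "b \<in> carrier B" "a' \<in> carrier A" "b' \<in> carrier B"
    using * B1.Fix_carrier B2.Fix_carrier by blast+
  show ?thesis
    using * car H assms(1,2) B1.Fix_mult'[OF H *(1,5)] B2.Fix_mult'[OF H *(3,7)]
    by (simp add: tcls_cls \<chi> BT.inj_comp_cls_mult t_Fix B1.cls_mult B2.cls_mult t_mult)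
qed

end

lemma (in brauer) cls_finsum:
  assumes "\<phi> \<in> carrier H" "f \<in> S \<rightarrow> Fix \<phi> P"
  shows "cls \<phi> (finsum A f S) = finsum (Bq \<phi>) (\<lambda>i. cls \<phi> (f i)) S"
proof -
  have "cls \<phi> (finsum (FA \<phi>) f S) = finsum (Bq \<phi>) (\<lambda>i. cls \<phi> (f i)) S"
    using assms module.axioms(2)[OF FA_module[OF assms(1)]] module.axioms(2)[OF Bq_module[OF assms(1)]]
    by (intro additive_finsum) (auto simp: cls_add cls_closed)
  then show ?thesis
    using finsum_submodule[OF A.module_axioms Fix_submodule[OF assms(1) order_refl] assms(2)] by simp
qed

lemma (in brauer_graded) NB_structural:
  "structural NB = lin_ext k NB (\<lambda>x. inj_comp (conj_aut G P x) (cls (conj_aut G P x) (g x)))"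
proof -
  have "inj_comp (conj_aut G P x) (cls (conj_aut G P x) (g x)) =
      (\<lambda>\<phi>\<in>K. if \<phi> = conj_aut G P x then cls \<phi> (g x) else \<zero>\<^bsub>Bq \<phi>\<^esub>)" for x
    by (auto simp: inj_comp_def cong: if_cong)
  then show ?thesis
    by (simp add: N_bar_def Let_def lin_ext_make_graded_interior)
qed

section \<open>The inverse in one degree, from a permuted basis\<close>

context brauer_pair begin

context
  fixes Y :: "'b set"
  assumes basis: "module_basis R B Y"
    and perm: "\<And>u y. u \<in> P \<Longrightarrow> y \<in> Y \<Longrightarrow> gimage R B u \<otimes>\<^bsub>B\<^esub> y \<in> Y"
      "\<And>u y. u \<in> P \<Longrightarrow> y \<in> Y \<Longrightarrow> y \<otimes>\<^bsub>B\<^esub> gimage R B u \<in> Y"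
begin

private lemma Y_carrier: "y \<in> Y \<Longrightarrow> y \<in> carrier B"
  using basis by (auto simp: module_basis_def)

private lemma act_Y: "\<phi> \<in> carrier B1.H \<Longrightarrow> u \<in> P \<Longrightarrow> y \<in> Y \<Longrightarrow> B2.act \<phi> u y \<in> Y"
  by (simp add: twisted_act_def perm B1.P_simps(3))

text \<open>The inverse sends the class of \<open>x\<close> to the sum, over basis elements
  \<open>y\<close> fixed in this degree, of the class of the coordinate at \<open>y\<close> tensored
  with the class of \<open>y\<close>. It is well defined because these coordinates preserve Brauer
  kernels. One composite is computed with the orbit lemma in \<open>B\<close>, the other with the
  orbit lemma in the tensor product.\<close>

lemma component_inverse:
  assumes \<phi>K: "\<phi> \<in> K" and Psi: "Psi \<in> lin_hom B1.k GP.T BT.NB"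
    "\<And>\<phi> C D. \<phi> \<in> K \<Longrightarrow> C \<in> carrier (B1.Bq \<phi>) \<Longrightarrow> D \<in> carrier (B2.Bq \<phi>) \<Longrightarrow>
      Psi (GP.tau (B1.inj_comp \<phi> C) (B2.inj_comp \<phi> D)) = BT.inj_comp \<phi> (tcls \<phi> C D)"
  obtains F where "F \<in> lin_hom B1.k (BT.Bq \<phi>) GP.T"
    "\<And>C D. C \<in> carrier (B1.Bq \<phi>) \<Longrightarrow> D \<in> carrier (B2.Bq \<phi>) \<Longrightarrow>
      F (tcls \<phi> C D) = GP.tau (B1.inj_comp \<phi> C) (B2.inj_comp \<phi> D)"
    "\<And>W. W \<in> carrier (BT.Bq \<phi>) \<Longrightarrow> F W \<in> GP.comp \<phi>"
    "\<And>W. W \<in> carrier (BT.Bq \<phi>) \<Longrightarrow> Psi (F W) = BT.inj_comp \<phi> W"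
proof (rule module_basis_coordinates[OF B2.A.module_axioms basis])
  fix \<beta>
  assume \<beta>: "\<And>y b. b \<in> carrier B \<Longrightarrow> \<beta> y b \<in> carrier R"
    "\<And>y b c. b \<in> carrier B \<Longrightarrow> c \<in> carrier B \<Longrightarrow> \<beta> y (b \<oplus>\<^bsub>B\<^esub> c) = \<beta> y b \<oplus>\<^bsub>R\<^esub> \<beta> y c"
    "\<And>r y b. r \<in> carrier R \<Longrightarrow> b \<in> carrier B \<Longrightarrow> \<beta> y (r \<odot>\<^bsub>B\<^esub> b) = r \<otimes>\<^bsub>R\<^esub> \<beta> y b"
    "\<And>b. b \<in> carrier B \<Longrightarrow> finite {y \<in> Y. \<beta> y b \<noteq> \<zero>\<^bsub>R\<^esub>}"
    "\<And>b. b \<in> carrier B \<Longrightarrow> b = (\<Oplus>\<^bsub>B\<^esub>y\<in>{y \<in> Y. \<beta> y b \<noteq> \<zero>\<^bsub>R\<^esub>}. \<beta> y b \<odot>\<^bsub>B\<^esub> y)"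
    "\<And>y z. z \<in> Y \<Longrightarrow> \<beta> y z = (if y = z then \<one>\<^bsub>R\<^esub> else \<zero>\<^bsub>R\<^esub>)"
  note \<phi> = B1.K_H[OF \<phi>K]
  let ?ya = "B2.act \<phi>"
  \<comment> \<open>Fixed under the action twisted by \<phi>, so this set changes with the
    degree.\<close>
  define Yf where "Yf = {y \<in> Y. \<forall>u\<in>P. ?ya u y = y}"
  interpret Bq1: module B1.k "B1.Bq \<phi>" by (rule B1.Bq_module[OF \<phi>])
  interpret Bq2: module B1.k "B2.Bq \<phi>" by (rule B2.Bq_module[OF \<phi>])
  interpret BqT: module B1.k "BT.Bq \<phi>" by (rule BT.Bq_module[OF \<phi>])
  have ya: "?ya u y \<in> Y" "?ya \<one>\<^bsub>G\<^esub> y = y" "v \<in> P \<Longrightarrow> ?ya (u \<otimes>\<^bsub>G\<^esub> v) y = ?ya v (?ya u y)"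
    if "u \<in> P" "y \<in> Y" for u v y
    using that act_Y[OF \<phi>] B2.act_one[OF \<phi>] B2.act_mult[OF \<phi>] Y_carrier by simp_all
  have ya_inj: "?ya u y = ?ya u z \<longleftrightarrow> y = z" if "u \<in> P" "y \<in> Y" "z \<in> Y" for u y z
  proof -
    have "?ya (inv\<^bsub>G\<^esub> u) (?ya u w) = w" if "w \<in> Y" for w
      using ya(3)[OF \<open>u \<in> P\<close> that B1.P.m_inv_closed[OF \<open>u \<in> P\<close>]] ya(2)[OF \<open>u \<in> P\<close> that]
        B1.P_simps(1)[OF \<open>u \<in> P\<close>] by simp
    then show ?thesis using that by metis
  qed
  have Yf: "y \<in> Y" "y \<in> carrier B" "y \<in> B2.Fix \<phi> P" "u \<in> P \<Longrightarrow> ?ya u y = y" if "y \<in> Yf" for y u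
    using that Y_carrier B2.Fix_iff[OF \<phi> order_refl] by (auto simp: Yf_def)
  \<comment> \<open>The action permutes the basis, so moving both the element and the index leaves
    the coordinate unchanged. Applied to the expansion of \<open>b\<close>, the coordinate at the
    moved index keeps only the term of \<open>y\<close>.\<close>
  have \<beta>_act: "\<beta> (?ya u y) (?ya u b) = \<beta> y b" if u: "u \<in> P" and y: "y \<in> Y" and b: "b \<in> carrier B" for u y b
  proof -
    let ?S = "{z \<in> Y. \<beta> z b \<noteq> \<zero>\<^bsub>R\<^esub>}"
    define h where "h b = \<beta> (?ya u y) (?ya u b)" for b
    note al = B2.act_lin[OF \<phi> u]
    note ar = lin_hom_closed[OF al] lin_hom_add[OF al] lin_hom_smult[OF al]
    have hz: "h (\<beta> z b \<odot>\<^bsub>B\<^esub> z) = (if y = z then \<beta> z b else \<zero>\<^bsub>R\<^esub>)" if "z \<in> Y" for z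
      using that b \<beta>(1)[OF b] Y_carrier[OF that] ya(1)[OF u that]
      by (simp add: h_def ar \<beta>(3,6) ya_inj[OF u y])
    have "h (\<Oplus>\<^bsub>B\<^esub>z\<in>?S. \<beta> z b \<odot>\<^bsub>B\<^esub> z) = (\<Oplus>\<^bsub>R\<^esub>z\<in>?S. h (\<beta> z b \<odot>\<^bsub>B\<^esub> z))"
      using b Y_carrier
      by (intro additive_finsum B2.A.abelian_group_axioms B1.A.R.abelian_group_axioms)
        (auto simp: h_def ar \<beta>)
    also have "\<dots> = (\<Oplus>\<^bsub>R\<^esub>z\<in>?S. if y = z then \<beta> z b else \<zero>\<^bsub>R\<^esub>)"
      using hz \<beta>(1)[OF b] by (intro B1.A.R.finsum_cong') auto
    also have "\<dots> = \<beta> y b"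
    proof (cases "y \<in> ?S")
      case True
      then show ?thesis
        using \<beta>(4)[OF b] \<beta>(1)[OF b] by (subst B1.A.R.finsum_single[of _ y]) auto
    next
      case False
      then have "(\<Oplus>\<^bsub>R\<^esub>z\<in>?S. if y = z then \<beta> z b else \<zero>\<^bsub>R\<^esub>) = (\<Oplus>\<^bsub>R\<^esub>z\<in>?S. \<zero>\<^bsub>R\<^esub>)"
        by (intro B1.A.R.finsum_cong') auto
      then show ?thesis using False y by simp
    qed
    finally show ?thesis
      using \<beta>(5)[OF b] by (simp add: h_def)
  qed
  \<comment> \<open>Under the decomposition of the tensor product into the summands A \<otimes> y,
    this is the coefficient map at \<open>y\<close>, with values in \<open>A\<close>.\<close>
  have "\<exists>h. h \<in> lin_hom R TI A \<and> (\<forall>a\<in>carrier A. \<forall>b\<in>carrier B. h (t a b) = \<beta> y b \<odot>\<^bsub>A\<^esub> a)" for y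
  proof (rule tensor_lift[OF alg B1.A.module_axioms])
    show "(\<lambda>a b. \<beta> y b \<odot>\<^bsub>A\<^esub> a) \<in> bilin R A B A"
      by (rule bilinI)
        (simp_all add: \<beta> B1.A.smult_l_distr B1.A.smult_r_distr B1.A.smult_assoc1
          flip: B1.A.smult_assoc1 add: B1.A.R.m_comm)
  next
    fix h assume "h \<in> lin_hom R (tensor R A B) A"
      "\<And>a b. a \<in> carrier A \<Longrightarrow> b \<in> carrier B \<Longrightarrow> h (t a b) = \<beta> y b \<odot>\<^bsub>A\<^esub> a"
    then show ?thesis by (auto simp: lin_hom_TI)
  qed
  then obtain coord where coord: "\<And>y. coord y \<in> lin_hom R TI A"
    "\<And>y a b. a \<in> carrier A \<Longrightarrow> b \<in> carrier B \<Longrightarrow> coord y (t a b) = \<beta> y b \<odot>\<^bsub>A\<^esub> a"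
    by metis
  note cr = lin_hom_closed[OF coord(1)] lin_hom_add[OF coord(1)] lin_hom_smult[OF coord(1)]
    lin_hom_zero[OF BT.A.module_axioms B1.A.module_axioms coord(1)]
    lin_hom_neg[OF BT.A.module_axioms B1.A.module_axioms coord(1)]
  \<comment> \<open>Tensors with finitely many nonzero coordinates form a submodule, and it contains
    the pure tensors because expansions in the basis are finite.\<close>
  have fin: "finite {y \<in> Y. coord y x \<noteq> \<zero>\<^bsub>A\<^esub>}" if x: "x \<in> carrier TI" for x
  proof -
    interpret T0: assoc_algebra R "tensor R A B" by (rule assoc_algebra_tensor[OF alg])
    let ?F = "{x \<in> carrier TI. finite {y \<in> Y. coord y x \<noteq> \<zero>\<^bsub>A\<^esub>}}"
    note c0 = coord(1)[unfolded lin_hom_TI]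
    have "submodule ?F R (tensor R A B)"
    proof (rule T0.submoduleI)
      show "\<zero>\<^bsub>tensor R A B\<^esub> \<in> ?F"
        by (simp add: TI_simps lin_hom_zero[OF T0.module_axioms B1.A.module_axioms c0])
      show "\<ominus>\<^bsub>tensor R A B\<^esub> a \<in> ?F" if "a \<in> ?F" for a
      proof -
        have "{y \<in> Y. coord y (\<ominus>\<^bsub>tensor R A B\<^esub> a) \<noteq> \<zero>\<^bsub>A\<^esub>} \<subseteq> {y \<in> Y. coord y a \<noteq> \<zero>\<^bsub>A\<^esub>}"
          using that by (auto simp: TI_simps lin_hom_neg[OF T0.module_axioms B1.A.module_axioms c0])
        then show ?thesis using that by (auto simp: TI_simps intro: finite_subset)
      qed
      show "a \<oplus>\<^bsub>tensor R A B\<^esub> b \<in> ?F" if "a \<in> ?F" "b \<in> ?F" for a b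
      proof -
        have "{y \<in> Y. coord y (a \<oplus>\<^bsub>tensor R A B\<^esub> b) \<noteq> \<zero>\<^bsub>A\<^esub>} \<subseteq>
            {y \<in> Y. coord y a \<noteq> \<zero>\<^bsub>A\<^esub>} \<union> {y \<in> Y. coord y b \<noteq> \<zero>\<^bsub>A\<^esub>}"
          using that by (auto simp: TI_simps lin_hom_add[OF c0])
        then show ?thesis using that by (auto simp: TI_simps intro: finite_subset)
      qed
      show "r \<odot>\<^bsub>tensor R A B\<^esub> a \<in> ?F" if "r \<in> carrier R" "a \<in> ?F" for r a
      proof -
        have "{y \<in> Y. coord y (r \<odot>\<^bsub>tensor R A B\<^esub> a) \<noteq> \<zero>\<^bsub>A\<^esub>} \<subseteq> {y \<in> Y. coord y a \<noteq> \<zero>\<^bsub>A\<^esub>}"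
          using that by (auto simp: TI_simps lin_hom_smult[OF c0])
        then show ?thesis using that by (auto simp: TI_simps intro: finite_subset)
      qed
    qed (auto simp: TI_simps)
    moreover have "t a b \<in> ?F" if "a \<in> carrier A" "b \<in> carrier B" for a b
    proof -
      have "{y \<in> Y. coord y (t a b) \<noteq> \<zero>\<^bsub>A\<^esub>} \<subseteq> {y \<in> Y. \<beta> y b \<noteq> \<zero>\<^bsub>R\<^esub>}"
        using that by (auto simp: coord(2))
      then show ?thesis using that \<beta>(4) t_closed by (auto intro: finite_subset)
    qed
    ultimately have "carrier (tensor R A B) \<subseteq> ?F"
      unfolding pure_tensor_span[OF alg, symmetric] by (intro submodule_span_minimal) auto
    then show ?thesis using x by (auto simp: TI_simps)
  qed
  \<comment> \<open>For \<open>y\<close> in the basis, the projection onto the summand A \<otimes>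
    y.\<close>
  define \<pi> where "\<pi> y x = t (coord y x) y" for y x
  have \<pi>_lin: "\<pi> y \<in> lin_hom R TI TI" if "y \<in> Y" for y
    unfolding \<pi>_def using lin_hom_comp[OF coord(1) bilinD(2)[OF t_bilin Y_carrier[OF that]]] .
  have t0: "t \<zero>\<^bsub>A\<^esub> y = \<zero>\<^bsub>TI\<^esub>" if "y \<in> Y" for y
    by (rule lin_hom_zero[OF B1.A.module_axioms BT.A.module_axioms bilinD(2)[OF t_bilin Y_carrier[OF that]]])
  have \<pi>_fin: "finite {y \<in> Y. \<pi> y x \<noteq> \<zero>\<^bsub>TI\<^esub>}" if "x \<in> carrier TI" for x
    by (rule finite_subset[OF _ fin[OF that]]) (auto simp: \<pi>_def t0)
  \<comment> \<open>The projections add up to the identity; on \<open>t a b\<close> this is the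
    expansion of \<open>b\<close>.\<close>
  have \<pi>_sum: "x = (\<Oplus>\<^bsub>TI\<^esub>y\<in>{y \<in> Y. \<pi> y x \<noteq> \<zero>\<^bsub>TI\<^esub>}. \<pi> y x)" if x: "x \<in> carrier TI" for x
  proof (rule TI_lin_eq[OF BT.A.module_axioms _ _ x])
    show "(\<lambda>x. x) \<in> lin_hom R TI TI" by (rule lin_homI) auto
    show "(\<lambda>x. \<Oplus>\<^bsub>TI\<^esub>y\<in>{y \<in> Y. \<pi> y x \<noteq> \<zero>\<^bsub>TI\<^esub>}. \<pi> y x) \<in> lin_hom R TI TI"
      by (rule lin_hom_finsum_family[OF BT.A.module_axioms BT.A.module_axioms \<pi>_lin \<pi>_fin])
    fix a b assume a: "a \<in> carrier A" and b: "b \<in> carrier B"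
    let ?S = "{y \<in> Y. \<beta> y b \<noteq> \<zero>\<^bsub>R\<^esub>}"
    note tl = bilinD(1)[OF t_bilin a] bilinD(2)[OF t_bilin]
    have \<pi>t: "\<pi> y (t a b) = t a (\<beta> y b \<odot>\<^bsub>B\<^esub> y)" if "y \<in> Y" for y
      using a b Y_carrier[OF that] \<beta>(1)[OF b]
      by (simp add: \<pi>_def coord(2) lin_hom_smult[OF tl(1)] lin_hom_smult[OF tl(2)])
    have z: "t a \<zero>\<^bsub>B\<^esub> = \<zero>\<^bsub>TI\<^esub>"
      by (rule lin_hom_zero[OF B2.A.module_axioms BT.A.module_axioms tl(1)])
    have "(\<Oplus>\<^bsub>TI\<^esub>y\<in>{y \<in> Y. \<pi> y (t a b) \<noteq> \<zero>\<^bsub>TI\<^esub>}. \<pi> y (t a b)) = (\<Oplus>\<^bsub>TI\<^esub>y\<in>?S. \<pi> y (t a b))"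
      using a b \<beta>(1,4)[OF b] Y_carrier
      by (intro BT.A.finsum_superset) (auto simp: \<pi>t z intro!: t_closed)
    also have "\<dots> = (\<Oplus>\<^bsub>TI\<^esub>y\<in>?S. t a (\<beta> y b \<odot>\<^bsub>B\<^esub> y))"
      using a b \<beta>(1)[OF b] Y_carrier by (intro BT.A.finsum_cong') (auto simp: \<pi>t intro!: t_closed)
    also have "\<dots> = t a (\<Oplus>\<^bsub>B\<^esub>y\<in>?S. \<beta> y b \<odot>\<^bsub>B\<^esub> y)"
      using b \<beta>(1)[OF b] Y_carrier
      by (intro lin_hom_finsum[OF B2.A.module_axioms BT.A.module_axioms tl(1), symmetric]) auto
    finally show "t a b = (\<Oplus>\<^bsub>TI\<^esub>y\<in>{y \<in> Y. \<pi> y (t a b) \<noteq> \<zero>\<^bsub>TI\<^esub>}. \<pi> y (t a b))"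
      using \<beta>(5)[OF b] by simp
  qed
  \<comment> \<open>On pure tensors the action works on both factors, and \<open>\<beta>_act\<close>
    absorbs its effect on the second.\<close>
  have coord_act: "coord (?ya u y) (BT.act \<phi> u x) = B1.act \<phi> u (coord y x)"
    if u: "u \<in> P" and y: "y \<in> Y" and x: "x \<in> carrier TI" for u y x
  proof (rule TI_lin_eq[OF B1.A.module_axioms _ _ x])
    show "(\<lambda>x. coord (?ya u y) (BT.act \<phi> u x)) \<in> lin_hom R TI A"
      by (rule lin_hom_comp[OF BT.act_lin[OF \<phi> u] coord(1)])
    show "(\<lambda>x. B1.act \<phi> u (coord y x)) \<in> lin_hom R TI A"
      by (rule lin_hom_comp[OF coord(1) B1.act_lin[OF \<phi> u]])
    show "coord (?ya u y) (BT.act \<phi> u (t a b)) = B1.act \<phi> u (coord y (t a b))"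
      if "a \<in> carrier A" "b \<in> carrier B" for a b
      using that u y \<phi>
      by (simp add: t_act coord(2) B1.act_closed B2.act_closed \<beta>_act \<beta>(1) lin_hom_smult[OF B1.act_lin[OF \<phi> u]])
  qed
  \<comment> \<open>At a fixed index the preceding identity says that \<open>coord y\<close>
    commutes with the action; hence it respects fixed points and, below, traces.\<close>
  have coord_Fix: "coord y x \<in> B1.Fix \<phi> Q" if "y \<in> Yf" "Q \<subseteq> P" "x \<in> BT.Fix \<phi> Q" for y Q x
  proof -
    note x = BT.FixD[OF \<phi> that(2,3)]
    have "B1.act \<phi> u (coord y x) = coord y x" if "u \<in> Q" for u
      using coord_act[OF _ Yf(1)[OF \<open>y \<in> Yf\<close>] x(1), of u] Yf(4)[OF \<open>y \<in> Yf\<close>] x(2)[OF that] that \<open>Q \<subseteq> P\<close> by auto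
    then show ?thesis
      using cr(1)[OF x(1)] B1.Fix_iff[OF \<phi> that(2)] by blast
  qed
  have coord_tr: "coord y (BT.tr \<phi> Q c) = B1.tr \<phi> Q (coord y c)"
    if y: "y \<in> Yf" and Q: "subgroup Q B1.PG" and c: "c \<in> BT.Fix \<phi> Q" for y Q c
  proof -
    have c': "c \<in> carrier TI" using c BT.Fix_carrier by blast
    have u: "(SOME u. u \<in> C) \<in> P" if "C \<in> rcosets\<^bsub>B1.PG\<^esub> Q" for C
      using B1.cosetD(1,5)[OF Q that] by blast
    have "coord y (BT.tr \<phi> Q c) = (\<Oplus>\<^bsub>A\<^esub>C\<in>rcosets\<^bsub>B1.PG\<^esub> Q. coord y (BT.act \<phi> (SOME u. u \<in> C) c))"
      unfolding BT.tr_eq using u c'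
      by (intro lin_hom_finsum[OF BT.A.module_axioms B1.A.module_axioms coord(1)]) (auto intro: BT.act_closed[OF \<phi>])
    also have "\<dots> = B1.tr \<phi> Q (coord y c)"
      unfolding B1.tr_eq
    proof (rule B1.A.finsum_cong'[OF refl])
      show "(\<lambda>C. B1.act \<phi> (SOME u. u \<in> C) (coord y c)) \<in> rcosets\<^bsub>B1.PG\<^esub> Q \<rightarrow> carrier A"
        using u c' cr(1) by (auto intro: B1.act_closed[OF \<phi>])
      show "coord y (BT.act \<phi> (SOME u. u \<in> C) c) = B1.act \<phi> (SOME u. u \<in> C) (coord y c)"
        if "C \<in> rcosets\<^bsub>B1.PG\<^esub> Q" for C
        using coord_act[OF u[OF that] Yf(1)[OF y] c'] Yf(4)[OF y u[OF that]] by simp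
    qed
    finally show ?thesis .
  qed
  \<comment> \<open>This allows a class of the tensor product to have a coordinate in the Brauer
    quotient of \<open>A\<close>. It relies on \<open>y\<close> being fixed, since otherwise the
    action would move the index.\<close>
  have coord_ker: "coord y x \<in> B1.ker \<phi>" if y: "y \<in> Yf" and x: "x \<in> BT.ker \<phi>" for y x
  proof (rule BT.ker_induct[OF \<phi> B1.FA_module[OF \<phi>] _ B1.ker_submodule[OF \<phi>] _ _ x])
    show "coord y \<in> lin_hom R (BT.FA \<phi>) (B1.FA \<phi>)"
      using coord_Fix[OF y order_refl] BT.FixD(1)[OF \<phi> order_refl]
      by (intro lin_homI) (auto simp: cr)
    show "coord y (BT.tr \<phi> Q c) \<in> B1.ker \<phi>" if "subgroup Q B1.PG" "Q \<noteq> P" "c \<in> BT.Fix \<phi> Q" for Q c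
    proof -
      have "Q \<subseteq> P" using subgroup.subset[OF that(1)] by simp
      then show ?thesis
        using coord_tr[OF y that(1,3)] B1.tr_ker[OF that(1,2) coord_Fix[OF y _ that(3)]] by simp
    qed
    show "coord y (r \<odot>\<^bsub>TI\<^esub> a) \<in> B1.ker \<phi>" if "r \<in> J" "a \<in> BT.Fix \<phi> P" for r a
      using that B1.smult_ker[OF that(1) coord_Fix[OF y order_refl that(2)]] B1.J.Icarr[OF that(1)]
        BT.FixD(1)[OF \<phi> order_refl that(2)] by (simp add: cr)
  qed
  \<comment> \<open>The contribution of \<open>y\<close> to the inverse, embedded in the tensor
    product of the full graded algebras by elements of degree \<phi>.\<close>
  define F0 where "F0 y x = GP.tau (B1.inj_comp \<phi> (B1.cls \<phi> (coord y x))) (B2.inj_comp \<phi> (B2.cls \<phi> y))" for y x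
  have e2: "B2.inj_comp \<phi> (B2.cls \<phi> y) \<in> carrier B2.NB" if "y \<in> Yf" for y
    using that by (intro B2.inj_comp_closed \<phi>K B2.cls_closed Yf)
  have F0_lin: "(\<lambda>C. GP.tau (B1.inj_comp \<phi> C) (B2.inj_comp \<phi> (B2.cls \<phi> y))) \<in> lin_hom B1.k (B1.Bq \<phi>) GP.T"
    if "y \<in> Yf" for y
    by (rule lin_hom_comp[OF B1.inj_comp_lin[OF \<phi>K] bilinD(2)[OF GP.tau_bilin e2[OF that]]])
  note F0r = lin_hom_closed[OF F0_lin] lin_hom_add[OF F0_lin] lin_hom_smult[OF F0_lin]
    lin_hom_zero[OF Bq1.module_axioms GP.T.module_axioms F0_lin]
  have cF: "coord y x \<in> B1.Fix \<phi> P" if "y \<in> Yf" "x \<in> BT.Fix \<phi> P" for y x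
    by (rule coord_Fix[OF that(1) order_refl that(2)])
  have "\<exists>h. h \<in> lin_hom B1.k (BT.Bq \<phi>) GP.T \<and> (\<forall>x\<in>BT.Fix \<phi> P. h (BT.cls \<phi> x) = F0 y x)" if y: "y \<in> Yf" for y
  proof (rule BT.Bq_lift[OF \<phi> GP.T.module_axioms, of "F0 y"])
    show "F0 y a \<in> carrier GP.T" if "a \<in> BT.Fix \<phi> P" for a
      unfolding F0_def using F0r(1)[OF y B1.cls_closed[OF cF[OF y that]]] .
    show "F0 y (a \<oplus>\<^bsub>TI\<^esub> b) = F0 y a \<oplus>\<^bsub>GP.T\<^esub> F0 y b" if "a \<in> BT.Fix \<phi> P" "b \<in> BT.Fix \<phi> P" for a b
      unfolding F0_def
      using that cF[OF y] BT.FixD(1)[OF \<phi> order_refl]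
      by (simp add: cr B1.cls_add[OF \<phi>, symmetric] F0r(2)[OF y] B1.cls_closed)
    show "F0 y (r \<odot>\<^bsub>TI\<^esub> a) = (J +>\<^bsub>R\<^esub> r) \<odot>\<^bsub>GP.T\<^esub> F0 y a" if "r \<in> carrier R" "a \<in> BT.Fix \<phi> P" for r a
      unfolding F0_def
      using that cF[OF y] BT.FixD(1)[OF \<phi> order_refl]
      by (simp add: cr B1.cls_smult[OF \<phi>, symmetric] F0r(3)[OF y] B1.cls_closed B1.k_carrier)
    show "F0 y a = \<zero>\<^bsub>GP.T\<^esub>" if "a \<in> BT.ker \<phi>" for a
      unfolding F0_def
      using F0r(4)[OF y] B1.cls_zero_iff[OF \<phi> cF[OF y BT.ker_carrier[OF \<phi> that]]] coord_ker[OF y that] by simp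
  next
    fix h assume "h \<in> lin_hom B1.k (BT.Bq \<phi>) GP.T" "\<And>a. a \<in> BT.Fix \<phi> P \<Longrightarrow> h (BT.cls \<phi> a) = F0 y a"
    then show ?thesis by blast
  qed
  then obtain h where h: "\<And>y. y \<in> Yf \<Longrightarrow> h y \<in> lin_hom B1.k (BT.Bq \<phi>) GP.T"
    "\<And>y x. y \<in> Yf \<Longrightarrow> x \<in> BT.Fix \<phi> P \<Longrightarrow> h y (BT.cls \<phi> x) = F0 y x"
    by metis
  have F0_zero: "F0 y x = \<zero>\<^bsub>GP.T\<^esub>" if "y \<in> Yf" "coord y x = \<zero>\<^bsub>A\<^esub>" for y x
    using that F0r(4) by (simp add: F0_def B1.cls_zero[OF \<phi>])
  have F0_closed: "F0 y x \<in> carrier GP.T" if "y \<in> Yf" "x \<in> BT.Fix \<phi> P" for y x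
    unfolding F0_def using F0r(1)[OF that(1) B1.cls_closed[OF cF[OF that]]] .
  \<comment> \<open>The sum is cut down to its nonzero terms because \<open>Yf\<close> may be
    infinite.\<close>
  define F where "F W = (\<Oplus>\<^bsub>GP.T\<^esub>y\<in>{y \<in> Yf. h y W \<noteq> \<zero>\<^bsub>GP.T\<^esub>}. h y W)" for W
  have F_fin: "finite {y \<in> Yf. h y W \<noteq> \<zero>\<^bsub>GP.T\<^esub>}" if "W \<in> carrier (BT.Bq \<phi>)" for W
  proof -
    from that obtain x where x: "x \<in> BT.Fix \<phi> P" "W = BT.cls \<phi> x" by (auto simp: BT.Bq_carrier)
    then show ?thesis
      using h(2) F0_zero Yf(1) by (intro finite_subset[OF _ fin[OF BT.FixD(1)[OF \<phi> order_refl x(1)]]]) auto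
  qed
  have F_lin: "F \<in> lin_hom B1.k (BT.Bq \<phi>) GP.T"
    unfolding F_def by (rule lin_hom_finsum_family[OF BqT.module_axioms GP.T.module_axioms h(1) F_fin])
  \<comment> \<open>Any finite set of fixed indices containing the nonzero coordinates may serve as
    index set; the two computations below use different ones.\<close>
  have F_eq: "F (BT.cls \<phi> x) = (\<Oplus>\<^bsub>GP.T\<^esub>y\<in>S. F0 y x)"
    if x: "x \<in> BT.Fix \<phi> P" and S: "finite S" "{y \<in> Yf. coord y x \<noteq> \<zero>\<^bsub>A\<^esub>} \<subseteq> S" "S \<subseteq> Yf" for x S
  proof -
    have "F (BT.cls \<phi> x) = (\<Oplus>\<^bsub>GP.T\<^esub>y\<in>{y \<in> Yf. F0 y x \<noteq> \<zero>\<^bsub>GP.T\<^esub>}. F0 y x)"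
    proof -
      have eq: "{y \<in> Yf. h y (BT.cls \<phi> x) \<noteq> \<zero>\<^bsub>GP.T\<^esub>} = {y \<in> Yf. F0 y x \<noteq> \<zero>\<^bsub>GP.T\<^esub>}"
        using h(2)[OF _ x] by auto
      show ?thesis
        unfolding F_def eq using h(2)[OF _ x] F0_closed[OF _ x] by (intro GP.T.finsum_cong') auto
    qed
    also have "\<dots> = (\<Oplus>\<^bsub>GP.T\<^esub>y\<in>S. F0 y x)"
      using S F0_zero F0_closed[OF _ x] by (intro GP.T.finsum_superset) auto
    finally show ?thesis .
  qed
  \<comment> \<open>The coordinates of \<open>t a b\<close> are multiples of \<open>a\<close>.
    Moving the scalars to the second factor leaves the class of \<open>a\<close> tensored with the
    class of the part of \<open>b\<close> on fixed basis elements, and the orbit lemma in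
    \<open>B\<close> identifies the latter with the class of \<open>b\<close>.\<close>
  have F1: "F (tcls \<phi> C D) = GP.tau (B1.inj_comp \<phi> C) (B2.inj_comp \<phi> D)"
    if C: "C \<in> carrier (B1.Bq \<phi>)" and D: "D \<in> carrier (B2.Bq \<phi>)" for C D
  proof -
    from C obtain a where a: "a \<in> B1.Fix \<phi> P" "C = B1.cls \<phi> a" by (auto simp: B1.Bq_carrier)
    from D obtain b where b: "b \<in> B2.Fix \<phi> P" "D = B2.cls \<phi> b" by (auto simp: B2.Bq_carrier)
    have car: "a \<in> carrier A" "b \<in> carrier B"
      using a(1) b(1) B1.Fix_carrier B2.Fix_carrier by blast+
    let ?S = "{y \<in> Yf. \<beta> y b \<noteq> \<zero>\<^bsub>R\<^esub>}"
    let ?c = "B1.inj_comp \<phi> C"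
    have c: "?c \<in> carrier B1.NB" by (rule B1.inj_comp_closed[OF \<phi>K C])
    have Sfin: "finite ?S" using Yf(1) by (intro finite_subset[OF _ \<beta>(4)[OF car(2)]]) auto
    have lin: "(\<lambda>D. GP.tau ?c (B2.inj_comp \<phi> D)) \<in> lin_hom B1.k (B2.Bq \<phi>) GP.T"
      by (rule lin_hom_comp[OF B2.inj_comp_lin[OF \<phi>K] bilinD(1)[OF GP.tau_bilin c]])
    have sF: "\<beta> y b \<odot>\<^bsub>B\<^esub> y \<in> B2.Fix \<phi> P" if "y \<in> Yf" for y
      using submodule.smult_closed[OF B2.Fix_submodule[OF \<phi> order_refl] \<beta>(1)[OF car(2)] Yf(3)[OF that]] .
    have F0_eq: "F0 y (t a b) = GP.tau ?c (B2.inj_comp \<phi> (B2.cls \<phi> (\<beta> y b \<odot>\<^bsub>B\<^esub> y)))" if y: "y \<in> Yf" for y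
      using car \<beta>(1)[OF car(2)] C B2.cls_closed[OF Yf(3)[OF y]] a(1) Yf(3)[OF y]
      by (simp add: F0_def coord(2) B1.cls_smult[OF \<phi>, symmetric] B2.cls_smult[OF \<phi>, symmetric]
          F0r(3)[OF y] lin_hom_smult[OF lin] B1.k_carrier flip: a(2))
    have "F (tcls \<phi> C D) = F (BT.cls \<phi> (t a b))"
      using a b tcls_cls[OF \<phi>] by simp
    also have "\<dots> = (\<Oplus>\<^bsub>GP.T\<^esub>y\<in>?S. F0 y (t a b))"
      using car by (intro F_eq t_Fix[OF \<phi> order_refl a(1) b(1)] Sfin) (auto simp: coord(2))
    also have "\<dots> = (\<Oplus>\<^bsub>GP.T\<^esub>y\<in>?S. GP.tau ?c (B2.inj_comp \<phi> (B2.cls \<phi> (\<beta> y b \<odot>\<^bsub>B\<^esub> y))))"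
      using F0_eq lin_hom_closed[OF lin] B2.cls_closed[OF sF] by (intro GP.T.finsum_cong') auto
    also have "\<dots> = GP.tau ?c (B2.inj_comp \<phi> (\<Oplus>\<^bsub>B2.Bq \<phi>\<^esub>y\<in>?S. B2.cls \<phi> (\<beta> y b \<odot>\<^bsub>B\<^esub> y)))"
      using B2.cls_closed[OF sF]
      by (intro lin_hom_finsum[OF Bq2.module_axioms GP.T.module_axioms lin, symmetric]) auto
    also have "(\<Oplus>\<^bsub>B2.Bq \<phi>\<^esub>y\<in>?S. B2.cls \<phi> (\<beta> y b \<odot>\<^bsub>B\<^esub> y)) = B2.cls \<phi> (\<Oplus>\<^bsub>B\<^esub>y\<in>?S. \<beta> y b \<odot>\<^bsub>B\<^esub> y)"
      using sF by (intro B2.cls_finsum[OF \<phi>, symmetric]) auto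
    also have "\<dots> = B2.cls \<phi> b"
    proof (rule B2.cls_orbit_sum(2)[OF \<phi> b(1), where ya = ?ya and Y = Y, symmetric])
      show "?ya u y \<in> Y" if "u \<in> P" "y \<in> Y" for u y using ya(1)[OF that] .
      show "?ya (u \<otimes>\<^bsub>G\<^esub> v) y = ?ya v (?ya u y)" if "u \<in> P" "v \<in> P" "y \<in> Y" for u v y
        using ya(3)[OF that(1,3,2)] .
      show "?ya \<one>\<^bsub>G\<^esub> y = y" if "y \<in> Y" for y using ya(2)[OF B1.P.one_closed that] .
      show "\<beta> y b \<odot>\<^bsub>B\<^esub> y \<in> carrier B" if "y \<in> Y" for y using Y_carrier[OF that] \<beta>(1)[OF car(2)] by simp
      show "\<beta> (?ya u y) b \<odot>\<^bsub>B\<^esub> ?ya u y = ?ya u (\<beta> y b \<odot>\<^bsub>B\<^esub> y)" if "u \<in> P" "y \<in> Y" for u y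
        using \<beta>_act[OF that car(2)] B2.FixD(2)[OF \<phi> order_refl b(1) that(1)]
          lin_hom_smult[OF B2.act_lin[OF \<phi> that(1)] \<beta>(1)[OF car(2)] Y_carrier[OF that(2)]] by simp
      show fin': "finite {y \<in> Y. \<beta> y b \<odot>\<^bsub>B\<^esub> y \<noteq> \<zero>\<^bsub>B\<^esub>}"
        using Y_carrier by (intro finite_subset[OF _ \<beta>(4)[OF car(2)]]) auto
      have "(\<Oplus>\<^bsub>B\<^esub>y\<in>{y \<in> Y. \<beta> y b \<odot>\<^bsub>B\<^esub> y \<noteq> \<zero>\<^bsub>B\<^esub>}. \<beta> y b \<odot>\<^bsub>B\<^esub> y) =
          (\<Oplus>\<^bsub>B\<^esub>y\<in>{y \<in> Y. \<beta> y b \<noteq> \<zero>\<^bsub>R\<^esub>}. \<beta> y b \<odot>\<^bsub>B\<^esub> y)"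
        using Y_carrier \<beta>(1,4)[OF car(2)] by (intro B2.A.finsum_superset) auto
      then show "b = (\<Oplus>\<^bsub>B\<^esub>y\<in>{y \<in> Y. \<beta> y b \<odot>\<^bsub>B\<^esub> y \<noteq> \<zero>\<^bsub>B\<^esub>}. \<beta> y b \<odot>\<^bsub>B\<^esub> y)"
        using \<beta>(5)[OF car(2)] by simp
      show "{y \<in> Y. (\<forall>u\<in>P. ?ya u y = y) \<and> \<beta> y b \<odot>\<^bsub>B\<^esub> y \<noteq> \<zero>\<^bsub>B\<^esub>} \<subseteq> ?S"
        using Y_carrier by (auto simp: Yf_def)
    qed (use Sfin in \<open>auto simp: Yf_def\<close>)
    finally show ?thesis using b(2) by simp
  qed
  have F0_comp: "F0 y x \<in> GP.comp \<phi>" if "y \<in> Yf" "x \<in> BT.Fix \<phi> P" for y x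
    unfolding F0_def using that \<phi>K
    by (intro GP.comp_mem) (auto simp: B1.homcomp_eq B2.homcomp_eq intro!: imageI B1.cls_closed B2.cls_closed cF Yf)
  \<comment> \<open>\<open>Psi\<close> reassembles the parts of \<open>x\<close> at the fixed
    indices, and the orbit lemma in the tensor product shows that their sum has the class of
    \<open>x\<close>. Membership in \<open>comp\<close> holds termwise.\<close>
  have F23: "F W \<in> GP.comp \<phi>" "Psi (F W) = BT.inj_comp \<phi> W" if W: "W \<in> carrier (BT.Bq \<phi>)" for W
  proof -
    from W obtain x where x: "x \<in> BT.Fix \<phi> P" "W = BT.cls \<phi> x" by (auto simp: BT.Bq_carrier)
    have xc: "x \<in> carrier TI" using x(1) BT.Fix_carrier by blast
    let ?S = "{y \<in> Yf. coord y x \<noteq> \<zero>\<^bsub>A\<^esub>}"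
    have Sfin: "finite ?S" using Yf(1) by (intro finite_subset[OF _ fin[OF xc]]) auto
    have FW: "F W = (\<Oplus>\<^bsub>GP.T\<^esub>y\<in>?S. F0 y x)"
      unfolding x(2) by (rule F_eq[OF x(1) Sfin]) auto
    show "F W \<in> GP.comp \<phi>"
      unfolding FW using F0_comp x(1)
      by (intro submodule_finsum[OF GP.T.module_axioms GP.comp_submodule[OF \<phi>K]]) auto
    have \<pi>F: "\<pi> y x \<in> BT.Fix \<phi> P" if "y \<in> Yf" for y
      unfolding \<pi>_def using t_Fix[OF \<phi> order_refl cF[OF that x(1)] Yf(3)[OF that]] .
    have "Psi (F W) = (\<Oplus>\<^bsub>BT.NB\<^esub>y\<in>?S. Psi (F0 y x))"
      unfolding FW using F0_closed[OF _ x(1)]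
      by (intro lin_hom_finsum[OF GP.T.module_axioms BT.NB_module Psi(1)]) auto
    also have "\<dots> = (\<Oplus>\<^bsub>BT.NB\<^esub>y\<in>?S. BT.inj_comp \<phi> (BT.cls \<phi> (\<pi> y x)))"
    proof (rule abelian_monoid.finsum_cong'[OF _ refl])
      show "abelian_monoid BT.NB"
        using BT.NB_module by (simp add: module_def abelian_group_def)
      show "(\<lambda>y. BT.inj_comp \<phi> (BT.cls \<phi> (\<pi> y x))) \<in> ?S \<rightarrow> carrier BT.NB"
        using \<pi>F \<phi>K by (auto intro!: BT.inj_comp_closed BT.cls_closed)
      show "Psi (F0 y x) = BT.inj_comp \<phi> (BT.cls \<phi> (\<pi> y x))" if "y \<in> ?S" for y
        using that cF[OF _ x(1)] Yf(3) unfolding F0_def \<pi>_def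
        by (simp add: Psi(2)[OF \<phi>K] B1.cls_closed B2.cls_closed tcls_cls[OF \<phi>])
    qed
    also have "\<dots> = BT.inj_comp \<phi> (\<Oplus>\<^bsub>BT.Bq \<phi>\<^esub>y\<in>?S. BT.cls \<phi> (\<pi> y x))"
      using \<pi>F
      by (intro lin_hom_finsum[OF BqT.module_axioms BT.NB_module BT.inj_comp_lin[OF \<phi>K], symmetric])
        (auto intro: BT.cls_closed)
    also have "(\<Oplus>\<^bsub>BT.Bq \<phi>\<^esub>y\<in>?S. BT.cls \<phi> (\<pi> y x)) = BT.cls \<phi> (\<Oplus>\<^bsub>TI\<^esub>y\<in>?S. \<pi> y x)"
      using \<pi>F by (intro BT.cls_finsum[OF \<phi>, symmetric]) auto
    also have "\<dots> = BT.cls \<phi> x"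
    proof (rule BT.cls_orbit_sum(2)[OF \<phi> x(1) _ _ _ _ _ \<pi>_fin[OF xc] \<pi>_sum[OF xc], where ya = ?ya, symmetric])
      show "?ya u y \<in> Y" if "u \<in> P" "y \<in> Y" for u y using ya(1)[OF that] .
      show "?ya (u \<otimes>\<^bsub>G\<^esub> v) y = ?ya v (?ya u y)" if "u \<in> P" "v \<in> P" "y \<in> Y" for u v y
        using ya(3)[OF that(1,3,2)] .
      show "?ya \<one>\<^bsub>G\<^esub> y = y" if "y \<in> Y" for y using ya(2)[OF B1.P.one_closed that] .
      show "\<pi> y x \<in> carrier TI" if "y \<in> Y" for y by (rule lin_hom_closed[OF \<pi>_lin[OF that] xc])
      show "\<pi> (?ya u y) x = BT.act \<phi> u (\<pi> y x)" if "u \<in> P" "y \<in> Y" for u y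
        using coord_act[OF that xc] BT.FixD(2)[OF \<phi> order_refl x(1) that(1)]
        by (simp add: \<pi>_def t_act[OF \<phi> that(1) cr(1)[OF xc] Y_carrier[OF that(2)]])
      show "{y \<in> Y. (\<forall>u\<in>P. ?ya u y = y) \<and> \<pi> y x \<noteq> \<zero>\<^bsub>TI\<^esub>} \<subseteq> ?S"
        using t0 by (auto simp: Yf_def \<pi>_def)
    qed (use Sfin in \<open>auto simp: Yf_def\<close>)
    finally show "Psi (F W) = BT.inj_comp \<phi> W" using x(2) by simp
  qed
  show thesis
    by (rule that[OF F_lin F1 F23])
qed

end

end

section \<open>Assembling the degrees: the isomorphism with the diagonal subalgebra\<close>

context brauer_pair begin

lemma gensE:
  assumes "x \<in> GP.gens"
  obtains \<phi> C D where "\<phi> \<in> K" "C \<in> carrier (B1.Bq \<phi>)" "D \<in> carrier (B2.Bq \<phi>)"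
    "x = GP.tau (B1.inj_comp \<phi> C) (B2.inj_comp \<phi> D)"
  using assms unfolding GP.gens_def by (auto simp: B1.homcomp_eq B2.homcomp_eq)

text \<open>\<open>Psi\<close> maps out of the diagonal, and the inverses of the single degrees,
  summed over the finite group \<open>K\<close>, give its inverse. Multiplicativity comes from
  \<open>tcls_mult\<close> on pure tensors of equal degree.\<close>

lemma tensor_N_bar_iso_diagonal:
  fixes Y :: "'b set"
  assumes "module_basis R B Y"
    and "\<And>u y. u \<in> P \<Longrightarrow> y \<in> Y \<Longrightarrow> gimage R B u \<otimes>\<^bsub>B\<^esub> y \<in> Y"
    and "\<And>u y. u \<in> P \<Longrightarrow> y \<in> Y \<Longrightarrow> y \<otimes>\<^bsub>B\<^esub> gimage R B u \<in> Y"
  shows "\<exists>F. F \<in> graded_interior_iso B1.k B1.NGK K BT.NB GP.Diag"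
proof (rule Psi_exists)
  fix Psi assume Psi: "Psi \<in> lin_hom B1.k GP.T BT.NB"
    "\<And>\<phi> C D. \<phi> \<in> K \<Longrightarrow> C \<in> carrier (B1.Bq \<phi>) \<Longrightarrow> D \<in> carrier (B2.Bq \<phi>) \<Longrightarrow>
      Psi (GP.tau (B1.inj_comp \<phi> C) (B2.inj_comp \<phi> D)) = BT.inj_comp \<phi> (tcls \<phi> C D)"
  \<comment> \<open>All properties are bundled into one predicate so that the inverses can be chosen
    simultaneously for all degrees.\<close>
  define Q where "Q \<phi> F \<longleftrightarrow> F \<in> lin_hom B1.k (BT.Bq \<phi>) GP.T \<and>
     (\<forall>C\<in>carrier (B1.Bq \<phi>). \<forall>D\<in>carrier (B2.Bq \<phi>).
        F (tcls \<phi> C D) = GP.tau (B1.inj_comp \<phi> C) (B2.inj_comp \<phi> D)) \<and>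
     (\<forall>W\<in>carrier (BT.Bq \<phi>). F W \<in> GP.comp \<phi> \<and> Psi (F W) = BT.inj_comp \<phi> W)" for \<phi> F
  have "\<exists>F. Q \<phi> F" if "\<phi> \<in> K" for \<phi>
    unfolding Q_def by (rule component_inverse[OF assms that Psi]) blast+
  then obtain F where "\<And>\<phi>. \<phi> \<in> K \<Longrightarrow> Q \<phi> (F \<phi>)"
    by metis
  then have F: "\<And>\<phi>. \<phi> \<in> K \<Longrightarrow> F \<phi> \<in> lin_hom B1.k (BT.Bq \<phi>) GP.T"
    "\<And>\<phi> C D. \<phi> \<in> K \<Longrightarrow> C \<in> carrier (B1.Bq \<phi>) \<Longrightarrow> D \<in> carrier (B2.Bq \<phi>) \<Longrightarrow>
        F \<phi> (tcls \<phi> C D) = GP.tau (B1.inj_comp \<phi> C) (B2.inj_comp \<phi> D)"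
    "\<And>\<phi> W. \<phi> \<in> K \<Longrightarrow> W \<in> carrier (BT.Bq \<phi>) \<Longrightarrow> F \<phi> W \<in> GP.comp \<phi>"
    "\<And>\<phi> W. \<phi> \<in> K \<Longrightarrow> W \<in> carrier (BT.Bq \<phi>) \<Longrightarrow> Psi (F \<phi> W) = BT.inj_comp \<phi> W"
    by (simp_all add: Q_def)
  \<comment> \<open>Written over the nonzero terms to match \<open>lin_hom_finsum_family\<close>;
    \<open>h'_eq\<close> returns to the sum over \<open>K\<close>.\<close>
  define h' where "h' f = (\<Oplus>\<^bsub>GP.T\<^esub>\<phi>\<in>{\<phi> \<in> K. F \<phi> (f \<phi>) \<noteq> \<zero>\<^bsub>GP.T\<^esub>}. F \<phi> (f \<phi>))" for f
  have Ff_closed: "F \<phi> (f \<phi>) \<in> carrier GP.T" if "\<phi> \<in> K" "f \<in> carrier BT.NB" for \<phi> f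
    using lin_hom_closed[OF F(1)[OF that(1)] BT.NB_app[OF that(2,1)]] .
  have h'_lin: "h' \<in> lin_hom B1.k BT.NB GP.T"
    unfolding h'_def using B1.finite_K
    by (intro lin_hom_finsum_family BT.NB_module GP.T.module_axioms lin_hom_comp[OF BT.NB_proj F(1)]) auto
  have h'_eq: "h' f = (\<Oplus>\<^bsub>GP.T\<^esub>\<phi>\<in>K. F \<phi> (f \<phi>))" if "f \<in> carrier BT.NB" for f
    unfolding h'_def using Ff_closed[OF _ that] B1.finite_K by (intro GP.T.finsum_superset) auto
  have tclosed: "tcls \<phi> C D \<in> carrier (BT.Bq \<phi>)" if "\<phi> \<in> K" "C \<in> carrier (B1.Bq \<phi>)" "D \<in> carrier (B2.Bq \<phi>)" for \<phi> C D
    using bilinD(3)[OF tcls_bilin[OF B1.K_H[OF that(1)]] that(2,3)] .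
  have h'_inj: "h' (BT.inj_comp \<phi> W) = F \<phi> W" if \<phi>: "\<phi> \<in> K" and W: "W \<in> carrier (BT.Bq \<phi>)" for \<phi> W
  proof -
    have "F \<psi> \<zero>\<^bsub>BT.Bq \<psi>\<^esub> = \<zero>\<^bsub>GP.T\<^esub>" if "\<psi> \<in> K" for \<psi>
      by (rule lin_hom_zero[OF BT.Bq_module'[OF that] GP.T.module_axioms F(1)[OF that]])
    then show ?thesis
      unfolding h'_eq[OF BT.inj_comp_closed[OF \<phi> W]] using \<phi> lin_hom_closed[OF F(1)[OF \<phi>] W] B1.finite_K
      by (subst GP.T.finsum_single[of K \<phi>]) (auto simp: BT.inj_comp_app)
  qed
  have "Psi \<in> graded_interior_iso B1.k B1.NGK K GP.Diag BT.NB"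
  proof (rule GP.diag_iso[OF BT.assoc_algebra_NB Psi(1) h'_lin _ _ _ _ _ _ _ _ BT.NB_structural])
    show "submodule (homcomp BT.NB \<phi>) B1.k BT.NB" if "\<phi> \<in> K" for \<phi>
      unfolding BT.homcomp_eq[OF that]
      by (rule submodule_image[OF BT.Bq_module'[OF that] BT.NB_module BT.inj_comp_lin[OF that]
            module.carrier_is_submodule[OF BT.Bq_module'[OF that]]])
    show "Psi (GP.tau c d) \<in> homcomp BT.NB \<phi>"
      if "\<phi> \<in> K" "c \<in> homcomp B1.NB \<phi>" "d \<in> homcomp B2.NB \<phi>" for \<phi> c d
      using that by (auto simp: B1.homcomp_eq B2.homcomp_eq BT.homcomp_eq Psi(2) tclosed)
    show "h' (Psi (GP.tau c d)) = GP.tau c d"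
      if "\<phi> \<in> K" "c \<in> homcomp B1.NB \<phi>" "d \<in> homcomp B2.NB \<phi>" for \<phi> c d
      using that by (auto simp: B1.homcomp_eq B2.homcomp_eq BT.homcomp_eq Psi(2) tclosed h'_inj F(2))
    show "h' w \<in> GP.comp \<phi>" if "\<phi> \<in> K" "w \<in> homcomp BT.NB \<phi>" for \<phi> w
      using that by (auto simp: BT.homcomp_eq h'_inj F(3))
    show "h' w \<in> GP.S" if "w \<in> carrier BT.NB" for w
      unfolding h'_eq[OF that] using F(3) BT.NB_app[OF that] GP.comp_subset_span
      by (intro submodule_finsum[OF GP.T.module_axioms GP.span_gens]) blast
    show "Psi (h' w) = w" if "w \<in> carrier BT.NB" for w
    proof -
      interpret NT: module B1.k BT.NB by (rule BT.NB_module)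
      have "Psi (h' w) = (\<Oplus>\<^bsub>BT.NB\<^esub>\<phi>\<in>K. Psi (F \<phi> (w \<phi>)))"
        unfolding h'_eq[OF that] using Ff_closed[OF _ that]
        by (intro lin_hom_finsum[OF GP.T.module_axioms BT.NB_module Psi(1)]) auto
      also have "\<dots> = (\<Oplus>\<^bsub>BT.NB\<^esub>\<phi>\<in>K. BT.inj_comp \<phi> (w \<phi>))"
        using BT.NB_app[OF that] F(4) by (intro NT.finsum_cong') (auto intro: BT.inj_comp_closed)
      finally show ?thesis using BT.NB_sum[OF that] by simp
    qed
    show "Psi (x \<otimes>\<^bsub>GP.T\<^esub> y) = Psi x \<otimes>\<^bsub>BT.NB\<^esub> Psi y" if "x \<in> GP.gens" "y \<in> GP.gens" for x y
    proof -
      from that(1) obtain \<phi> C D where x: "\<phi> \<in> K" "C \<in> carrier (B1.Bq \<phi>)" "D \<in> carrier (B2.Bq \<phi>)"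
        "x = GP.tau (B1.inj_comp \<phi> C) (B2.inj_comp \<phi> D)" by (rule gensE)
      from that(2) obtain \<psi> C' D' where y: "\<psi> \<in> K" "C' \<in> carrier (B1.Bq \<psi>)" "D' \<in> carrier (B2.Bq \<psi>)"
        "y = GP.tau (B1.inj_comp \<psi> C') (B2.inj_comp \<psi> D')" by (rule gensE)
      show ?thesis
        using x y bilinD(3)[OF B1.m_bilin[OF x(1) y(1)] x(2) y(2)] bilinD(3)[OF B2.m_bilin[OF x(1) y(1)] x(3) y(3)]
        by (simp add: GP.tau_mult B1.inj_comp_closed B2.inj_comp_closed B1.inj_comp_mult B2.inj_comp_mult
            Psi(2) B1.K.m_closed tcls_mult)
    qed
    show "Psi \<one>\<^bsub>GP.T\<^esub> = \<one>\<^bsub>BT.NB\<^esub>"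
      unfolding pure_tensor_one[OF GP.alg, symmetric] B1.NB_one B2.NB_one BT.NB_one
      using B1.one_Fix B2.one_Fix
      by (simp add: Psi(2) B1.K.one_closed B1.cls_closed B2.cls_closed tcls_cls TI_simps pure_tensor_one[OF alg])
    show "Psi (GP.tau (gimage B1.k B1.NB x) (gimage B1.k B2.NB x)) =
        BT.inj_comp (conj_aut G P x) (BT.cls (conj_aut G P x) (BT.g x))" if "x \<in> carrier B1.NGK" for x
      using B1.NGK_D[OF that] B2.NGK_D(3)[OF that] B1.K_H
      by (simp add: B1.gimage_NB[OF that] B2.gimage_NB[OF that] Psi(2) B1.cls_closed B2.cls_closed tcls_cls
          gimage_tensor_interior[OF B1.interior B2.interior])
  qed
  from GP.diag_iso_inv[OF this] show ?thesis by blast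
qed

section \<open>The case in which the first graded algebra is A(P) \<otimes> kK\<close>

abbreviation AP where "AP \<equiv> B1.Bq \<one>\<^bsub>B1.H\<^esub>"
abbreviation MK where "MK \<equiv> monoid_algebra B1.k (B1.H\<lparr>carrier := K\<rparr>)"
abbreviation KK where "KK \<equiv> K_algebra B1.k G P K"

text \<open>An element of degree \<phi> is the preimage under \<open>F\<close> of some a \<otimes>
  \<phi>, and this \<open>a\<close> should replace it. To get linear maps on whole tensor products,
  \<open>a\<close> is read off by a coefficient map, and a sum over all degrees lets the second
  factor select the right one.\<close>

lemma diagonal_iso_tensor:
  assumes \<sigma>: "\<sigma> \<in> hom B1.NGK (units_of AP)"
    and F: "F \<in> graded_interior_iso B1.k B1.NGK K B1.NB (tensor_graded_interior B1.k AP \<sigma> KK)"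
  shows "\<exists>F. F \<in> graded_interior_iso B1.k B1.NGK K GP.Diag (tensor_graded_interior B1.k AP \<sigma> B2.NB)"
proof -
  note k_comm = comm_monoid.m_comm[OF cring.axioms(2)[OF B1.k_cring]]
  note k_one = monoid.one_closed[OF ring.is_monoid[OF cring.axioms(1)[OF B1.k_cring]]]
  interpret AP: assoc_algebra B1.k AP by (rule B1.assoc_algebra_Bq_one)
  have monK: "Group.monoid (B1.H\<lparr>carrier := K\<rparr>)"
    by (rule group.is_monoid[OF B1.K.subgroup_is_group[OF B1.H.group_axioms]])
  note MK_alg = assoc_algebra_monoid_algebra[OF B1.k_cring monK]
  interpret MK: assoc_algebra B1.k MK by (rule MK_alg)
  have KK_eq: "KK = make_graded_interior B1.k MK (\<lambda>x. single B1.k (conj_aut G P x))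
      (\<lambda>\<phi>. {c \<odot>\<^bsub>MK\<^esub> single B1.k \<phi> | c. c \<in> carrier B1.k})"
    by (simp add: K_algebra_def Let_def)
  have KK_alg: "assoc_algebra B1.k KK"
    unfolding KK_eq by (rule assoc_algebra_make_graded_interior[OF MK_alg(1)])
  let ?t1 = "pure_tensor B1.k AP KK" and ?T1 = "tensor B1.k AP KK"
  let ?t2 = "pure_tensor B1.k AP B2.NB" and ?T2 = "tensor B1.k AP B2.NB"
  let ?e = "\<lambda>\<phi>. single B1.k \<phi>"
  note alg1 = B1.assoc_algebra_Bq_one KK_alg
  note alg2 = B1.assoc_algebra_Bq_one B2.assoc_algebra_NB
  interpret T1: assoc_algebra B1.k ?T1 by (rule assoc_algebra_tensor[OF alg1])
  interpret T2: assoc_algebra B1.k ?T2 by (rule assoc_algebra_tensor[OF alg2])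
  note t1b = pure_tensor_bilin[OF alg1] and t2b = pure_tensor_bilin[OF alg2]
  have e_MK: "?e \<phi> \<in> carrier MK" if "\<phi> \<in> K" for \<phi>
    using that by (simp add: cring.single_finsupp[OF B1.k_cring])
  have e_KK: "?e \<phi> \<in> carrier KK" if "\<phi> \<in> K" for \<phi>
    using e_MK[OF that] by (simp add: KK_eq)
  have e_mult: "?e \<phi> \<otimes>\<^bsub>KK\<^esub> ?e \<psi> = ?e (\<phi> \<otimes>\<^bsub>B1.H\<^esub> \<psi>)" if "\<phi> \<in> K" "\<psi> \<in> K" for \<phi> \<psi>
    using MK_alg(2)[of \<phi> \<psi>] that by (simp add: KK_eq)
  note Fp = graded_interior_isoD[OF F]
  have W_simps: "carrier (tensor_graded_interior B1.k AP \<sigma> KK) = carrier ?T1"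
    "lin_hom B1.k M (tensor_graded_interior B1.k AP \<sigma> KK) = lin_hom B1.k M ?T1"
    "homcomp (tensor_graded_interior B1.k AP \<sigma> KK) \<phi> =
      submodule_span B1.k ?T1 {?t1 b d | b d. b \<in> carrier AP \<and> d \<in> homcomp KK \<phi>}" for M \<phi>
    by (simp_all add: tensor_graded_interior_def lin_hom_make_graded_interior)
  have F_lin: "F \<in> lin_hom B1.k B1.NB ?T1"
    using Fp(6) by (simp add: W_simps)
  have F_bij: "bij_betw F (carrier B1.NB) (carrier ?T1)"
    using Fp(3) by (simp add: W_simps)
  have F_mult: "F (x \<otimes>\<^bsub>B1.NB\<^esub> y) = F x \<otimes>\<^bsub>?T1\<^esub> F y" if "x \<in> carrier B1.NB" "y \<in> carrier B1.NB" for x y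
    using ring_hom_mult[OF Fp(2) that] by (simp add: tensor_graded_interior_def)
  define Fi where "Fi = inv_into (carrier B1.NB) F"
  have FiF: "Fi (F c) = c" if "c \<in> carrier B1.NB" for c
    unfolding Fi_def using F_bij that by (intro inv_into_f_f) (auto simp: bij_betw_def)
  have FFi: "F (Fi w) = w" "Fi w \<in> carrier B1.NB" if "w \<in> carrier ?T1" for w
    unfolding Fi_def using F_bij that f_inv_into_f[of w F "carrier B1.NB"] inv_into_into[of w F "carrier B1.NB"]
    by (simp_all add: bij_betw_def)
  have Fi_lin: "Fi \<in> lin_hom B1.k ?T1 B1.NB"
  proof (rule lin_homI)
    interpret N1: module B1.k B1.NB by (rule B1.NB_module)
    show "Fi w \<in> carrier B1.NB" if "w \<in> carrier ?T1" for w by (rule FFi(2)[OF that])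
    show "Fi (v \<oplus>\<^bsub>?T1\<^esub> w) = Fi v \<oplus>\<^bsub>B1.NB\<^esub> Fi w" if "v \<in> carrier ?T1" "w \<in> carrier ?T1" for v w
      using FiF[of "Fi v \<oplus>\<^bsub>B1.NB\<^esub> Fi w"] that FFi lin_hom_add[OF F_lin, of "Fi v" "Fi w"] by simp
    show "Fi (r \<odot>\<^bsub>?T1\<^esub> w) = r \<odot>\<^bsub>B1.NB\<^esub> Fi w" if "r \<in> carrier B1.k" "w \<in> carrier ?T1" for r w
      using FiF[of "r \<odot>\<^bsub>B1.NB\<^esub> Fi w"] that FFi lin_hom_smult[OF F_lin, of r "Fi w"] by simp
  qed
  have te_lin: "(\<lambda>a. ?t1 a (?e \<phi>)) \<in> lin_hom B1.k AP ?T1" if "\<phi> \<in> K" for \<phi>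
    by (rule bilinD(2)[OF t1b e_KK[OF that]])
  \<comment> \<open>Scalars of kK move into the first factor, so an element of degree \<phi> in A(P)
    \<otimes> kK is one pure tensor and not merely a sum of them.\<close>
  have F_form: "\<exists>a\<in>carrier AP. F c = ?t1 a (?e \<phi>)" if \<phi>: "\<phi> \<in> K" and c: "c \<in> homcomp B1.NB \<phi>" for \<phi> c
  proof -
    have sub: "submodule ((\<lambda>a. ?t1 a (?e \<phi>)) ` carrier AP) B1.k ?T1"
      by (rule submodule_image[OF AP.module_axioms T1.module_axioms te_lin[OF \<phi>] AP.carrier_is_submodule])
    have "?t1 b d \<in> (\<lambda>a. ?t1 a (?e \<phi>)) ` carrier AP" if b: "b \<in> carrier AP" and d: "d \<in> homcomp KK \<phi>" for b d
    proof -
      from d obtain r where r: "r \<in> carrier B1.k" "d = r \<odot>\<^bsub>KK\<^esub> ?e \<phi>" by (auto simp: KK_eq)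
      then have "?t1 b d = ?t1 (r \<odot>\<^bsub>AP\<^esub> b) (?e \<phi>)"
        using lin_hom_smult[OF bilinD(1)[OF t1b b] r(1) e_KK[OF \<phi>]] lin_hom_smult[OF te_lin[OF \<phi>] r(1) b] by simp
      then show ?thesis using AP.smult_closed[OF r(1) b] by blast
    qed
    then have "homcomp (tensor_graded_interior B1.k AP \<sigma> KK) \<phi> \<subseteq> (\<lambda>a. ?t1 a (?e \<phi>)) ` carrier AP"
      unfolding W_simps by (intro submodule_span_minimal[OF sub]) blast
    then show ?thesis
      using Fp(4)[OF \<phi>] c by blast
  qed
  \<comment> \<open>The grading condition on \<open>F\<close> is an equality of images, so the
    preimage can be found inside degree \<phi>; injectivity shows that it is the value of
    \<open>Fi\<close>.\<close>
  have Fi_homcomp: "Fi (?t1 a (?e \<phi>)) \<in> homcomp B1.NB \<phi>" if \<phi>: "\<phi> \<in> K" and a: "a \<in> carrier AP" for \<phi> a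
  proof -
    have "?e \<phi> = \<one>\<^bsub>B1.k\<^esub> \<odot>\<^bsub>MK\<^esub> ?e \<phi>"
      by (rule MK.smult_one[OF e_MK[OF \<phi>], symmetric])
    then have "?e \<phi> \<in> homcomp KK \<phi>"
      unfolding KK_eq using k_one by auto
    then have "?t1 a (?e \<phi>) \<in> homcomp (tensor_graded_interior B1.k AP \<sigma> KK) \<phi>"
      unfolding W_simps using a by (intro subsetD[OF submodule_span_superset]) blast
    then obtain c where c: "c \<in> homcomp B1.NB \<phi>" "F c = ?t1 a (?e \<phi>)"
      unfolding Fp(4)[OF \<phi>, symmetric] by force
    then show ?thesis
      using FiF[of c] gp1(1) by auto
  qed
  \<comment> \<open>The coefficient at \<phi>, as a linear map from A(P) \<otimes> kK to
    A(P).\<close>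
  have "\<exists>\<rho>. \<rho> \<in> lin_hom B1.k ?T1 AP \<and> (\<forall>a\<in>carrier AP. \<forall>f\<in>carrier KK. \<rho> (?t1 a f) = f \<phi> \<odot>\<^bsub>AP\<^esub> a)" for \<phi>
  proof (rule tensor_lift[OF alg1 AP.module_axioms])
    show "(\<lambda>a f. f \<phi> \<odot>\<^bsub>AP\<^esub> a) \<in> bilin B1.k AP KK AP"
      by (rule bilinI)
        (simp_all add: KK_eq finsuppD(1) AP.smult_l_distr AP.smult_r_distr AP.smult_assoc1
          flip: AP.smult_assoc1 add: k_comm)
  qed blast
  then obtain \<rho> where \<rho>: "\<And>\<phi>. \<rho> \<phi> \<in> lin_hom B1.k ?T1 AP"
    "\<And>\<phi> a f. a \<in> carrier AP \<Longrightarrow> f \<in> carrier KK \<Longrightarrow> \<rho> \<phi> (?t1 a f) = f \<phi> \<odot>\<^bsub>AP\<^esub> a"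
    by metis
  have \<rho>_e: "\<rho> \<phi> (?t1 a (?e \<phi>)) = a" if "\<phi> \<in> K" "a \<in> carrier AP" for \<phi> a
    using that e_KK by (simp add: \<rho>(2) single_def)
  have e2p: "(\<lambda>d. B2.inj_comp \<phi> (d \<phi>)) \<in> lin_hom B1.k B2.NB B2.NB" if "\<phi> \<in> K" for \<phi>
    by (rule lin_hom_comp[OF B2.NB_proj[OF that] B2.inj_comp_lin[OF that]])
  have e2d: "B2.inj_comp \<psi> (d \<psi>) = (if \<psi> = \<phi> then d else \<zero>\<^bsub>B2.NB\<^esub>)"
    if "\<phi> \<in> K" "\<psi> \<in> K" "d \<in> homcomp B2.NB \<phi>" for \<phi> \<psi> d
  proof -
    from that obtain D where D: "D \<in> carrier (B2.Bq \<phi>)" "d = B2.inj_comp \<phi> D" by (auto simp: B2.homcomp_eq)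
    show ?thesis
      using that(1,2) D lin_hom_zero[OF B2.Bq_module'[OF that(2)] B2.NB_module B2.inj_comp_lin[OF that(2)]]
      by (auto simp: B2.inj_comp_app)
  qed
  have comp_bilin: "(\<lambda>c d. \<beta> (f c) (h d)) \<in> bilin B1.k C D M"
    if "f \<in> lin_hom B1.k C C'" "h \<in> lin_hom B1.k D D'" "\<beta> \<in> bilin B1.k C' D' M"
    for f h \<beta> and C :: "('r set, 'x, 'y) module_scheme" and D :: "('r set, 'z, 'w) module_scheme"
      and C' :: "('r set, 'u, 'v) module_scheme" and D' :: "('r set, 's, 'q) module_scheme"
      and M :: "('r set, 'o, 'l) module_scheme"
    using lin_hom_comp[OF that(1) bilinD(2)[OF that(3)]] lin_hom_comp[OF that(2) bilinD(1)[OF that(3)]]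
      lin_hom_closed[OF that(1)] lin_hom_closed[OF that(2)] by (auto simp: bilin_def)
  \<comment> \<open>The component of \<open>d\<close> in degree \<phi> is tensored with the
    coefficient of \<open>F c\<close> at \<phi>. When \<open>c\<close> and \<open>d\<close> have the
    same degree, a single term survives.\<close>
  have b1: "(\<lambda>c d. \<Oplus>\<^bsub>?T2\<^esub>\<phi>\<in>K. ?t2 (\<rho> \<phi> (F c)) (B2.inj_comp \<phi> (d \<phi>))) \<in> bilin B1.k B1.NB B2.NB ?T2"
    by (intro bilin_finsum T2.module_axioms B1.finite_K comp_bilin[OF lin_hom_comp[OF F_lin \<rho>(1)] e2p t2b])
  \<comment> \<open>In the other direction the component of \<open>d\<close> decides in which degree
    the preimage under \<open>F\<close> is taken.\<close>
  have b2: "(\<lambda>a d. \<Oplus>\<^bsub>GP.T\<^esub>\<phi>\<in>K. GP.tau (Fi (?t1 a (?e \<phi>))) (B2.inj_comp \<phi> (d \<phi>))) \<in> bilin B1.k AP B2.NB GP.T"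
    by (intro bilin_finsum GP.T.module_axioms B1.finite_K
        comp_bilin[OF lin_hom_comp[OF te_lin Fi_lin] e2p GP.tau_bilin])
  show ?thesis
  proof (rule tensor_lift[OF GP.alg T2.module_axioms b1], rule tensor_lift[OF alg2 GP.T.module_axioms b2])
    fix h h'
    assume h: "h \<in> lin_hom B1.k GP.T ?T2"
      "\<And>c d. c \<in> carrier B1.NB \<Longrightarrow> d \<in> carrier B2.NB \<Longrightarrow>
        h (GP.tau c d) = (\<Oplus>\<^bsub>?T2\<^esub>\<phi>\<in>K. ?t2 (\<rho> \<phi> (F c)) (B2.inj_comp \<phi> (d \<phi>)))"
      and h': "h' \<in> lin_hom B1.k ?T2 GP.T"
      "\<And>a d. a \<in> carrier AP \<Longrightarrow> d \<in> carrier B2.NB \<Longrightarrow>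
        h' (?t2 a d) = (\<Oplus>\<^bsub>GP.T\<^esub>\<phi>\<in>K. GP.tau (Fi (?t1 a (?e \<phi>))) (B2.inj_comp \<phi> (d \<phi>)))"
    note t2c = bilinD(3)[OF t2b]
    have t2z: "?t2 a \<zero>\<^bsub>B2.NB\<^esub> = \<zero>\<^bsub>?T2\<^esub>" if "a \<in> carrier AP" for a
      by (rule lin_hom_zero[OF B2.NB_module T2.module_axioms bilinD(1)[OF t2b that]])
    have tauz: "GP.tau c \<zero>\<^bsub>B2.NB\<^esub> = \<zero>\<^bsub>GP.T\<^esub>" if "c \<in> carrier B1.NB" for c
      by (rule lin_hom_zero[OF B2.NB_module GP.T.module_axioms bilinD(1)[OF GP.tau_bilin that]])
    have key: "h (GP.tau c d) = ?t2 a d"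
      if \<phi>: "\<phi> \<in> K" and c: "c \<in> homcomp B1.NB \<phi>" and d: "d \<in> homcomp B2.NB \<phi>"
        and a: "a \<in> carrier AP" and Fc: "F c = ?t1 a (?e \<phi>)" for \<phi> c d a
    proof -
      have car: "c \<in> carrier B1.NB" "d \<in> carrier B2.NB" using c d gp1(1) gp2(1) by blast+
      have "h (GP.tau c d) = (\<Oplus>\<^bsub>?T2\<^esub>\<psi>\<in>K. ?t2 (\<rho> \<psi> (F c)) (B2.inj_comp \<psi> (d \<psi>)))"
        by (rule h(2)[OF car])
      also have "\<dots> = ?t2 (\<rho> \<phi> (F c)) (B2.inj_comp \<phi> (d \<phi>))"
        using \<phi> a car t2c by (intro T2.finsum_single B1.finite_K)
          (auto simp: e2d[OF \<phi> _ d] Fc \<rho>_e intro!: t2z lin_hom_closed[OF \<rho>(1)] bilinD(3)[OF t1b] e_KK)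
      also have "\<dots> = ?t2 a d"
        using \<phi> a by (simp add: Fc \<rho>_e e2d[OF \<phi> \<phi> d])
      finally show ?thesis .
    qed
    have key': "h' (?t2 a d) = GP.tau (Fi (?t1 a (?e \<phi>))) d"
      if \<phi>: "\<phi> \<in> K" and a: "a \<in> carrier AP" and d: "d \<in> homcomp B2.NB \<phi>" for \<phi> a d
    proof -
      have car: "d \<in> carrier B2.NB" using d gp2(1) by blast
      have Fic: "Fi (?t1 a (?e \<psi>)) \<in> carrier B1.NB" if "\<psi> \<in> K" for \<psi>
        by (rule FFi(2)[OF bilinD(3)[OF t1b a e_KK[OF that]]])
      have "h' (?t2 a d) = (\<Oplus>\<^bsub>GP.T\<^esub>\<psi>\<in>K. GP.tau (Fi (?t1 a (?e \<psi>))) (B2.inj_comp \<psi> (d \<psi>)))"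
        by (rule h'(2)[OF a car])
      also have "\<dots> = GP.tau (Fi (?t1 a (?e \<phi>))) (B2.inj_comp \<phi> (d \<phi>))"
        using \<phi> Fic car by (intro GP.T.finsum_single B1.finite_K)
          (auto simp: e2d[OF \<phi> _ d] tauz intro!: GP.tau_closed)
      finally show ?thesis
        by (simp add: e2d[OF \<phi> \<phi> d])
    qed
    let ?D = "\<lambda>\<phi>. submodule_span B1.k ?T2 {?t2 b d | b d. b \<in> carrier AP \<and> d \<in> homcomp B2.NB \<phi>}"
    let ?s = "\<lambda>x. ?t2 (\<sigma> x) (gimage B1.k B2.NB x)"
    define E where "E = tensor_graded_interior B1.k AP \<sigma> B2.NB"
    have E: "E = make_graded_interior B1.k ?T2 ?s ?D"
      by (simp add: E_def tensor_graded_interior_def)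
    have E_lin: "lin_hom B1.k M E = lin_hom B1.k M ?T2" "lin_hom B1.k E M = lin_hom B1.k ?T2 M" for M
      by (simp_all add: E lin_hom_make_graded_interior)
    have gen_sub: "{?t2 b d | b d. b \<in> carrier AP \<and> d \<in> homcomp B2.NB \<phi>} \<subseteq> carrier ?T2" for \<phi>
      using gp2(1) t2c by blast
    note T2_span = pure_tensor_span[OF alg2]
    have "h \<in> graded_interior_iso B1.k B1.NGK K GP.Diag E"
    proof (rule GP.diag_iso)
      show "assoc_algebra B1.k E"
        unfolding E by (rule assoc_algebra_make_graded_interior[OF T2.assoc_algebra_axioms])
      show "h \<in> lin_hom B1.k GP.T E" "h' \<in> lin_hom B1.k E GP.T"
        using h(1) h'(1) by (simp_all add: E_lin)
      show "submodule (homcomp E \<phi>) B1.k E" for \<phi>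
        unfolding E
        by (simp, intro submodule_make_graded_interior T2.assoc_algebra_axioms
            submodule_span_submodule T2.module_axioms gen_sub)
      show "h (GP.tau c d) \<in> homcomp E \<phi>"
        if "\<phi> \<in> K" "c \<in> homcomp B1.NB \<phi>" "d \<in> homcomp B2.NB \<phi>" for \<phi> c d
      proof -
        from F_form[OF that(1,2)] obtain a where "a \<in> carrier AP" "F c = ?t1 a (?e \<phi>)" by blast
        with key[OF that] have "h (GP.tau c d) = ?t2 a d" "a \<in> carrier AP" by auto
        with that(3) show ?thesis
          unfolding E make_graded_interior_simps by (intro subsetD[OF submodule_span_superset]) auto
      qed
      show "h' (h (GP.tau c d)) = GP.tau c d"
        if "\<phi> \<in> K" "c \<in> homcomp B1.NB \<phi>" "d \<in> homcomp B2.NB \<phi>" for \<phi> c d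
      proof -
        from F_form[OF that(1,2)] obtain a where a: "a \<in> carrier AP" "F c = ?t1 a (?e \<phi>)" by blast
        have "c \<in> carrier B1.NB" using that(2) gp1(1) by blast
        then show ?thesis
          using key[OF that a] key'[OF that(1) a(1) that(3)] FiF[of c] a(2) by simp
      qed
      show "h' w \<in> GP.comp \<phi>" if \<phi>: "\<phi> \<in> K" and w: "w \<in> homcomp E \<phi>" for \<phi> w
      proof (rule lin_hom_span_image[OF T2.module_axioms GP.T.module_axioms h'(1) gen_sub GP.comp_submodule[OF \<phi>]])
        show "w \<in> ?D \<phi>" using w by (simp add: E)
        show "h' x \<in> GP.comp \<phi>" if "x \<in> {?t2 b d | b d. b \<in> carrier AP \<and> d \<in> homcomp B2.NB \<phi>}" for x
        proof -
          from that obtain b d where bd: "x = ?t2 b d" "b \<in> carrier AP" "d \<in> homcomp B2.NB \<phi>" by blast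
          show ?thesis
            using GP.comp_mem[OF Fi_homcomp[OF \<phi> bd(2)] bd(3)] key'[OF \<phi> bd(2,3)] bd(1) by simp
        qed
      qed
      \<comment> \<open>A general \<open>d\<close> has several components while \<open>key\<close>
        and \<open>key'\<close> concern a single degree, so \<open>d\<close> is first split into
        homogeneous terms.\<close>
      have h'_sum: "h' (?t2 a d) = (\<Oplus>\<^bsub>GP.T\<^esub>\<phi>\<in>K. h' (?t2 a (B2.inj_comp \<phi> (d \<phi>))))"
        "?t2 a d = (\<Oplus>\<^bsub>?T2\<^esub>\<phi>\<in>K. ?t2 a (B2.inj_comp \<phi> (d \<phi>)))"
        if a: "a \<in> carrier AP" and d: "d \<in> carrier B2.NB" for a d
      proof -
        have c: "(\<lambda>\<phi>. B2.inj_comp \<phi> (d \<phi>)) \<in> K \<rightarrow> carrier B2.NB"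
          using d by (auto intro: B2.inj_comp_closed B2.NB_app)
        show eq: "?t2 a d = (\<Oplus>\<^bsub>?T2\<^esub>\<phi>\<in>K. ?t2 a (B2.inj_comp \<phi> (d \<phi>)))"
          using lin_hom_finsum[OF B2.NB_module T2.module_axioms bilinD(1)[OF t2b a] c] B2.NB_sum[OF d] by simp
        show "h' (?t2 a d) = (\<Oplus>\<^bsub>GP.T\<^esub>\<phi>\<in>K. h' (?t2 a (B2.inj_comp \<phi> (d \<phi>))))"
          by (subst eq, rule lin_hom_finsum[OF T2.module_axioms GP.T.module_axioms h'(1)]) (use c t2c[OF a] in auto)
      qed
      have hc: "B2.inj_comp \<phi> (d \<phi>) \<in> homcomp B2.NB \<phi>" if "\<phi> \<in> K" "d \<in> carrier B2.NB" for \<phi> d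
        using that by (auto simp: B2.homcomp_eq intro: B2.NB_app)
      have h'_term: "h' (?t2 a (B2.inj_comp \<phi> (d \<phi>))) \<in> GP.comp \<phi>"
        "h (h' (?t2 a (B2.inj_comp \<phi> (d \<phi>)))) = ?t2 a (B2.inj_comp \<phi> (d \<phi>))"
        if \<phi>: "\<phi> \<in> K" and a: "a \<in> carrier AP" and d: "d \<in> carrier B2.NB" for a d \<phi>
        using key'[OF \<phi> a hc[OF \<phi> d]] GP.comp_mem[OF Fi_homcomp[OF \<phi> a] hc[OF \<phi> d]]
          key[OF \<phi> Fi_homcomp[OF \<phi> a] hc[OF \<phi> d] a] FFi(1)[OF bilinD(3)[OF t1b a e_KK[OF \<phi>]]] by auto
      show "h' w \<in> GP.S" if "w \<in> carrier E" for w
      proof (rule lin_hom_span_image[OF T2.module_axioms GP.T.module_axioms h'(1) _ GP.span_gens])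
        show "w \<in> submodule_span B1.k ?T2 {?t2 a d | a d. a \<in> carrier AP \<and> d \<in> carrier B2.NB}"
          unfolding T2_span using that by (simp add: E)
        show "{?t2 a d | a d. a \<in> carrier AP \<and> d \<in> carrier B2.NB} \<subseteq> carrier ?T2" using t2c by blast
        fix x assume "x \<in> {?t2 a d | a d. a \<in> carrier AP \<and> d \<in> carrier B2.NB}"
        then obtain a d where ad: "a \<in> carrier AP" "d \<in> carrier B2.NB" "x = ?t2 a d" by blast
        show "h' x \<in> GP.S"
          unfolding ad(3) h'_sum(1)[OF ad(1,2)] using h'_term(1)[OF _ ad(1,2)] GP.comp_subset_span
          by (intro submodule_finsum[OF GP.T.module_axioms GP.span_gens]) blast
      qed
      show "h (h' w) = w" if "w \<in> carrier E" for w
      proof (rule lin_hom_eq_on_span[OF T2.module_axioms T2.module_axioms lin_hom_comp[OF h'(1) h(1)]])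
        show "(\<lambda>x. x) \<in> lin_hom B1.k ?T2 ?T2" by (rule lin_homI) auto
        show "w \<in> submodule_span B1.k ?T2 {?t2 a d | a d. a \<in> carrier AP \<and> d \<in> carrier B2.NB}"
          unfolding T2_span using that by (simp add: E)
        show "{?t2 a d | a d. a \<in> carrier AP \<and> d \<in> carrier B2.NB} \<subseteq> carrier ?T2" using t2c by blast
        fix x assume "x \<in> {?t2 a d | a d. a \<in> carrier AP \<and> d \<in> carrier B2.NB}"
        then obtain a d where ad: "a \<in> carrier AP" "d \<in> carrier B2.NB" "x = ?t2 a d" by blast
        have comp_T: "y \<in> carrier GP.T" if "\<phi> \<in> K" "y \<in> GP.comp \<phi>" for \<phi> y
          using submodule_subset[OF GP.comp_submodule[OF that(1)]] that(2) by blast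
        have "h (h' x) = (\<Oplus>\<^bsub>?T2\<^esub>\<phi>\<in>K. h (h' (?t2 a (B2.inj_comp \<phi> (d \<phi>)))))"
          unfolding ad(3) h'_sum(1)[OF ad(1,2)] using h'_term(1)[OF _ ad(1,2)] comp_T
          by (intro lin_hom_finsum[OF GP.T.module_axioms T2.module_axioms h(1)]) blast
        also have "\<dots> = (\<Oplus>\<^bsub>?T2\<^esub>\<phi>\<in>K. ?t2 a (B2.inj_comp \<phi> (d \<phi>)))"
          using h'_term(2)[OF _ ad(1,2)] t2c[OF ad(1) subsetD[OF gp2(1) hc[OF _ ad(2)]]]
          by (intro T2.finsum_cong') auto
        finally show "h (h' x) = x"
          using h'_sum(2)[OF ad(1,2)] ad(3) by simp
      qed
      show "h (x \<otimes>\<^bsub>GP.T\<^esub> y) = h x \<otimes>\<^bsub>E\<^esub> h y" if "x \<in> GP.gens" "y \<in> GP.gens" for x y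
      proof -
        from that obtain \<phi> c d \<psi> c' d' where *: "\<phi> \<in> K" "c \<in> homcomp B1.NB \<phi>" "d \<in> homcomp B2.NB \<phi>" "x = GP.tau c d"
          "\<psi> \<in> K" "c' \<in> homcomp B1.NB \<psi>" "d' \<in> homcomp B2.NB \<psi>" "y = GP.tau c' d'"
          unfolding GP.gens_def by blast
        from F_form[OF *(1,2)] obtain a where a: "a \<in> carrier AP" "F c = ?t1 a (?e \<phi>)" by blast
        from F_form[OF *(5,6)] obtain a' where a': "a' \<in> carrier AP" "F c' = ?t1 a' (?e \<psi>)" by blast
        have car: "c \<in> carrier B1.NB" "c' \<in> carrier B1.NB" "d \<in> carrier B2.NB" "d' \<in> carrier B2.NB"
          using * gp1(1) gp2(1) by blast+
        \<comment> \<open>In A(P) \<otimes> kK the degrees multiply in the second factor, so the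
          element of A(P) belonging to a product is the product of the elements belonging to its
          factors.\<close>
        have "F (c \<otimes>\<^bsub>B1.NB\<^esub> c') = ?t1 (a \<otimes>\<^bsub>AP\<^esub> a') (?e (\<phi> \<otimes>\<^bsub>B1.H\<^esub> \<psi>))"
          using car a a' *(1,5) by (simp add: F_mult pure_tensor_mult[OF alg1] e_KK e_mult)
        from key[OF B1.K.m_closed[OF *(1,5)] gp1(2)[OF *(1,5,2,6)] gp2(2)[OF *(1,5,3,7)] AP.m_closed[OF a(1) a'(1)] this]
        have "h (x \<otimes>\<^bsub>GP.T\<^esub> y) = ?t2 (a \<otimes>\<^bsub>AP\<^esub> a') (d \<otimes>\<^bsub>B2.NB\<^esub> d')"
          using car *(4,8) by (simp add: GP.tau_mult)
        also have "\<dots> = h x \<otimes>\<^bsub>E\<^esub> h y"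
          using key[OF *(1-3) a] key[OF *(5-7) a'] *(4,8) a(1) a'(1) car by (simp add: E pure_tensor_mult[OF alg2])
        finally show ?thesis .
      qed
      show "h \<one>\<^bsub>GP.T\<^esub> = \<one>\<^bsub>E\<^esub>"
      proof -
        have "F \<one>\<^bsub>B1.NB\<^esub> = \<one>\<^bsub>?T1\<^esub>"
          using ring_hom_one[OF Fp(2)] by (simp add: tensor_graded_interior_def)
        also have "\<dots> = ?t1 \<one>\<^bsub>AP\<^esub> (?e \<one>\<^bsub>B1.H\<^esub>)"
        proof -
          have "\<one>\<^bsub>KK\<^esub> = ?e \<one>\<^bsub>B1.H\<^esub>" by (simp add: KK_eq)
          then show ?thesis using pure_tensor_one[OF alg1] by simp
        qed
        finally have "h (GP.tau \<one>\<^bsub>B1.NB\<^esub> \<one>\<^bsub>B2.NB\<^esub>) = ?t2 \<one>\<^bsub>AP\<^esub> \<one>\<^bsub>B2.NB\<^esub>"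
          by (intro key[OF B1.K.one_closed gp1(3) gp2(3) AP.one_closed])
        then show ?thesis
          by (simp add: pure_tensor_one[OF GP.alg] pure_tensor_one[OF alg2] E)
      qed
      show "structural E = lin_ext B1.k E ?s"
        unfolding E by (simp add: lin_ext_make_graded_interior)
      show "h (GP.tau (gimage B1.k B1.NB x) (gimage B1.k B2.NB x)) = ?s x" if x: "x \<in> carrier B1.NGK" for x
      proof -
        note conjK = B1.NGK_D(2)[OF x]
        have \<sigma>x: "\<sigma> x \<in> carrier AP"
          using \<sigma> x by (auto simp: hom_def units_of_def Units_def)
        have gK: "gimage B1.k KK x = ?e (conj_aut G P x)"
          unfolding KK_eq by (intro gimage_make_graded_interior MK.module_axioms e_MK conjK)
        \<comment> \<open>\<open>F\<close> respects the structural maps, so the image of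
          \<open>x\<close> has the form \<sigma>(x) \<otimes> \<phi>_x. Feeding this to
          \<open>key\<close> gives \<sigma>(x) \<otimes> x, the interior structure of the
          target.\<close>
        have "F (gimage B1.k B1.NB x) = gimage B1.k (tensor_graded_interior B1.k AP \<sigma> KK) x"
          unfolding gimage_def using x by (intro Fp(5)) (simp add: cring.single_finsupp[OF B1.k_cring])
        also have "\<dots> = ?t1 (\<sigma> x) (?e (conj_aut G P x))"
          unfolding tensor_graded_interior_def gK[symmetric]
          by (rule gimage_make_graded_interior[OF T1.module_axioms])
            (use \<sigma>x e_KK[OF conjK] gK bilinD(3)[OF t1b] in simp)
        finally show ?thesis
          by (rule key[OF conjK gp1(4)[OF x] gp2(4)[OF x] \<sigma>x])
      qed
    qed
    then show ?thesis
      unfolding E_def by blast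
  qed
qed

end

theorem theorem5p1:
  fixes R :: "('r, 'm) ring_scheme" and J :: "'r set" and p :: nat
    and G :: "('g, 'n) monoid_scheme" and P :: "'g set" and K :: "('g \<Rightarrow> 'g) set"
    and A :: "('r, 'a, 'g) interior" and A' :: "('r, 'b, 'g) interior"
  assumes "complete_dvr R J"
    and "ring_characteristic (R Quot J) = p" and "p > 0"
    and "group G"
    and "subgroup P G" and "finite P" and "\<exists>n. card P = p ^ n"
    and "interior_algebra R G A"
    and "interior_algebra R G A'"
    and "\<exists>Y. module_basis R A' Y \<and>
           (\<forall>u\<in>P. \<forall>y\<in>Y. gimage R A' u \<otimes>\<^bsub>A'\<^esub> y \<in> Y \<and> y \<otimes>\<^bsub>A'\<^esub> gimage R A' u \<in> Y)"
    and "subgroup K (aut_group G P)"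
  defines "k \<equiv> R Quot J"
    and "N \<equiv> normalizer_in G P K"
    and "A_P \<equiv> brauer_quotient R J G P A \<one>\<^bsub>aut_group G P\<^esub>"
  shows "(\<exists>F. F \<in> graded_interior_iso k N K
            (N_bar R J G P K (tensor_interior R A A'))
            (diagonal_subalgebra k K (N_bar R J G P K A) (N_bar R J G P K A')))
       \<and> (\<forall>\<sigma> \<in> hom N (units_of A_P).
            (\<exists>F. F \<in> graded_interior_iso k N K
               (N_bar R J G P K A)
               (tensor_graded_interior k A_P \<sigma> (K_algebra k G P K)))
            \<longrightarrow> (\<exists>F. F \<in> graded_interior_iso k N K
               (N_bar R J G P K (tensor_interior R A A'))
               (tensor_graded_interior k A_P \<sigma> (N_bar R J G P K A'))))"
proof -
  have "maximalideal J R"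
    using assms(1) by (simp add: complete_dvr_def)
  then have J: "ideal J R"
    by (rule maximalideal.axioms(1))
  have "brauer_graded R J G P A K" "brauer_graded R J G P A' K"
    using assms J
    by (simp_all add: brauer_graded_def brauer_def brauer_axioms_def interior_algebra_def)
  then interpret brauer_pair R J G P A A' K
    by (rule brauer_pair.intro)
  obtain F1 where F1: "F1 \<in> graded_interior_iso k N K BT.NB GP.Diag"
    using assms(10) tensor_N_bar_iso_diagonal unfolding k_def N_def by blast
  \<comment> \<open>The second claim is the first isomorphism followed by the one leaving the
    diagonal subalgebra.\<close>
  moreover have "\<exists>F. F \<in> graded_interior_iso k N K BT.NB (tensor_graded_interior k A_P \<sigma> B2.NB)"
    if "\<sigma> \<in> hom N (units_of A_P)"
      "\<exists>F. F \<in> graded_interior_iso k N K B1.NB (tensor_graded_interior k A_P \<sigma> KK)" for \<sigma>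
    using diagonal_iso_tensor[of \<sigma>] that graded_interior_iso_comp[OF F1]
    unfolding k_def N_def A_P_def by blast
  ultimately show ?thesis
    unfolding k_def by blast
qed

end
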